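(* Let $(M^n,g)$ be a spin Riemannian manifold of dimension $n$, $A$ a real 1-form on $M^n$, $k_1,k_2\in\mathbb{C}$, and $\hat\nabla_X=\nabla_X+k_1\,\mathrm{cl}(A)\cdot\mathrm{cl}(X)+k_2A(X)$. Let $\epsilon$ be a spinor with $\hat\nabla\epsilon=0$, and define the forms $$\chi_p(X_1,\dots,X_p)=\frac{i^{[p/2]}}{p!}\sum_\sigma(-1)^{|\sigma|}\langle\epsilon,\mathrm{cl}(X_{\sigma(1)})\cdot\mathrm{cl}(X_{\sigma(2)})\cdots\mathrm{cl}(X_{\sigma(p)})\epsilon\rangle .$$ Then the forms $\chi_p$ define a covariant form hierarchy on $M^n$ twisted with $A$; explicitly, for every $p$ and every vector field $Y$, $$\nabla_Y\chi_p+2\,\mathrm{Re}(2k_1+k_2)A(Y)\chi_p=\frac1{p+1}\,i_Y\Big(d\chi_p+2\,\mathrm{Re}(2k_1+k_2)A\wedge\chi_p\Big)-\frac1{n-p+1}\,\alpha_Y\wedge\Big(\delta\chi_p-2\,\mathrm{Re}(2k_1+k_2)\,i_A\chi_p\Big).$$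
   Context: $\nabla$ is the Levi-Civita connection, also acting on sections of the complex spinor bundle $S$. Clifford conventions: $\mathrm{cl}(X)$ denotes Clifford multiplication by $X$, $\mathrm{cl}(X)\cdot\mathrm{cl}(Y)+\mathrm{cl}(Y)\cdot\mathrm{cl}(X)=2g(X,Y)1$; $S$ carries a pointwise Spin-invariant Hermitian inner product $\langle\cdot,\cdot\rangle$ (linear in the second slot) with $\langle\mathrm{cl}(X)\eta,\epsilon\rangle=\langle\eta,\mathrm{cl}(X)\epsilon\rangle$ for real $X$. $\mathrm{cl}(A)=A_i\Gamma^i$ in an orthonormal frame with Clifford elements $\Gamma^i$. The sum is over permutations $\sigma$ of $\{1,\dots,p\}$ with $(-1)^{|\sigma|}$ the sign, and $[\cdot]$ is the integer part. $\alpha_Y(X)=g(Y,X)$; $i_A$ is contraction with the vector field dual to $A$; $\delta$ is the formal adjoint of $d$, i.e. $(\delta\chi)_{i_2\dots i_p}=-\nabla^{i_1}\chi_{i_1i_2\dots i_p}$. Definition: given a multi-form $F$ on $(M^n,g)$, a covariant form hierarchy twisted with $F$ is a collection of forms $\chi_p$ satisfying $\nabla^F_Y(\{\chi_p\})=i_Y\mathcal{P}(F,\{\chi_p\})+\alpha_Y\wedge\mathcal{Q}(F,\{\chi_p\})$, where $\mathcal P,\mathcal Q$ are maps into forms depending on $F$ and $\{\chi_p\}$ and $\nabla^F$ is a (not necessarily degree preserving) connection on (sums of copies of) $\Lambda^*(M)$ built from the Levi-Civita connection and $F$. *)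

theory Defs
  imports "HOL-Analysis.Analysis"
begin

section \<open>Smooth manifolds, tensor fields and the Levi-Civita connection\<close>

text \<open>
  Tensor calculus is done in components with respect to the charts of a smooth atlas.  A manifold
  is a whole Hausdorff second countable type \<open>'m\<close>; a chart is a pair \<open>(U, \<phi>)\<close> of its domain and its
  coordinate map into \<open>real ^ 'n\<close>, so that the dimension of the manifold is \<open>CARD('n)\<close>.
\<close>

primrec Ck_on ::
  "nat \<Rightarrow> 'a::real_normed_vector set \<Rightarrow> ('a \<Rightarrow> 'b::real_normed_vector) \<Rightarrow> bool" where
  "Ck_on 0 U f \<longleftrightarrow> continuous_on U f"
| "Ck_on (Suc k) U f \<longleftrightarrow> (\<forall>x\<in>U. f differentiable (at x)) \<and>
     (\<forall>v. Ck_on k U (\<lambda>x. frechet_derivative f (at x) v))"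

text \<open>Only used for open sets \<open>U\<close>.\<close>

definition smooth_on :: "'a::real_normed_vector set \<Rightarrow> ('a \<Rightarrow> 'b::real_normed_vector) \<Rightarrow> bool" where
  "smooth_on U f \<longleftrightarrow> (\<forall>k. Ck_on k U f)"

type_synonym ('m, 'n) chart = "'m set \<times> ('m \<Rightarrow> real ^ 'n)"

definition in_chart :: "('m, 'n) chart \<Rightarrow> ('m \<Rightarrow> 'b) \<Rightarrow> (real ^ 'n) \<Rightarrow> 'b" where
  "in_chart c f = f \<circ> inv_into (fst c) (snd c)"

definition smooth_in_chart ::
  "('m, 'n::finite) chart \<Rightarrow> 'm set \<Rightarrow> ('m \<Rightarrow> 'b::real_normed_vector) \<Rightarrow> bool" where
  "smooth_in_chart c W f \<longleftrightarrow> smooth_on (snd c ` (fst c \<inter> W)) (in_chart c f)"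

text \<open>The derivative of \<open>f\<close> at \<open>x\<close> along the tangent vector with components \<open>u\<close> in the chart \<open>c\<close>.
  In particular \<open>deriv_in c (snd c') x\<close> is the Jacobian at \<open>x\<close> of the change from \<open>c\<close> to \<open>c'\<close>.\<close>

definition deriv_in ::
  "('m, 'n::finite) chart \<Rightarrow> ('m \<Rightarrow> 'b::real_normed_vector) \<Rightarrow> 'm \<Rightarrow> real ^ 'n \<Rightarrow> 'b" where
  "deriv_in c f x u = frechet_derivative (in_chart c f) (at (snd c x)) u"

definition is_chart :: "('m::topological_space, 'n::finite) chart \<Rightarrow> bool" where
  "is_chart c \<longleftrightarrow> open (fst c) \<and> open (snd c ` fst c) \<and>
     homeomorphism (fst c) (snd c ` fst c) (snd c) (inv_into (fst c) (snd c))"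

definition smooth_atlas :: "('m::topological_space, 'n::finite) chart set \<Rightarrow> bool" where
  "smooth_atlas At \<longleftrightarrow> (\<forall>c\<in>At. is_chart c) \<and> (\<Union>c\<in>At. fst c) = UNIV \<and>
     (\<forall>c\<in>At. \<forall>c'\<in>At. smooth_in_chart c (fst c') (snd c'))"

text \<open>
  Vector fields and covariant tensor fields give, for every chart and every point of its domain, the
  components in that chart.  Values outside the atlas or outside the chart domain are irrelevant.
  A multi-form is evaluated on lists of tangent vectors: its degree \<open>p\<close> part is its restriction to
  lists of length \<open>p\<close>.  Forms take values in a real vector space \<open>'b\<close>, i.e. they are sections of
  \<open>\<Lambda>\<^sup>* \<otimes> 'b\<close>, a sum of copies of \<open>\<Lambda>\<^sup>*\<close>.
\<close>

type_synonym ('m, 'n) vfield = "('m, 'n) chart \<Rightarrow> 'm \<Rightarrow> real ^ 'n"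

type_synonym ('m, 'n, 'b) mform = "('m, 'n) chart \<Rightarrow> 'm \<Rightarrow> (real ^ 'n) list \<Rightarrow> 'b"

record ('m, 'n::finite) riemannian =
  atlas :: "('m, 'n) chart set"
  gm :: "('m, 'n) chart \<Rightarrow> 'm \<Rightarrow> real ^ 'n \<Rightarrow> real ^ 'n \<Rightarrow> real"

definition inner_product_form :: "(real ^ 'n::finite \<Rightarrow> real ^ 'n \<Rightarrow> real) \<Rightarrow> bool" where
  "inner_product_form g \<longleftrightarrow>
     bilinear g \<and> (\<forall>u v. g u v = g v u) \<and> (\<forall>u. u \<noteq> 0 \<longrightarrow> g u u > 0)"

definition riemannian_manifold ::
  "('m::{t2_space, second_countable_topology}, 'n::finite, 'z) riemannian_scheme \<Rightarrow> bool" where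
  "riemannian_manifold M \<longleftrightarrow> smooth_atlas (atlas M) \<and>
     (\<forall>c\<in>atlas M. \<forall>x\<in>fst c. inner_product_form (gm M c x)) \<and>
     (\<forall>c\<in>atlas M. \<forall>u v. smooth_in_chart c UNIV (\<lambda>x. gm M c x u v)) \<and>
     (\<forall>c\<in>atlas M. \<forall>c'\<in>atlas M. \<forall>x\<in>fst c \<inter> fst c'. \<forall>u v.
        gm M c' x (deriv_in c (snd c') x u) (deriv_in c (snd c') x v) = gm M c x u v)"

definition vector_field_on ::
  "('m::topological_space, 'n::finite, 'z) riemannian_scheme \<Rightarrow> 'm set \<Rightarrow> ('m, 'n) vfield \<Rightarrow> bool" where
  "vector_field_on M W X \<longleftrightarrow> (\<forall>c\<in>atlas M. smooth_in_chart c W (X c)) \<and>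
     (\<forall>c\<in>atlas M. \<forall>c'\<in>atlas M. \<forall>x\<in>fst c \<inter> fst c' \<inter> W.
        X c' x = deriv_in c (snd c') x (X c x))"

abbreviation vector_field ::
  "('m::topological_space, 'n::finite, 'z) riemannian_scheme \<Rightarrow> ('m, 'n) vfield \<Rightarrow> bool" where
  "vector_field M X \<equiv> vector_field_on M UNIV X"

definition alternating_multilinear :: "((real ^ 'n::finite) list \<Rightarrow> 'b::real_vector) \<Rightarrow> bool" where
  "alternating_multilinear \<omega> \<longleftrightarrow>
     (\<forall>xs i. i < length xs \<longrightarrow> linear (\<lambda>v. \<omega> (xs[i := v]))) \<and>
     (\<forall>xs i j. i < j \<and> j < length xs \<and> xs ! i = xs ! j \<longrightarrow> \<omega> xs = 0)"

definition multi_form ::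
  "('m::topological_space, 'n::finite, 'z) riemannian_scheme
     \<Rightarrow> ('m, 'n, 'b::real_normed_vector) mform \<Rightarrow> bool" where
  "multi_form M \<omega> \<longleftrightarrow>
     (\<forall>c\<in>atlas M. \<forall>x\<in>fst c. alternating_multilinear (\<omega> c x)) \<and>
     (\<forall>c\<in>atlas M. \<forall>xs. smooth_in_chart c UNIV (\<lambda>x. \<omega> c x xs)) \<and>
     (\<forall>c\<in>atlas M. \<forall>c'\<in>atlas M. \<forall>x\<in>fst c \<inter> fst c'. \<forall>xs.
        \<omega> c' x (map (deriv_in c (snd c') x) xs) = \<omega> c x xs)"

definition p_form ::
  "('m::topological_space, 'n::finite, 'z) riemannian_scheme \<Rightarrow> nat
     \<Rightarrow> ('m, 'n, 'b::real_normed_vector) mform \<Rightarrow> bool" where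
  "p_form M p \<omega> \<longleftrightarrow> multi_form M \<omega> \<and>
     (\<forall>c\<in>atlas M. \<forall>x\<in>fst c. \<forall>xs. length xs \<noteq> p \<longrightarrow> \<omega> c x xs = 0)"

definition form_eq ::
  "('m, 'n::finite, 'z) riemannian_scheme \<Rightarrow> ('m, 'n, 'b) mform \<Rightarrow> ('m, 'n, 'b) mform \<Rightarrow> bool" where
  "form_eq M \<omega> \<eta> \<longleftrightarrow> (\<forall>c\<in>atlas M. \<forall>x\<in>fst c. \<forall>xs. \<omega> c x xs = \<eta> c x xs)"

text \<open>The Christoffel symbols in the chart \<open>c\<close>, as a bilinear map: the unique torsion free metric
  connection.\<close>

definition christoffel ::
  "('m, 'n::finite, 'z) riemannian_scheme
     \<Rightarrow> ('m, 'n) chart \<Rightarrow> 'm \<Rightarrow> real ^ 'n \<Rightarrow> real ^ 'n \<Rightarrow> real ^ 'n" where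
  "christoffel M c x = (THE G. bilinear G \<and> (\<forall>u v. G u v = G v u) \<and>
     (\<forall>u v w. deriv_in c (\<lambda>y. gm M c y u v) x w = gm M c x (G w u) v + gm M c x u (G w v)))"

definition nabla_vf ::
  "('m, 'n::finite, 'z) riemannian_scheme \<Rightarrow> ('m, 'n) vfield
     \<Rightarrow> ('m, 'n) chart \<Rightarrow> 'm \<Rightarrow> real ^ 'n \<Rightarrow> real ^ 'n" where
  "nabla_vf M X c x u = deriv_in c (X c) x u + christoffel M c x u (X c x)"

definition nabla_at ::
  "('m, 'n::finite, 'z) riemannian_scheme \<Rightarrow> ('m, 'n, 'b::real_normed_vector) mform
     \<Rightarrow> ('m, 'n) chart \<Rightarrow> 'm \<Rightarrow> real ^ 'n \<Rightarrow> (real ^ 'n) list \<Rightarrow> 'b" where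
  "nabla_at M \<omega> c x u xs = deriv_in c (\<lambda>y. \<omega> c y xs) x u
     - (\<Sum>i<length xs. \<omega> c x (xs[i := christoffel M c x u (xs ! i)]))"

definition nabla ::
  "('m, 'n::finite, 'z) riemannian_scheme \<Rightarrow> ('m, 'n) vfield
     \<Rightarrow> ('m, 'n, 'b::real_normed_vector) mform \<Rightarrow> ('m, 'n, 'b) mform" where
  "nabla M Y \<omega> = (\<lambda>c x xs. nabla_at M \<omega> c x (Y c x) xs)"

definition contract ::
  "('m, 'n) vfield \<Rightarrow> ('m, 'n, 'b) mform \<Rightarrow> ('m, 'n, 'b) mform" where
  "contract X \<omega> = (\<lambda>c x xs. \<omega> c x (X c x # xs))"

definition remove_nth :: "nat \<Rightarrow> 'a list \<Rightarrow> 'a list" where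
  "remove_nth i xs = take i xs @ drop (Suc i) xs"

text \<open>Exterior product with a 1-form, and exterior derivative, normalised by
  \<open>\<alpha> \<and> \<beta> = \<alpha> \<otimes> \<beta> - \<beta> \<otimes> \<alpha>\<close> for 1-forms and by
  \<open>(d\<omega>)(X\<^sub>0, \<dots>, X\<^sub>p) = \<Sum>\<^sub>i (-1)\<^sup>i X\<^sub>i (\<omega>(\<dots>))\<close> on coordinate vector fields.\<close>

definition wedge1 ::
  "('m, 'n, real) mform \<Rightarrow> ('m, 'n, 'b::real_vector) mform \<Rightarrow> ('m, 'n, 'b) mform" where
  "wedge1 \<alpha> \<omega> = (\<lambda>c x xs.
     \<Sum>i<length xs. ((-1) ^ i * \<alpha> c x [xs ! i]) *\<^sub>R \<omega> c x (remove_nth i xs))"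

definition ext_d ::
  "('m, 'n::finite, 'b::real_normed_vector) mform \<Rightarrow> ('m, 'n, 'b) mform" where
  "ext_d \<omega> = (\<lambda>c x xs.
     \<Sum>i<length xs. (-1) ^ i *\<^sub>R deriv_in c (\<lambda>y. \<omega> c y (remove_nth i xs)) x (xs ! i))"

definition inverse_metric ::
  "('m, 'n::finite, 'z) riemannian_scheme \<Rightarrow> ('m, 'n) chart \<Rightarrow> 'm \<Rightarrow> real ^ 'n ^ 'n" where
  "inverse_metric M c x = matrix_inv (\<chi> i j. gm M c x (axis i 1) (axis j 1))"

definition codiff ::
  "('m, 'n::finite, 'z) riemannian_scheme \<Rightarrow> ('m, 'n, 'b::real_normed_vector) mform
     \<Rightarrow> ('m, 'n, 'b) mform" where
  "codiff M \<omega> = (\<lambda>c x xs. - (\<Sum>i\<in>UNIV. \<Sum>j\<in>UNIV.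
     inverse_metric M c x $ i $ j *\<^sub>R nabla_at M \<omega> c x (axis i 1) (axis j 1 # xs)))"

text \<open>The 1-form \<open>\<alpha>\<^sub>Y\<close> dual to a vector field, and the vector field dual to a 1-form.\<close>

definition flat :: "('m, 'n::finite, 'z) riemannian_scheme \<Rightarrow> ('m, 'n) vfield \<Rightarrow> ('m, 'n, real) mform" where
  "flat M Y = (\<lambda>c x xs. case xs of [v] \<Rightarrow> gm M c x (Y c x) v | _ \<Rightarrow> 0)"

definition sharp :: "('m, 'n::finite, 'z) riemannian_scheme \<Rightarrow> ('m, 'n, real) mform \<Rightarrow> ('m, 'n) vfield" where
  "sharp M A = (\<lambda>c x. THE v. \<forall>u. gm M c x v u = A c x [u])"


section \<open>Covariant form hierarchies\<close>

text \<open>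
  The connections built from the Levi-Civita connection and a multi-form \<open>F\<close> are
  \<open>\<nabla>\<^sub>Y + T g F Y\<close>, where \<open>T\<close> is a bundle endomorphism of the multi-forms, not necessarily degree
  preserving, that depends linearly on \<open>Y\<close> and is determined pointwise by the metric and \<open>F\<close>.
\<close>

definition connection_term ::
  "('m::topological_space, 'n::finite, 'z) riemannian_scheme \<Rightarrow>
   ((real ^ 'n \<Rightarrow> real ^ 'n \<Rightarrow> real) \<Rightarrow> ((real ^ 'n) list \<Rightarrow> real) \<Rightarrow> real ^ 'n \<Rightarrow>
      ((real ^ 'n) list \<Rightarrow> 'b::real_normed_vector) \<Rightarrow> (real ^ 'n) list \<Rightarrow> 'b) \<Rightarrow> bool" where
  "connection_term M T \<longleftrightarrow>
     (\<forall>g F. inner_product_form g \<and> alternating_multilinear F \<longrightarrow>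
        (\<forall>\<psi> xs. alternating_multilinear \<psi> \<longrightarrow> linear (\<lambda>v. T g F v \<psi> xs)) \<and>
        (\<forall>v \<psi> \<psi>' r s xs. alternating_multilinear \<psi> \<and> alternating_multilinear \<psi>' \<longrightarrow>
           T g F v (\<lambda>ys. r *\<^sub>R \<psi> ys + s *\<^sub>R \<psi>' ys) xs
             = r *\<^sub>R T g F v \<psi> xs + s *\<^sub>R T g F v \<psi>' xs)) \<and>
     (\<forall>F Y \<psi>. multi_form M F \<and> vector_field M Y \<and> multi_form M \<psi> \<longrightarrow>
        multi_form M (\<lambda>c x. T (gm M c x) (F c x) (Y c x) (\<psi> c x)))"

definition covariant_form_hierarchy ::
  "('m::topological_space, 'n::finite, 'z) riemannian_scheme \<Rightarrow> ('m, 'n, real) mform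
     \<Rightarrow> ('m, 'n, 'b::real_normed_vector) mform \<Rightarrow> bool" where
  "covariant_form_hierarchy M F \<omega> \<longleftrightarrow> multi_form M F \<and> multi_form M \<omega> \<and>
     (\<exists>T P Q. connection_term M T \<and>
        (\<forall>F' \<psi>. multi_form M F' \<and> multi_form M \<psi> \<longrightarrow>
           multi_form M (P F' \<psi>) \<and> multi_form M (Q F' \<psi>)) \<and>
        (\<forall>Y. vector_field M Y \<longrightarrow>
           form_eq M
             (\<lambda>c x xs. nabla M Y \<omega> c x xs + T (gm M c x) (F c x) (Y c x) (\<omega> c x) xs)
             (\<lambda>c x xs. contract Y (P F \<omega>) c x xs + wedge1 (flat M Y) (Q F \<omega>) c x xs)))"


section \<open>Spin structures and spinors\<close>

text \<open>\<open>cliff \<Gamma> v\<close> is Clifford multiplication by the vector \<open>v\<close> of Euclidean space on the module of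
  column vectors \<open>complex ^ 's\<close>.\<close>

definition cliff :: "('n::finite \<Rightarrow> complex ^ 's ^ 's) \<Rightarrow> real ^ 'n \<Rightarrow> complex ^ 's ^ 's" where
  "cliff \<Gamma> v = (\<Sum>i\<in>UNIV. v $ i *\<^sub>R \<Gamma> i)"

definition clifford_relations :: "('n \<Rightarrow> complex ^ 's ^ 's::finite) \<Rightarrow> bool" where
  "clifford_relations \<Gamma> \<longleftrightarrow>
     (\<forall>i j. \<Gamma> i ** \<Gamma> j + \<Gamma> j ** \<Gamma> i = (if i = j then mat 2 else 0))"

definition irreducible_module :: "('n \<Rightarrow> complex ^ 's ^ 's::finite) \<Rightarrow> bool" where
  "irreducible_module \<Gamma> \<longleftrightarrow>
     (\<forall>W. vec.subspace W \<and> (\<forall>i. \<forall>w\<in>W. \<Gamma> i *v w \<in> W) \<longrightarrow> W = {0} \<or> W = UNIV)"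

text \<open>An irreducible complex module of the full Clifford algebra is faithful on its even part, so
  \<open>Spin(n)\<close> is the group of even products of unit vectors, as endomorphisms of the module.\<close>

definition spin_group :: "('n::finite \<Rightarrow> complex ^ 's ^ 's::finite) \<Rightarrow> (complex ^ 's ^ 's) set" where
  "spin_group \<Gamma> = {foldr (\<lambda>v s. cliff \<Gamma> v ** s) vs (mat 1) | vs.
     even (length vs) \<and> (\<forall>v\<in>set vs. norm v = 1)}"

text \<open>Linear in the second slot.\<close>

definition hermitian_inner_product ::
  "(complex ^ 's \<Rightarrow> complex ^ 's \<Rightarrow> complex) \<Rightarrow> bool" where
  "hermitian_inner_product h \<longleftrightarrow>
     (\<forall>\<eta> \<zeta> \<xi>. h \<eta> (\<zeta> + \<xi>) = h \<eta> \<zeta> + h \<eta> \<xi>) \<and>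
     (\<forall>\<eta> k \<zeta>. h \<eta> (k *s \<zeta>) = k * h \<eta> \<zeta>) \<and>
     (\<forall>\<eta> \<zeta>. h \<zeta> \<eta> = cnj (h \<eta> \<zeta>)) \<and>
     (\<forall>\<eta>. \<eta> \<noteq> 0 \<longrightarrow> Re (h \<eta> \<eta>) > 0)"

text \<open>
  A spin structure is given by local orthonormal frames \<open>frame S a\<close> on the open sets \<open>dom_of S a\<close> of a
  cover, together with a cocycle \<open>transition S a b\<close> in \<open>Spin(n)\<close> that lifts the transition functions of
  the frames.  The spinor bundle is the bundle associated to this cocycle by the representation of
  \<open>Spin(n)\<close> on the irreducible module \<open>complex ^ 's\<close>.
\<close>

record ('m, 'n::finite, 'i, 's::finite) spin_riemannian = "('m, 'n) riemannian" +
  frames :: "'i set"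
  dom_of :: "'i \<Rightarrow> 'm set"
  frame :: "'i \<Rightarrow> 'n \<Rightarrow> ('m, 'n) vfield"
  transition :: "'i \<Rightarrow> 'i \<Rightarrow> 'm \<Rightarrow> complex ^ 's ^ 's"
  gam :: "'n \<Rightarrow> complex ^ 's ^ 's"
  ip :: "complex ^ 's \<Rightarrow> complex ^ 's \<Rightarrow> complex"

text \<open>Clifford multiplication by a tangent vector and by a 1-form, in the frame \<open>a\<close>.\<close>

definition cl ::
  "('m, 'n::finite, 'i, 's) spin_riemannian \<Rightarrow> 'i \<Rightarrow> ('m, 'n) chart \<Rightarrow> 'm \<Rightarrow> real ^ 'n
     \<Rightarrow> complex ^ 's ^ 's" where
  "cl S a c x u = cliff (gam S) (\<chi> i. gm S c x u (frame S a i c x))"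

definition cl_form ::
  "('m, 'n::finite, 'i, 's) spin_riemannian \<Rightarrow> 'i \<Rightarrow> ('m, 'n) chart \<Rightarrow> 'm \<Rightarrow> ('m, 'n, real) mform
     \<Rightarrow> complex ^ 's ^ 's" where
  "cl_form S a c x A = cliff (gam S) (\<chi> i. A c x [frame S a i c x])"

text \<open>
  Writing \<open>s = transition S a b x\<close>, the equation \<open>s cl\<^sub>b(u) = cl\<^sub>a(u) s\<close> says that the components of every
  tangent vector in the frames \<open>a\<close> and \<open>b\<close> are related by the image of \<open>s\<close> under the covering
  \<open>Spin(n) \<rightarrow> SO(n)\<close>; in particular the frames are consistently oriented.  Invariance of the inner
  product under \<open>Spin(n)\<close> follows from the self-adjointness of Clifford multiplication.
\<close>

definition spin_riemannian_manifold ::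
  "('m::{t2_space, second_countable_topology}, 'n::finite, 'i, 's::finite) spin_riemannian \<Rightarrow> bool"
  where
  "spin_riemannian_manifold S \<longleftrightarrow> riemannian_manifold S \<and>
     (\<comment> \<open>the spin representation and its inner product\<close>
      clifford_relations (gam S) \<and> irreducible_module (gam S) \<and>
      hermitian_inner_product (ip S) \<and>
      (\<forall>i \<eta> \<zeta>. ip S (gam S i *v \<eta>) \<zeta> = ip S \<eta> (gam S i *v \<zeta>))) \<and>
     (\<comment> \<open>the local orthonormal frames\<close>
      (\<forall>a\<in>frames S. open (dom_of S a)) \<and> (\<Union>a\<in>frames S. dom_of S a) = UNIV \<and>
      (\<forall>a\<in>frames S. \<forall>i. vector_field_on S (dom_of S a) (frame S a i)) \<and>
      (\<forall>a\<in>frames S. \<forall>c\<in>atlas S. \<forall>x\<in>fst c \<inter> dom_of S a. \<forall>i j.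
         gm S c x (frame S a i c x) (frame S a j c x) = (if i = j then 1 else 0))) \<and>
     (\<comment> \<open>the lift of the transition functions to the spin group\<close>
      (\<forall>a\<in>frames S. \<forall>b\<in>frames S. \<forall>c\<in>atlas S.
         smooth_in_chart c (dom_of S a \<inter> dom_of S b) (transition S a b)) \<and>
      (\<forall>a\<in>frames S. \<forall>b\<in>frames S. \<forall>x\<in>dom_of S a \<inter> dom_of S b.
         transition S a b x \<in> spin_group (gam S)) \<and>
      (\<forall>a\<in>frames S. \<forall>b\<in>frames S. \<forall>c\<in>atlas S. \<forall>x\<in>fst c \<inter> dom_of S a \<inter> dom_of S b. \<forall>u.
         transition S a b x ** cl S b c x u = cl S a c x u ** transition S a b x) \<and>
      (\<forall>a\<in>frames S. \<forall>b\<in>frames S. \<forall>d\<in>frames S.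
         \<forall>x\<in>dom_of S a \<inter> dom_of S b \<inter> dom_of S d.
           transition S a b x ** transition S b d x = transition S a d x))"

text \<open>Smooth sections of the spinor bundle, given by their components in the frames.\<close>

type_synonym ('m, 'i, 's) spinor = "'i \<Rightarrow> 'm \<Rightarrow> complex ^ 's"

definition spinor_field ::
  "('m, 'n::finite, 'i, 's::finite) spin_riemannian \<Rightarrow> ('m, 'i, 's) spinor \<Rightarrow> bool" where
  "spinor_field S \<epsilon> \<longleftrightarrow>
     (\<forall>a\<in>frames S. \<forall>c\<in>atlas S. smooth_in_chart c (dom_of S a) (\<epsilon> a)) \<and>
     (\<forall>a\<in>frames S. \<forall>b\<in>frames S. \<forall>x\<in>dom_of S a \<inter> dom_of S b. \<epsilon> a x = transition S a b x *v \<epsilon> b x)"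

text \<open>The Levi-Civita connection on spinors, \<open>\<nabla>\<^sub>u \<epsilon> = u(\<epsilon>) + 1/4 \<Omega>\<^sub>i\<^sub>j(u) \<Gamma>\<^sup>i \<Gamma>\<^sup>j \<epsilon>\<close> with
  \<open>\<Omega>\<^sub>i\<^sub>j(u) = g(e\<^sub>i, \<nabla>\<^sub>u e\<^sub>j)\<close>.\<close>

definition spin_nabla ::
  "('m, 'n::finite, 'i, 's::finite) spin_riemannian \<Rightarrow> ('m, 'i, 's) spinor
     \<Rightarrow> 'i \<Rightarrow> ('m, 'n) chart \<Rightarrow> 'm \<Rightarrow> real ^ 'n \<Rightarrow> complex ^ 's" where
  "spin_nabla S \<epsilon> a c x u = deriv_in c (\<epsilon> a) x u +
     (1 / 4) *\<^sub>R (\<Sum>i\<in>UNIV. \<Sum>j\<in>UNIV.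
        gm S c x (frame S a i c x) (nabla_vf S (frame S a j) c x u) *\<^sub>R
          (gam S i *v (gam S j *v \<epsilon> a x)))"

definition hat_nabla ::
  "('m, 'n::finite, 'i, 's::finite) spin_riemannian \<Rightarrow> complex \<Rightarrow> complex \<Rightarrow> ('m, 'n, real) mform
     \<Rightarrow> ('m, 'i, 's) spinor \<Rightarrow> 'i \<Rightarrow> ('m, 'n) chart \<Rightarrow> 'm \<Rightarrow> real ^ 'n \<Rightarrow> complex ^ 's" where
  "hat_nabla S k\<^sub>1 k\<^sub>2 A \<epsilon> a c x u = spin_nabla S \<epsilon> a c x u +
     k\<^sub>1 *s (cl_form S a c x A *v (cl S a c x u *v \<epsilon> a x)) +
     (k\<^sub>2 * of_real (A c x [u])) *s \<epsilon> a x"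

definition hat_parallel ::
  "('m, 'n::finite, 'i, 's::finite) spin_riemannian \<Rightarrow> complex \<Rightarrow> complex \<Rightarrow> ('m, 'n, real) mform
     \<Rightarrow> ('m, 'i, 's) spinor \<Rightarrow> bool" where
  "hat_parallel S k\<^sub>1 k\<^sub>2 A \<epsilon> \<longleftrightarrow>
     (\<forall>a\<in>frames S. \<forall>c\<in>atlas S. \<forall>x\<in>fst c \<inter> dom_of S a. \<forall>u. hat_nabla S k\<^sub>1 k\<^sub>2 A \<epsilon> a c x u = 0)"

text \<open>The bilinears \<open>\<chi>\<^sub>p\<close>.  They do not depend on the frame chosen at \<open>x\<close>.  Permutations act on the
  indices \<open>0, \<dots>, p - 1\<close>.\<close>

definition spinor_form ::
  "('m, 'n::finite, 'i, 's::finite) spin_riemannian \<Rightarrow> ('m, 'i, 's) spinor \<Rightarrow> nat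
     \<Rightarrow> ('m, 'n, complex) mform" where
  "spinor_form S \<epsilon> p = (\<lambda>c x xs.
     if length xs = p then
       let a = (SOME a. a \<in> frames S \<and> x \<in> dom_of S a) in
         \<i> ^ (p div 2) / fact p *
         (\<Sum>\<sigma> | \<sigma> permutes {..<p}. of_int (sign \<sigma>) *
            ip S (\<epsilon> a x) (foldr (\<lambda>i \<eta>. cl S a c x (xs ! \<sigma> i) *v \<eta>) [0..<p] (\<epsilon> a x)))
     else 0)"

text \<open>The multi-form with components \<open>\<chi>\<^sub>p\<close>.\<close>

definition spinor_multi_form ::
  "('m, 'n::finite, 'i, 's::finite) spin_riemannian \<Rightarrow> ('m, 'i, 's) spinor
     \<Rightarrow> ('m, 'n, complex) mform" where
  "spinor_multi_form S \<epsilon> = (\<lambda>c x xs. spinor_form S \<epsilon> (length xs) c x xs)"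

end

theory Submission
  imports Defs
begin

text \<open>
  At a point, \<open>\<chi>\<^sub>p\<close> is, up to a power of \<open>\<i>\<close>, \<open>\<langle>\<epsilon>, cl\<^sub>p \<epsilon>\<rangle>\<close> with \<open>cl\<^sub>p\<close> the antisymmetrised Clifford
  product.  The Levi-Civita part of \<open>\<nabla>\<^sub>Y \<epsilon>\<close> is skew and turns the derivative of the bilinear into
  \<open>\<nabla>\<^sub>Y \<chi>\<^sub>p\<close>; what remains are the bilinears of \<open>cl\<^sub>p cl(A) cl(Y)\<close> and \<open>cl(Y) cl(A) cl\<^sub>p\<close>.  Multiplication
  by \<open>cl(v)\<close> from the left or from the right acts on \<open>cl\<^sub>p\<close>, up to sign, as \<open>\<iota>\<^sub>v + v \<and>\<close> or \<open>\<iota>\<^sub>v - v \<and>\<close>.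
  Sorting the resulting operators with the anticommutation relations gives
  \<open>\<nabla>\<^sub>Y \<chi> + 2 Re(2k\<^sub>1 + k\<^sub>2) A(Y) \<chi> = \<iota>\<^sub>Y P + \<alpha>\<^sub>Y \<and> Q\<close> with
  \<open>P = 2 Re k\<^sub>1 A \<and> \<chi> - 2 Im k\<^sub>1 \<iota>\<^sub>A \<chi>\<close> and \<open>Q = 2 Re k\<^sub>1 \<iota>\<^sub>A \<chi> + 2 Im k\<^sub>1 A \<and> \<chi>\<close>.  Antisymmetrising
  and tracing this equation expresses \<open>P\<close> through \<open>d\<chi>\<^sub>p\<close> and \<open>Q\<close> through \<open>\<delta>\<chi>\<^sub>p\<close>.  For \<open>p = n + 1\<close>, where
  the factor \<open>1/(n - p + 1)\<close> is the junk value 0, all terms vanish because alternating maps of more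
  than \<open>n\<close> arguments do.
\<close>

section \<open>Alternating functions on lists\<close>

text \<open>The degree of a multi-form is the length of its argument list, so all
  \<open>\<chi>\<^sub>p\<close> are treated at once; a degree enters only through phases and signs
  that depend on the length. The obstacle is that the sum over permutations in
  \<open>cl\<^sub>p\<close> is awkward to multiply. Both sides of an identity for
  \<open>cl\<^sub>p\<close> alternate, so it can be tested on tuples of distinct vectors of an
  orthonormal basis, where the factors anticommute and \<open>cl\<^sub>p\<close> is a plain product.
  The product \<open>cl\<^sub>p cl(A) cl(Y)\<close> comes with \<open>k\<^sub>1\<close> and
  \<open>cl(Y) cl(A) cl\<^sub>p\<close> with its conjugate. Their parts of degree \<open>p\<close>
  agree, which leaves \<open>Re k\<^sub>1\<close>; their parts of degree \<open>p + 2\<close> and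
  \<open>p - 2\<close> are opposite, which leaves \<open>\<i> Im k\<^sub>1\<close>, and the phase
  \<open>\<i> ^ (p div 2)\<close> absorbs that \<open>\<i>\<close>. Antisymmetrising
  \<open>\<iota>\<^sub>Y P\<close> returns \<open>(p + 1) P\<close>, while
  \<open>\<alpha>\<^sub>Y \<and> Q\<close> dies by the symmetry of the metric. In the trace the
  double contraction of \<open>P\<close> dies, and \<open>Q\<close> is multiplied by
  \<open>n - (p - 1)\<close>.\<close>

lemma remove_nth_0 [simp]: "remove_nth 0 (v # xs) = xs"
  by (simp add: remove_nth_def)

lemma remove_nth_Suc [simp]: "remove_nth (Suc i) (v # xs) = v # remove_nth i xs"
  by (simp add: remove_nth_def)

lemma length_remove_nth: "i < length xs \<Longrightarrow> length (remove_nth i xs) = length xs - 1"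
  by (simp add: remove_nth_def)

lemma remove_nth_map: "remove_nth i (map h xs) = map h (remove_nth i xs)"
  by (simp add: remove_nth_def take_map drop_map)

text \<open>The shape shared by the exterior product with a covector and the exterior derivative:
  \<open>u\<close> is the entry that is singled out, \<open>ys\<close> are the remaining
  ones.\<close>

definition alt_sum :: "('a \<Rightarrow> 'a list \<Rightarrow> 'b::real_vector) \<Rightarrow> 'a list \<Rightarrow> 'b" where
  "alt_sum H xs = (\<Sum>i<length xs. (-1) ^ i *\<^sub>R H (xs ! i) (remove_nth i xs))"

lemma alt_sum_Nil [simp]: "alt_sum H [] = 0"
  by (simp add: alt_sum_def)

text \<open>Splitting off the head lowers every other index by one, whence the minus sign. This
  recursion lets induction over the list replace index arithmetic.\<close>

lemma alt_sum_Cons [simp]: "alt_sum H (v # xs) = H v xs - alt_sum (\<lambda>u ys. H u (v # ys)) xs"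
  unfolding alt_sum_def by (simp add: sum.lessThan_Suc_shift sum_negf del: sum.lessThan_Suc)

lemma alt_sum_0 [simp]: "alt_sum (\<lambda>u ys. 0) xs = 0"
  by (simp add: alt_sum_def)

lemma alt_sum_add: "alt_sum (\<lambda>u ys. H u ys + K u ys) xs = alt_sum H xs + alt_sum K xs"
  by (simp add: alt_sum_def scaleR_right_distrib sum.distrib)

lemma alt_sum_diff: "alt_sum (\<lambda>u ys. H u ys - K u ys) xs = alt_sum H xs - alt_sum K xs"
  by (simp add: alt_sum_def scaleR_right_diff_distrib sum_subtractf)

lemma alt_sum_minus: "alt_sum (\<lambda>u ys. - H u ys) xs = - alt_sum H xs"
  by (simp add: alt_sum_def sum_negf)

lemma alt_sum_linear: "linear f \<Longrightarrow> alt_sum (\<lambda>u ys. f (H u ys)) xs = f (alt_sum H xs)"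
  by (simp add: alt_sum_def linear_sum linear_scale)

lemma alt_sum_scaleR: "alt_sum (\<lambda>u ys. r *\<^sub>R H u ys) xs = r *\<^sub>R alt_sum H xs"
  by (rule alt_sum_linear) simp

lemma alt_sum_sum: "alt_sum (\<lambda>u ys. \<Sum>k\<in>I. H k u ys) xs = (\<Sum>k\<in>I. alt_sum (H k) xs)"
  unfolding alt_sum_def by (subst sum.swap) (simp add: scaleR_sum_right)

lemma alt_sum_cong:
  "(\<And>u ys. length xs = Suc (length ys) \<Longrightarrow> H u ys = K u ys) \<Longrightarrow> alt_sum H xs = alt_sum K xs"
  unfolding alt_sum_def by (intro sum.cong refl) (auto simp: length_remove_nth)

lemma alt_sum_map: "alt_sum H (map h xs) = alt_sum (\<lambda>u ys. H (h u) (map h ys)) xs"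
  by (simp add: alt_sum_def remove_nth_map)

section \<open>Exterior product with a covector\<close>

definition covector_wedge :: "('a \<Rightarrow> real) \<Rightarrow> ('a list \<Rightarrow> 'b::real_vector) \<Rightarrow> 'a list \<Rightarrow> 'b" where
  "covector_wedge f \<omega> = alt_sum (\<lambda>u ys. f u *\<^sub>R \<omega> ys)"

lemma covector_wedge_Nil [simp]: "covector_wedge f \<omega> [] = 0"
  by (simp add: covector_wedge_def)

text \<open>Contraction is an antiderivation: prefixing \<open>v\<close> to the argument is
  \<open>\<iota>\<^sub>v\<close>, and this is \<open>\<iota>\<^sub>v (f \<and> \<omega>) = f(v)
  \<omega> - f \<and> \<iota>\<^sub>v \<omega>\<close>.\<close>

lemma covector_wedge_Cons [simp]:
  "covector_wedge f \<omega> (v # xs) = f v *\<^sub>R \<omega> xs - covector_wedge f (\<lambda>ys. \<omega> (v # ys)) xs"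
  by (simp add: covector_wedge_def)

lemma covector_wedge_0 [simp]: "covector_wedge f (\<lambda>ys. 0) xs = 0"
  by (simp add: covector_wedge_def)

lemma covector_wedge_add:
  "covector_wedge f (\<lambda>ys. \<omega> ys + \<eta> ys) xs = covector_wedge f \<omega> xs + covector_wedge f \<eta> xs"
  by (simp add: covector_wedge_def scaleR_right_distrib alt_sum_add)

lemma covector_wedge_diff:
  "covector_wedge f (\<lambda>ys. \<omega> ys - \<eta> ys) xs = covector_wedge f \<omega> xs - covector_wedge f \<eta> xs"
  by (simp add: covector_wedge_def scaleR_right_diff_distrib alt_sum_diff)

lemma covector_wedge_minus: "covector_wedge f (\<lambda>ys. - \<omega> ys) xs = - covector_wedge f \<omega> xs"
  by (simp add: covector_wedge_def alt_sum_minus)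

lemma covector_wedge_linear:
  "linear L \<Longrightarrow> covector_wedge f (\<lambda>ys. L (\<omega> ys)) xs = L (covector_wedge f \<omega> xs)"
  unfolding covector_wedge_def by (simp add: alt_sum_linear[symmetric] linear_scale)

lemma covector_wedge_scaleR:
  "covector_wedge f (\<lambda>ys. r *\<^sub>R \<omega> ys) xs = r *\<^sub>R covector_wedge f \<omega> xs"
  by (rule covector_wedge_linear) simp

lemma covector_wedge_map:
  "covector_wedge f \<omega> (map h xs) = covector_wedge (\<lambda>u. f (h u)) (\<lambda>ys. \<omega> (map h ys)) xs"
  by (simp add: covector_wedge_def alt_sum_map)

lemma covector_wedge_scale_covector:
  "covector_wedge (\<lambda>u. r * f u) \<omega> xs = r *\<^sub>R covector_wedge f \<omega> xs"
  by (simp add: covector_wedge_def alt_sum_scaleR[symmetric])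

lemma covector_wedge_cong:
  assumes "\<And>ys. length xs = Suc (length ys) \<Longrightarrow> \<omega> ys = \<eta> ys"
  shows "covector_wedge f \<omega> xs = covector_wedge f \<eta> xs"
  unfolding covector_wedge_def using assms by (intro alt_sum_cong) simp

lemma wedge1_eq: "wedge1 \<alpha> \<omega> c x = covector_wedge (\<lambda>v. \<alpha> c x [v]) (\<omega> c x)"
  by (rule ext) (simp add: wedge1_def covector_wedge_def alt_sum_def)

lemma ext_d_eq: "ext_d \<omega> c x = alt_sum (\<lambda>u ys. deriv_in c (\<lambda>y. \<omega> c y ys) x u)"
  by (rule ext) (simp add: ext_d_def alt_sum_def)

section \<open>Multilinear and alternating functions of all degrees\<close>

definition multilinear_lists :: "(('a::real_vector) list \<Rightarrow> 'b::real_vector) \<Rightarrow> bool" where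
  "multilinear_lists \<omega> \<longleftrightarrow> (\<forall>xs i. i < length xs \<longrightarrow> linear (\<lambda>v. \<omega> (xs[i := v])))"

text \<open>Multilinearity is split off because words in Clifford elements have it without
  alternating. Vanishing on non-distinct lists suits induction over the list better than a pair of
  equal positions.\<close>

lemma alternating_multilinear_iff:
  fixes \<omega> :: "(real ^ 'n::finite) list \<Rightarrow> 'b::real_vector"
  shows "alternating_multilinear \<omega> \<longleftrightarrow> multilinear_lists \<omega> \<and> (\<forall>xs. \<not> distinct xs \<longrightarrow> \<omega> xs = 0)"
proof -
  have "(\<forall>xs i j. i < j \<and> j < length xs \<and> xs ! i = xs ! j \<longrightarrow> \<omega> xs = 0)
     \<longleftrightarrow> (\<forall>xs. \<not> distinct xs \<longrightarrow> \<omega> xs = 0)"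
  proof safe
    fix xs :: "(real ^ 'n) list" assume h: "\<forall>xs i j. i < j \<and> j < length xs \<and> xs ! i = xs ! j \<longrightarrow> \<omega> xs = 0" "\<not> distinct xs"
    then obtain i j where "i < length xs" "j < length xs" "i \<noteq> j" "xs ! i = xs ! j"
      by (auto simp: distinct_conv_nth)
    then show "\<omega> xs = 0"
      using h(1)[rule_format, of i j xs] h(1)[rule_format, of j i xs] by (cases "i < j") auto
  next
    fix xs :: "(real ^ 'n) list" and i j
    assume "\<forall>xs. \<not> distinct xs \<longrightarrow> \<omega> xs = 0" "i < j" "j < length xs" "xs ! i = xs ! j"
    then show "\<omega> xs = 0" by (metis distinct_conv_nth less_trans nat_neq_iff)
  qed
  then show ?thesis by (simp add: alternating_multilinear_def multilinear_lists_def)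
qed

lemma multilinear_lists_linear:
  "multilinear_lists \<omega> \<Longrightarrow> i < length xs \<Longrightarrow> linear (\<lambda>v. \<omega> (xs[i := v]))"
  by (simp add: multilinear_lists_def)

lemma multilinear_lists_append: "multilinear_lists \<omega> \<Longrightarrow> linear (\<lambda>v. \<omega> (ys @ v # xs))"
  using multilinear_lists_linear[of \<omega> "length ys" "ys @ undefined # xs"] by simp

lemma multilinear_lists_Cons: "multilinear_lists \<omega> \<Longrightarrow> linear (\<lambda>v. \<omega> (v # xs))"
  by (drule multilinear_lists_append[of _ "[]" xs]) simp

lemma multilinear_lists_contract:
  assumes "multilinear_lists \<omega>" shows "multilinear_lists (\<lambda>ys. \<omega> (v # ys))"
  unfolding multilinear_lists_def
proof (intro allI impI)
  fix xs :: "'a list" and i assume "i < length xs"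
  then have "linear (\<lambda>w. \<omega> ((v # xs)[Suc i := w]))"
    by (intro multilinear_lists_linear[OF assms]) simp
  then show "linear (\<lambda>w. \<omega> (v # xs[i := w]))"
    by (simp only: list_update_code)
qed

lemma multilinear_lists_compose: "linear L \<Longrightarrow> multilinear_lists \<omega> \<Longrightarrow> multilinear_lists (\<lambda>ys. L (\<omega> ys))"
  unfolding multilinear_lists_def by (auto intro: linear_compose[unfolded o_def])

lemma multilinear_lists_add:
  "multilinear_lists \<omega> \<Longrightarrow> multilinear_lists \<eta> \<Longrightarrow> multilinear_lists (\<lambda>ys. \<omega> ys + \<eta> ys)"
  unfolding multilinear_lists_def by (auto intro: linear_compose_add)

lemma linear_covector_wedge:
  assumes "\<And>ys. linear (\<lambda>v. \<omega> v ys)" shows "linear (\<lambda>v. covector_wedge f (\<omega> v) xs)"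
proof -
  have 1: "\<omega> (u + v) = (\<lambda>ys. \<omega> u ys + \<omega> v ys)" "\<omega> (r *\<^sub>R u) = (\<lambda>ys. r *\<^sub>R \<omega> u ys)" for r u v
    by (auto simp: linear_add[OF assms] linear_scale[OF assms])
  show ?thesis
    by (intro linearI) (simp_all add: 1 covector_wedge_add covector_wedge_scaleR)
qed

lemma multilinear_lists_covector_wedge:
  assumes "linear f" "multilinear_lists \<omega>" shows "multilinear_lists (covector_wedge f \<omega>)"
proof -
  have "i < length xs \<Longrightarrow> linear (\<lambda>v. covector_wedge f \<omega> (xs[i := v]))" for xs i
    using assms(2)
  proof (induction xs arbitrary: i \<omega>)
    case (Cons u xs)
    show ?case
    proof (cases i)
      case 0
      have "linear (\<lambda>v. covector_wedge f (\<lambda>ys. \<omega> (v # ys)) xs)"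
        by (rule linear_covector_wedge) (rule multilinear_lists_Cons[OF Cons.prems(2)])
      moreover have "linear (\<lambda>v. f v *\<^sub>R \<omega> xs)"
        using assms(1) by (intro linearI) (auto simp: linear_add linear_scale scaleR_left_distrib)
      ultimately show ?thesis using 0 by (auto intro: linear_compose_sub)
    next
      case (Suc k)
      then have "linear (\<lambda>v. covector_wedge f (\<lambda>ys. \<omega> (u # ys)) (xs[k := v]))"
        using Cons by (auto intro: multilinear_lists_contract)
      moreover have "linear (\<lambda>v. f u *\<^sub>R \<omega> (xs[k := v]))"
        using Cons.prems Suc multilinear_lists_linear[of \<omega> k xs]
        by (auto intro: linear_compose_scale_right)
      ultimately show ?thesis using Suc by (auto intro: linear_compose_sub)
    qed
  qed simp
  then show ?thesis by (simp add: multilinear_lists_def)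
qed

lemma alternating_contract: "alternating_multilinear \<omega> \<Longrightarrow> alternating_multilinear (\<lambda>ys. \<omega> (v # ys))"
  by (simp add: alternating_multilinear_iff multilinear_lists_contract)

lemma alternating_compose:
  "linear L \<Longrightarrow> alternating_multilinear \<omega> \<Longrightarrow> alternating_multilinear (\<lambda>ys. L (\<omega> ys))"
  by (simp add: alternating_multilinear_iff multilinear_lists_compose linear_0)

lemma alternating_scaleR:
  "alternating_multilinear \<omega> \<Longrightarrow> alternating_multilinear (\<lambda>ys. r *\<^sub>R \<omega> ys)"
  by (rule alternating_compose) auto

lemma alternating_add:
  "alternating_multilinear \<omega> \<Longrightarrow> alternating_multilinear \<eta> \<Longrightarrow>
    alternating_multilinear (\<lambda>ys. \<omega> ys + \<eta> ys)"
  by (simp add: alternating_multilinear_iff multilinear_lists_add)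

lemma alternating_diff:
  "alternating_multilinear \<omega> \<Longrightarrow> alternating_multilinear \<eta> \<Longrightarrow>
    alternating_multilinear (\<lambda>ys. \<omega> ys - \<eta> ys)"
  using alternating_add[of \<omega> "\<lambda>ys. - \<eta> ys"] alternating_scaleR[of \<eta> "-1"] by simp

lemma alternating_Cons_linear: "alternating_multilinear \<omega> \<Longrightarrow> linear (\<lambda>v. \<omega> (v # xs))"
  by (simp add: alternating_multilinear_iff multilinear_lists_Cons)

lemma alternating_Cons_Cons_same: "alternating_multilinear \<omega> \<Longrightarrow> \<omega> (u # u # xs) = 0"
  by (simp add: alternating_multilinear_iff)

lemma alternating_swap:
  assumes "alternating_multilinear \<omega>" shows "\<omega> (u # v # xs) = - \<omega> (v # u # xs)"
proof -
  have l1: "\<omega> ((a + b) # ys) = \<omega> (a # ys) + \<omega> (b # ys)" for a b ys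
    using alternating_Cons_linear[OF assms] by (rule linear_add)
  have l2: "\<omega> (w # (a + b) # ys) = \<omega> (w # a # ys) + \<omega> (w # b # ys)" for a b w ys
    using alternating_Cons_linear[OF alternating_contract[OF assms]] by (rule linear_add)
  have "\<omega> ((u + v) # (u + v) # xs) = 0" by (rule alternating_Cons_Cons_same[OF assms])
  moreover have "\<omega> ((u + v) # (u + v) # xs) = \<omega> (u # v # xs) + \<omega> (v # u # xs)"
    by (simp only: l1 l2) (simp add: alternating_Cons_Cons_same[OF assms])
  ultimately have "\<omega> (u # v # xs) + \<omega> (v # u # xs) = 0" by metis
  then show ?thesis by (simp add: eq_neg_iff_add_eq_0 add.commute)
qed

text \<open>Moving \<open>w\<close> from the front to position \<open>i\<close> takes
  \<open>i\<close> swaps of neighbours.\<close>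

lemma alternating_insert_nth:
  "alternating_multilinear \<omega> \<Longrightarrow> i < length xs \<Longrightarrow>
    \<omega> (w # remove_nth i xs) = (-1) ^ i *\<^sub>R \<omega> (xs[i := w])"
proof (induction i arbitrary: xs \<omega>)
  case 0
  then show ?case by (cases xs) auto
next
  case (Suc i)
  then obtain v ys where xs: "xs = v # ys" by (cases xs) auto
  have "\<omega> (w # remove_nth (Suc i) xs) = - \<omega> (v # w # remove_nth i ys)"
    using alternating_swap[OF Suc.prems(1), of w v] by (simp add: xs)
  also have "\<dots> = - ((-1) ^ i *\<^sub>R \<omega> (v # ys[i := w]))"
    using Suc.IH[OF alternating_contract[OF Suc.prems(1)], of ys] Suc.prems by (simp add: xs)
  finally show ?case by (simp add: xs)
qed

text \<open>The sign of the alternating sum cancels the sign of moving \<open>f u\<close> back to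
  its place, which leaves the derivation induced by \<open>f\<close>.\<close>

lemma alt_sum_insert:
  assumes "alternating_multilinear \<omega>"
  shows "alt_sum (\<lambda>u ys. \<omega> (f u # ys)) xs = (\<Sum>i<length xs. \<omega> (xs[i := f (xs ! i)]))"
  unfolding alt_sum_def
  by (intro sum.cong refl)
     (simp add: alternating_insert_nth[OF assms])

text \<open>For the identity the induced derivation multiplies by the degree; this produces the
  factor \<open>p + 1\<close> in \<open>d\<chi>\<^sub>p\<close>.\<close>

lemma alt_sum_contract:
  assumes "alternating_multilinear \<omega>"
  shows "alt_sum (\<lambda>u ys. \<omega> (u # ys)) xs = real (length xs) *\<^sub>R \<omega> xs"
  using alt_sum_insert[OF assms, of "\<lambda>u. u" xs] by (simp add: sum_constant_scaleR)

text \<open>The case where \<open>v\<close> occurs in \<open>xs\<close> of the identity \<open>f \<and> \<iota>\<^sub>v \<omega> + \<iota>\<^sub>v (f \<and> \<omega>) = f(v) \<omega>\<close>; it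
  says that \<open>\<iota>\<^sub>v (f \<and> \<omega>)\<close> vanishes there.\<close>

lemma covector_wedge_contract_mem:
  assumes "alternating_multilinear \<omega>" "v \<in> set xs"
  shows "covector_wedge f (\<lambda>ys. \<omega> (v # ys)) xs = f v *\<^sub>R \<omega> xs"
  using assms
proof (induction xs arbitrary: \<omega>)
  case (Cons u xs)
  have sw: "(\<lambda>ys. \<omega> (v # u # ys)) = (\<lambda>ys. - \<omega> (u # v # ys))"
    by (intro ext alternating_swap[OF Cons.prems(1)])
  show ?case
  proof (cases "v \<in> set xs")
    case True
    then have "\<omega> (v # xs) = 0" using Cons.prems by (simp add: alternating_multilinear_iff)
    moreover have "covector_wedge f (\<lambda>ys. \<omega> (u # v # ys)) xs = f v *\<^sub>R \<omega> (u # xs)"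
      using Cons.IH[OF alternating_contract[OF Cons.prems(1)] True] .
    ultimately show ?thesis by (simp add: sw covector_wedge_minus)
  next
    case False
    then have "u = v" using Cons.prems by auto
    then show ?thesis by (simp add: alternating_Cons_Cons_same[OF Cons.prems(1)])
  qed
qed simp

lemma alternating_covector_wedge:
  assumes "linear f" "alternating_multilinear \<omega>"
  shows "alternating_multilinear (covector_wedge f \<omega>)"
proof -
  have "\<not> distinct xs \<Longrightarrow> covector_wedge f \<omega> xs = 0" for xs
    using assms(2)
  proof (induction xs arbitrary: \<omega>)
    case (Cons v xs)
    show ?case
    proof (cases "v \<in> set xs")
      case True
      then show ?thesis by (simp add: covector_wedge_contract_mem[OF Cons.prems(2) True])
    next
      case False
      then have "\<not> distinct xs" using Cons.prems by auto
      moreover from this have "\<omega> xs = 0" using Cons.prems by (simp add: alternating_multilinear_iff)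
      ultimately show ?thesis using Cons.IH[OF _ alternating_contract[OF Cons.prems(2)]] by simp
    qed
  qed simp
  then show ?thesis
    using assms by (simp add: alternating_multilinear_iff multilinear_lists_covector_wedge)
qed

text \<open>Every pair of entries enters in both orders with opposite signs, and a symmetric
  \<open>g\<close> makes the two contributions cancel. Thus \<open>\<alpha>\<^sub>Y \<and> Q\<close>
  drops out of \<open>d\<chi>\<^sub>p\<close>.\<close>

lemma alt_sum_covector_wedge_symmetric:
  assumes "\<And>u v. g u v = g v u"
  shows "alt_sum (\<lambda>u. covector_wedge (g u) \<omega>) xs = 0"
proof (induction xs arbitrary: \<omega>)
  case (Cons v xs)
  have "alt_sum (\<lambda>u ys. covector_wedge (g u) \<omega> (v # ys)) xs
      = covector_wedge (\<lambda>u. g u v) \<omega> xs - alt_sum (\<lambda>u. covector_wedge (g u) (\<lambda>ys. \<omega> (v # ys))) xs"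
    by (simp add: alt_sum_diff covector_wedge_def[of "\<lambda>u. g u v"])
  moreover have "(\<lambda>u. g u v) = g v"
    using assms by blast
  ultimately show ?case by (simp add: Cons.IH)
qed simp

text \<open>With \<open>G\<close> the Christoffel map: the connection terms cancel in the exterior
  derivative because the connection is torsion free.\<close>

lemma alt_sum_derivation_symmetric:
  assumes "alternating_multilinear \<omega>" "\<And>u v. G u v = G v u"
  shows "alt_sum (\<lambda>u ys. \<Sum>i<length ys. \<omega> (ys[i := G u (ys ! i)])) xs = 0"
  using assms(1)
proof (induction xs arbitrary: \<omega>)
  case (Cons v xs)
  have "alt_sum (\<lambda>u ys. \<Sum>i<length (v # ys). \<omega> ((v # ys)[i := G u ((v # ys) ! i)])) xs
     = alt_sum (\<lambda>u ys. \<omega> (G u v # ys)) xs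
       + alt_sum (\<lambda>u ys. \<Sum>i<length ys. \<omega> (v # ys[i := G u (ys ! i)])) xs"
    by (simp add: sum.lessThan_Suc_shift alt_sum_add del: sum.lessThan_Suc)
  \<comment> \<open>Here the head \<open>v\<close> is transformed by the entry that is singled out.
    Symmetry of \<open>G\<close> identifies this with the terms in which \<open>v\<close> itself is
    singled out, and the two enter with opposite signs.\<close>
  also have "alt_sum (\<lambda>u ys. \<omega> (G u v # ys)) xs = (\<Sum>i<length xs. \<omega> (xs[i := G v (xs ! i)]))"
    by (subst alt_sum_insert[OF Cons.prems]) (intro sum.cong arg_cong[where f = \<omega>] arg_cong2[where f = "list_update xs"] refl assms(2))
  finally show ?case
    using Cons.IH[OF alternating_contract[OF Cons.prems]] by simp
qed simp

section \<open>Antisymmetrisation over permutations\<close>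

definition antisymmetrize :: "('a list \<Rightarrow> 'b::real_vector) \<Rightarrow> 'a list \<Rightarrow> 'b" where
  "antisymmetrize f xs = (1 / fact (length xs)) *\<^sub>R
     (\<Sum>\<sigma> | \<sigma> permutes {..<length xs}. of_int (sign \<sigma>) *\<^sub>R f (permute_list \<sigma> xs))"

text \<open>\<open>permute_list \<sigma>\<close> reads entry \<open>\<sigma> k\<close> at position
  \<open>k\<close>, so what is written at \<open>i\<close> shows up at
  \<open>inv \<sigma> i\<close>.\<close>

lemma permute_list_update:
  assumes "\<sigma> permutes {..<length xs}" "i < length xs"
  shows "permute_list \<sigma> (xs[i := v]) = (permute_list \<sigma> xs)[inv \<sigma> i := v]"
proof (rule nth_equalityI)
  fix k assume "k < length (permute_list \<sigma> (xs[i := v]))"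
  then have k: "k < length xs" by simp
  have "\<sigma> permutes {..<length (xs[i := v])}" using assms by simp
  then show "permute_list \<sigma> (xs[i := v]) ! k = (permute_list \<sigma> xs)[inv \<sigma> i := v] ! k"
    using k assms permutes_inv_eq[OF assms(1), of i k]
    by (auto simp: permute_list_nth nth_list_update)
qed simp

lemma multilinear_lists_antisymmetrize:
  assumes "multilinear_lists f" shows "multilinear_lists (antisymmetrize f)"
  unfolding multilinear_lists_def
proof safe
  fix xs :: "'a list" and i assume i: "i < length xs"
  have "linear (\<lambda>v. f (permute_list \<sigma> (xs[i := v])))" if "\<sigma> permutes {..<length xs}" for \<sigma>
  proof -
    have "inv \<sigma> i < length xs" using permutes_in_image[OF permutes_inv[OF that]] i by auto
    then have "linear (\<lambda>v. f ((permute_list \<sigma> xs)[inv \<sigma> i := v]))"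
      by (intro multilinear_lists_linear[OF assms]) simp
    then show ?thesis by (simp add: permute_list_update[OF that i])
  qed
  then show "linear (\<lambda>v. antisymmetrize f (xs[i := v]))"
    unfolding antisymmetrize_def
    by (auto intro!: linear_compose_scale_right linear_compose_sum)
qed

lemma alternating_antisymmetrize:
  assumes "multilinear_lists f" shows "alternating_multilinear (antisymmetrize f)"
  unfolding alternating_multilinear_def
proof (intro conjI allI impI)
  fix xs :: "(real ^ 'a) list" and i assume "i < length xs"
  then show "linear (\<lambda>v. antisymmetrize f (xs[i := v]))"
    using multilinear_lists_antisymmetrize[OF assms] by (simp add: multilinear_lists_def)
next
  fix xs :: "(real ^ 'a) list" and i j
  assume "i < j \<and> j < length xs \<and> xs ! i = xs ! j"
  then have ij: "i < length xs" "j < length xs" "i \<noteq> j" "xs ! i = xs ! j" by auto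
  define \<tau> where "\<tau> = Transposition.transpose i j"
  define s where "s \<sigma> = real_of_int (sign \<sigma>) *\<^sub>R f (permute_list \<sigma> xs)" for \<sigma>
  have \<tau>: "\<tau> permutes {..<length xs}" unfolding \<tau>_def using ij by (simp add: permutes_swap_id)
  have "xs ! \<tau> k = xs ! k" for k
    using ij by (cases "k = i"; cases "k = j") (simp_all add: \<tau>_def)
  then have pl: "permute_list (\<tau> \<circ> \<sigma>) xs = permute_list \<sigma> xs" for \<sigma>
    by (simp add: permute_list_def)
  \<comment> \<open>Composing with the transposition of the two equal entries keeps the permuted
    list but flips the sign, so the sum equals its own negative.\<close>
  have "s (\<tau> \<circ> \<sigma>) = - s \<sigma>" if "\<sigma> permutes {..<length xs}" for \<sigma>
  proof -
    have "sign (\<tau> \<circ> \<sigma>) = sign \<tau> * sign \<sigma>"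
      by (rule sign_compose) (use \<tau> that in \<open>auto intro: permutation_permutes[THEN iffD2]\<close>)
    also have "sign \<tau> = -1" using ij by (simp add: \<tau>_def sign_swap_id)
    finally show ?thesis by (simp only: s_def pl) simp
  qed
  moreover have "(\<Sum>\<sigma> | \<sigma> permutes {..<length xs}. s (\<tau> \<circ> \<sigma>)) = sum s {\<sigma>. \<sigma> permutes {..<length xs}}"
    by (rule sum.reindex_bij_witness[of _ "\<lambda>\<sigma>. \<tau> \<circ> \<sigma>" "\<lambda>\<sigma>. \<tau> \<circ> \<sigma>"])
       (auto simp: o_assoc \<tau>_def intro: permutes_compose \<tau>[unfolded \<tau>_def])
  ultimately have "sum s {\<sigma>. \<sigma> permutes {..<length xs}} = - sum s {\<sigma>. \<sigma> permutes {..<length xs}}"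
    by (simp add: sum_negf)
  then have "sum s {\<sigma>. \<sigma> permutes {..<length xs}} = 0"
    by (simp add: eq_neg_iff_add_eq_0 flip: scaleR_2)
  then show "antisymmetrize f xs = 0" by (simp add: antisymmetrize_def s_def)
qed

lemma antisymmetrize_eq_self:
  assumes "\<And>\<sigma>. \<sigma> permutes {..<length xs} \<Longrightarrow> f (permute_list \<sigma> xs) = of_int (sign \<sigma>) *\<^sub>R f xs"
  shows "antisymmetrize f xs = f xs"
proof -
  have "(\<Sum>\<sigma> | \<sigma> permutes {..<length xs}. of_int (sign \<sigma>) *\<^sub>R f (permute_list \<sigma> xs))
      = (\<Sum>\<sigma> | \<sigma> permutes {..<length xs}. f xs)"
    using assms by (intro sum.cong) (auto simp flip: of_int_mult)
  also have "\<dots> = real (fact (length xs)) *\<^sub>R f xs"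
    by (simp add: sum_constant_scaleR card_permutations)
  finally show ?thesis by (simp add: antisymmetrize_def)
qed

text \<open>Swaps of neighbours generate all permutations. The sign rule is required on
  rearrangements of \<open>xs\<close> only, because Clifford factors anticommute only when they are
  orthogonal.\<close>

lemma permute_list_sign:
  assumes adj: "\<And>ys i. mset ys = mset xs \<Longrightarrow> Suc i < length ys \<Longrightarrow>
      f (ys[i := ys ! Suc i, Suc i := ys ! i]) = - f ys"
    and \<sigma>: "\<sigma> permutes {..<length xs}"
  shows "f (permute_list \<sigma> xs) = of_int (sign \<sigma>) *\<^sub>R (f xs :: 'b::real_vector)"
proof -
  let ?S = "{..<length xs}"
  define h where "h \<sigma> = f (permute_list \<sigma> xs)" for \<sigma>
  have step: "h (\<sigma> \<circ> Transposition.transpose i (Suc i)) = - h \<sigma>"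
    if "\<sigma> permutes ?S" "Suc i < length xs" for \<sigma> i
  proof -
    let ?ys = "permute_list \<sigma> xs"
    have t: "Transposition.transpose i (Suc i) permutes ?S" using that by (simp add: permutes_swap_id)
    have "permute_list (\<sigma> \<circ> Transposition.transpose i (Suc i)) xs
        = permute_list (Transposition.transpose i (Suc i)) ?ys"
      by (rule permute_list_compose) (rule t)
    also have "\<dots> = ?ys[i := ?ys ! Suc i, Suc i := ?ys ! i]"
      using that t
      by (intro nth_equalityI)
         (auto simp: permute_list_nth nth_list_update Transposition.transpose_def)
    finally show ?thesis using adj[of ?ys i] that by (simp add: h_def mset_permute_list)
  qed
  have tr: "h (\<sigma> \<circ> Transposition.transpose a (Suc (a + d))) = - h \<sigma>"
    if "\<sigma> permutes ?S" "Suc (a + d) < length xs" for \<sigma> a d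
    using that
  proof (induction d arbitrary: \<sigma>)
    case 0
    then show ?case by (simp only: add_0_right step)
  next
    case (Suc d)
    let ?b = "Suc (a + d)"
    let ?t = "Transposition.transpose ?b (Suc ?b)" and ?s = "Transposition.transpose a ?b"
    \<comment> \<open>Conjugating by the swap of two neighbours shortens the transposition by one
      place and costs two signs, which cancel.\<close>
    have eq: "Transposition.transpose a (Suc ?b) = ?t \<circ> ?s \<circ> ?t"
      by (rule ext) (auto simp: Transposition.transpose_def)
    have tp: "?t permutes ?S" and sp: "?s permutes ?S"
      using Suc.prems by (auto intro!: permutes_swap_id)
    have "h (\<sigma> \<circ> Transposition.transpose a (Suc ?b)) = h (\<sigma> \<circ> ?t \<circ> ?s \<circ> ?t)"
      by (simp add: eq o_assoc)
    also have "\<dots> = - h (\<sigma> \<circ> ?t \<circ> ?s)"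
      using Suc.prems tp sp by (intro step) (auto intro!: permutes_compose)
    also have "\<dots> = h (\<sigma> \<circ> ?t)"
      using Suc.prems tp by (subst Suc.IH) (auto intro!: permutes_compose)
    also have "\<dots> = - h \<sigma>"
      using Suc.prems by (intro step) auto
    finally show ?case by (simp only: add_Suc_right)
  qed
  have "finite ?S" by simp
  then have "h \<sigma> = of_int (sign \<sigma>) *\<^sub>R f xs"
    using \<sigma>
  proof (induction rule: permutes_rev_induct)
    case id
    then show ?case by (simp add: h_def)
  next
    case (swap a b p)
    have "h (p \<circ> Transposition.transpose a b) = - h p"
    proof (cases "a < b")
      case True
      then obtain d where "b = Suc (a + d)" using less_imp_Suc_add by blast
      then show ?thesis using tr[of p a d] swap by simp
    next
      case False
      then have "b < a" using swap by simp
      then obtain d where "a = Suc (b + d)" using less_imp_Suc_add by blast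
      then show ?thesis using tr[of p b d] swap by (simp add: transpose_commute)
    qed
    moreover have "permutation p"
      using swap by (auto simp: permutation_permutes)
    then have "sign (p \<circ> Transposition.transpose a b) = - sign p"
      using swap by (subst sign_compose) (simp_all add: sign_swap_id permutation_swap_id)
    ultimately show ?case using swap by (simp only: of_int_minus scaleR_minus_left)
  qed
  then show ?thesis by (simp add: h_def)
qed

section \<open>Orthonormal bases\<close>

lemma inner_product_formD:
  assumes "inner_product_form g"
  shows "bilinear g" "g u v = g v u" "linear (g u)" "linear (\<lambda>u. g u v)"
proof -
  show "bilinear g" "g u v = g v u" using assms by (auto simp: inner_product_form_def)
  then show "linear (g u)" "linear (\<lambda>u. g u v)" by (simp_all add: bilinear_def)
qed

lemma inner_product_form_eq_iff:
  assumes "inner_product_form g" shows "u = v \<longleftrightarrow> (\<forall>w. g u w = g v w)"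
proof
  assume h: "\<forall>w. g u w = g v w"
  then have "g (u - v) (u - v) = 0"
    by (simp add: linear_diff[OF inner_product_formD(4)[OF assms]])
  moreover have "u - v \<noteq> 0 \<Longrightarrow> g (u - v) (u - v) > 0"
    using assms unfolding inner_product_form_def by blast
  ultimately show "u = v" by fastforce
qed simp

definition orthonormal_basis ::
  "(real ^ 'n \<Rightarrow> real ^ 'n \<Rightarrow> real) \<Rightarrow> ('n::finite \<Rightarrow> real ^ 'n) \<Rightarrow> bool" where
  "orthonormal_basis g e \<longleftrightarrow> inner_product_form g \<and> (\<forall>i j. g (e i) (e j) = (if i = j then 1 else 0))"

lemma orthonormal_basisD:
  assumes "orthonormal_basis g e"
  shows "inner_product_form g" "g (e i) (e j) = (if i = j then 1 else 0)"
  using assms by (auto simp: orthonormal_basis_def)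

text \<open>By orthonormality the map from coefficients to vectors is injective, and an injective
  endomorphism of \<open>real ^ 'n\<close> is onto.\<close>

lemma orthonormal_basis_expand:
  fixes g :: "real ^ 'n::finite \<Rightarrow> real ^ 'n \<Rightarrow> real" and e :: "'n \<Rightarrow> real ^ 'n"
  assumes "orthonormal_basis g e" shows "v = (\<Sum>i\<in>UNIV. g v (e i) *\<^sub>R e i)"
proof -
  note g = inner_product_formD[OF orthonormal_basisD(1)[OF assms]]
  define L where "L c = (\<Sum>i\<in>UNIV. (c $ i) *\<^sub>R e i)" for c :: "real ^ 'n"
  have gL: "g (L c) (e j) = c $ j" for c j
    by (simp add: L_def linear_sum[OF g(4)] linear_scale[OF g(4)] orthonormal_basisD(2)[OF assms]
        if_distrib[where f = "(*) _"] cong: if_cong)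
  have "linear L"
    unfolding L_def by (intro linearI) (simp_all add: scaleR_left_distrib sum.distrib scaleR_sum_right)
  moreover have "inj L"
    by (rule injI) (metis gL vec_eq_iff)
  ultimately have "surj L" by (rule linear_injective_imp_surjective) simp
  then obtain c where "v = L c" by blast
  then show ?thesis using gL by (simp add: L_def)
qed

lemma linear_orthonormal_expand:
  assumes "orthonormal_basis g e" "linear f" shows "f v = (\<Sum>i\<in>UNIV. g v (e i) *\<^sub>R f (e i))"
  by (subst orthonormal_basis_expand[OF assms(1), of v])
     (simp add: linear_sum[OF assms(2)] linear_scale[OF assms(2)])

lemma inner_product_orthonormal:
  assumes "orthonormal_basis g e" shows "g u v = (\<Sum>i\<in>UNIV. g u (e i) * g v (e i))"
  using linear_orthonormal_expand[OF assms inner_product_formD(3)[OF orthonormal_basisD(1)[OF assms]], of u v]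
  by (simp add: mult.commute)

lemma multilinear_eq_0I:
  assumes e: "orthonormal_basis g e" and ml: "multilinear_lists \<omega>" and 0: "\<And>ks. \<omega> (map e ks) = 0"
  shows "\<omega> xs = 0"
proof -
  \<comment> \<open>The suffix holds the entries already expanded in the basis; expanding the last
    free entry lengthens it.\<close>
  have "\<omega> (xs @ map e ks) = 0" for ks
  proof (induction xs arbitrary: ks rule: rev_induct)
    case Nil
    show ?case by (simp add: 0)
  next
    case (snoc v xs)
    have "\<omega> (xs @ v # map e ks) = (\<Sum>i\<in>UNIV. g v (e i) *\<^sub>R \<omega> (xs @ map e (i # ks)))"
      using linear_orthonormal_expand[OF e multilinear_lists_append[OF ml, of xs "map e ks"], of v]
      by (simp only: list.map)
    then show ?case by (simp only: snoc.IH) simp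
  qed
  from this[of "[]"] show ?thesis by simp
qed

text \<open>Repeated basis vectors give zero on both sides, so distinct tuples decide equality. On
  these the antisymmetrised Clifford product is an ordinary product.\<close>

lemma alternating_eqI:
  fixes g :: "real ^ 'n::finite \<Rightarrow> real ^ 'n \<Rightarrow> real" and e :: "'n \<Rightarrow> real ^ 'n"
  assumes e: "orthonormal_basis g e"
    and alt: "alternating_multilinear \<omega>" "alternating_multilinear \<eta>"
    and eq: "\<And>ks. distinct ks \<Longrightarrow> \<omega> (map e ks) = \<eta> (map e ks)"
  shows "\<omega> xs = \<eta> xs"
proof -
  define \<zeta> where "\<zeta> ys = \<omega> ys - \<eta> ys" for ys
  have \<zeta>: "alternating_multilinear \<zeta>" unfolding \<zeta>_def using alt by (rule alternating_diff)
  have "\<zeta> (map e ks) = 0" for ks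
  proof (cases "distinct ks")
    case True
    then show ?thesis by (simp add: \<zeta>_def eq)
  next
    case False
    then have "\<not> distinct (map e ks)" by (simp add: distinct_map)
    then show ?thesis using \<zeta> unfolding alternating_multilinear_iff by blast
  qed
  moreover have "multilinear_lists \<zeta>"
    using \<zeta> unfolding alternating_multilinear_iff by blast
  ultimately have "\<zeta> xs = 0"
    using multilinear_eq_0I[OF e] by blast
  then show ?thesis by (simp add: \<zeta>_def)
qed

text \<open>Alternation compares only lists of the same length, so a factor that depends on the
  degree, such as \<open>(-1) ^ p\<close> or \<open>\<i> ^ (p div 2)\<close>, preserves it.\<close>

lemma alternating_length_compose:
  assumes "\<And>p. linear (L p)" "alternating_multilinear \<omega>"
  shows "alternating_multilinear (\<lambda>xs. L (length xs) (\<omega> xs))"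
  using assms(2) unfolding alternating_multilinear_def
  by (auto simp: linear_0[OF assms(1)] intro!: linear_compose[OF _ assms(1), unfolded o_def])

lemma alternating_length_scale:
  "alternating_multilinear \<omega> \<Longrightarrow> alternating_multilinear (\<lambda>xs. c (length xs) *\<^sub>R \<omega> xs)"
  by (rule alternating_length_compose[where L = "\<lambda>p. (*\<^sub>R) (c p)"]) simp

lemma alternating_eq_0_of_length:
  fixes g :: "real ^ 'n::finite \<Rightarrow> real ^ 'n \<Rightarrow> real" and e :: "'n \<Rightarrow> real ^ 'n"
    and \<omega> :: "(real ^ 'n) list \<Rightarrow> 'b::real_vector"
  assumes e: "orthonormal_basis g e" and alt: "alternating_multilinear \<omega>"
    and len: "length xs > CARD('n)"
  shows "\<omega> xs = 0"
proof -
  \<comment> \<open>Truncation to the degrees above the dimension, in which no tuple of distinct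
    indices exists. The test on basis tuples covers all lengths at once, so the bound on the length
    is built into the function.\<close>
  define \<eta> where "\<eta> ys = (if length ys > CARD('n) then 1 else 0 :: real) *\<^sub>R \<omega> ys" for ys
  have "\<eta> xs = (0 :: real) *\<^sub>R \<omega> xs"
  proof (rule alternating_eqI[OF e])
    show "alternating_multilinear \<eta>"
      unfolding \<eta>_def using alternating_length_scale[OF alt, of "\<lambda>p. if p > CARD('n) then 1 else 0"] .
    show "alternating_multilinear (\<lambda>xs. (0 :: real) *\<^sub>R \<omega> xs)" by (rule alternating_scaleR[OF alt])
    fix ks :: "'n list" assume "distinct ks"
    then have "length ks \<le> CARD('n)"
      by (metis card_mono distinct_card finite_class.finite_UNIV subset_UNIV)
    then show "\<eta> (map e ks) = (0 :: real) *\<^sub>R \<omega> (map e ks)" by (simp add: \<eta>_def)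
  qed
  then show ?thesis using len by (simp add: \<eta>_def)
qed

lemma covector_wedge_anticommute:
  "covector_wedge f (covector_wedge h \<omega>) xs = - covector_wedge h (covector_wedge f \<omega>) xs"
proof (induction xs arbitrary: \<omega>)
  case (Cons v xs)
  show ?case
    by (simp add: covector_wedge_diff covector_wedge_scaleR Cons.IH[of "\<lambda>ys. \<omega> (v # ys)"])
qed simp

text \<open>For distinct arguments only distinct sublists occur, and there antisymmetrised products
  may be replaced by words.\<close>

lemma covector_wedge_cong_distinct:
  assumes "distinct xs" "\<And>ys. distinct ys \<Longrightarrow> \<omega> ys = \<eta> ys"
  shows "covector_wedge f \<omega> xs = covector_wedge f \<eta> xs"
proof -
  have "distinct (remove_nth i xs)" for i
    using assms(1) by (auto simp: remove_nth_def dest: set_take_disj_set_drop_if_distinct[of xs i "Suc i"])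
  then show ?thesis by (simp add: covector_wedge_def alt_sum_def assms(2))
qed

lemma linear_covector_wedge_covector:
  assumes "\<And>u. linear (\<lambda>v. g v u)" shows "linear (\<lambda>v. covector_wedge (g v) \<omega> xs)"
  unfolding covector_wedge_def alt_sum_def
  by (intro linear_compose_sum ballI linear_compose_scale_right linearI)
     (simp_all add: linear_add[OF assms] linear_scale[OF assms] scaleR_left_distrib)

text \<open>Each \<open>k\<close> gives \<open>g(e\<^sub>k, e\<^sub>k) \<omega>\<close> minus the
  wedge of \<open>e\<^sub>k\<close> with its own contraction; summed over \<open>k\<close>, the
  latter multiplies \<open>\<omega>\<close> by its degree. In degree \<open>p - 1\<close> this
  yields \<open>n - p + 1\<close>.\<close>

lemma sum_contract_covector_wedge:
  fixes \<omega> :: "(real ^ 'n::finite) list \<Rightarrow> 'b::real_vector"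
  assumes e: "orthonormal_basis g e" and alt: "alternating_multilinear \<omega>"
  shows "(\<Sum>k\<in>UNIV. covector_wedge (g (e k)) \<omega> (e k # xs)) = (real CARD('n) - real (length xs)) *\<^sub>R \<omega> xs"
proof -
  have "(\<Sum>k\<in>UNIV. covector_wedge (g (e k)) (\<lambda>ys. \<omega> (e k # ys)) xs)
      = alt_sum (\<lambda>u ys. \<Sum>k\<in>UNIV. g (e k) u *\<^sub>R \<omega> (e k # ys)) xs"
    by (simp add: covector_wedge_def alt_sum_sum)
  also have "(\<lambda>u ys. \<Sum>k\<in>UNIV. g (e k) u *\<^sub>R \<omega> (e k # ys)) = (\<lambda>u ys. \<omega> (u # ys))"
  proof (intro ext)
    fix u ys
    have "\<omega> (u # ys) = (\<Sum>k\<in>UNIV. g u (e k) *\<^sub>R \<omega> (e k # ys))"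
      by (rule linear_orthonormal_expand[OF e alternating_Cons_linear[OF alt]])
    then show "(\<Sum>k\<in>UNIV. g (e k) u *\<^sub>R \<omega> (e k # ys)) = \<omega> (u # ys)"
      by (simp add: inner_product_formD(2)[OF orthonormal_basisD(1)[OF e], of _ u])
  qed
  finally show ?thesis
    using orthonormal_basisD(2)[OF e] alt
    by (simp add: sum_subtractf alt_sum_contract sum_constant_scaleR scaleR_left_diff_distrib)
qed

section \<open>Antisymmetrised products in a Clifford algebra\<close>

lemma bounded_bilinear_matrix_matrix_mult:
  "bounded_bilinear ((**) :: complex ^ 's::finite ^ 's \<Rightarrow> complex ^ 's ^ 's \<Rightarrow> complex ^ 's ^ 's)"
  unfolding bilinear_conv_bounded_bilinear[symmetric] bilinear_def
  by (intro conjI allI linearI)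
     (simp_all add: vec_eq_iff matrix_matrix_mult_def distrib_left distrib_right sum.distrib scaleR_sum_right)

lemma bounded_bilinear_matrix_vector_mult:
  "bounded_bilinear ((*v) :: complex ^ 's::finite ^ 's \<Rightarrow> complex ^ 's \<Rightarrow> complex ^ 's)"
  unfolding bilinear_conv_bounded_bilinear[symmetric] bilinear_def
  by (intro conjI allI linearI)
     (simp_all add: vec_eq_iff matrix_vector_mult_def distrib_left distrib_right sum.distrib scaleR_sum_right)

lemmas mmult_simps =
  bounded_bilinear.add_left[OF bounded_bilinear_matrix_matrix_mult]
  bounded_bilinear.add_right[OF bounded_bilinear_matrix_matrix_mult]
  bounded_bilinear.diff_left[OF bounded_bilinear_matrix_matrix_mult]
  bounded_bilinear.diff_right[OF bounded_bilinear_matrix_matrix_mult]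
  bounded_bilinear.minus_left[OF bounded_bilinear_matrix_matrix_mult]
  bounded_bilinear.minus_right[OF bounded_bilinear_matrix_matrix_mult]
  bounded_bilinear.scaleR_left[OF bounded_bilinear_matrix_matrix_mult]
  bounded_bilinear.scaleR_right[OF bounded_bilinear_matrix_matrix_mult]
  bounded_bilinear.zero_left[OF bounded_bilinear_matrix_matrix_mult]
  bounded_bilinear.zero_right[OF bounded_bilinear_matrix_matrix_mult]

lemma
  fixes N :: "complex ^ 's::finite ^ 's"
  shows linear_mmult_left: "linear (\<lambda>M :: complex ^ 's ^ 's. N ** M)"
    and linear_mmult_right: "linear (\<lambda>M :: complex ^ 's ^ 's. M ** N)"
  by (auto intro!: linearI simp: mmult_simps)

lemma covector_wedge_mmult:
  fixes \<omega> :: "'a list \<Rightarrow> complex ^ 's::finite ^ 's"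
  shows "covector_wedge f (\<lambda>ys. N ** \<omega> ys) xs = N ** covector_wedge f \<omega> xs"
    and "covector_wedge f (\<lambda>ys. \<omega> ys ** N) xs = covector_wedge f \<omega> xs ** N"
  by (rule covector_wedge_linear[OF linear_mmult_left] covector_wedge_linear[OF linear_mmult_right])+

section \<open>Words in Clifford elements\<close>

definition clifford_word :: "('a \<Rightarrow> complex ^ 's::finite ^ 's) \<Rightarrow> 'a list \<Rightarrow> complex ^ 's ^ 's" where
  "clifford_word C xs = foldr (\<lambda>v M. C v ** M) xs (mat 1)"

lemma clifford_word_simps [simp]:
  "clifford_word C [] = mat 1" "clifford_word C (v # xs) = C v ** clifford_word C xs"
  by (simp_all add: clifford_word_def)

lemma clifford_word_append: "clifford_word C (xs @ ys) = clifford_word C xs ** clifford_word C ys"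
  by (induction xs) (simp_all add: matrix_mul_assoc)

lemma multilinear_clifford_word:
  assumes "linear C" shows "multilinear_lists (clifford_word C)"
proof -
  have "i < length xs \<Longrightarrow> linear (\<lambda>v. clifford_word C (xs[i := v]))" for i xs
  proof (induction xs arbitrary: i)
    case (Cons u xs)
    show ?case
    proof (cases i)
      case 0
      then show ?thesis using linear_compose[OF assms linear_mmult_right] by (simp add: o_def)
    next
      case (Suc k)
      then have "linear (\<lambda>v. clifford_word C (xs[k := v]))" using Cons by simp
      from linear_compose[OF this linear_mmult_left] show ?thesis using Suc by (simp add: o_def)
    qed
  qed simp
  then show ?thesis by (simp add: multilinear_lists_def)
qed

definition clifford_map ::
  "(real ^ 'n \<Rightarrow> real ^ 'n \<Rightarrow> real) \<Rightarrow> (real ^ 'n::finite \<Rightarrow> complex ^ 's::finite ^ 's) \<Rightarrow> bool" where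
  "clifford_map g C \<longleftrightarrow> linear C \<and> (\<forall>u v. C u ** C v + C v ** C u = (2 * g u v) *\<^sub>R mat 1)"

lemma clifford_map_linear: "clifford_map g C \<Longrightarrow> linear C"
  by (simp add: clifford_map_def)

text \<open>Stated with a trailing factor so that it applies inside a right-nested word.\<close>

lemma clifford_map_swap:
  fixes M :: "complex ^ 's::finite ^ 's"
  assumes "clifford_map g C"
  shows "C u ** (C v ** M) = (2 * g u v) *\<^sub>R M - C v ** (C u ** M)"
proof -
  have "C u ** C v = (2 * g u v) *\<^sub>R mat 1 - C v ** C u"
    using assms by (simp add: clifford_map_def eq_diff_eq)
  then show ?thesis by (simp add: matrix_mul_assoc mmult_simps)
qed

abbreviation clifford_alt :: "(real ^ 'n::finite \<Rightarrow> complex ^ 's::finite ^ 's) \<Rightarrow> (real ^ 'n) list \<Rightarrow> complex ^ 's ^ 's"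
  where "clifford_alt C \<equiv> antisymmetrize (clifford_word C)"

lemma alternating_clifford_alt: "clifford_map g C \<Longrightarrow> alternating_multilinear (clifford_alt C)"
  by (intro alternating_antisymmetrize multilinear_clifford_word clifford_map_linear)

text \<open>Distinct orthonormal vectors anticommute, so every permuted word is the original one up
  to the sign of the permutation.\<close>

lemma clifford_alt_orthonormal:
  fixes g :: "real ^ 'n::finite \<Rightarrow> real ^ 'n \<Rightarrow> real" and e :: "'n \<Rightarrow> real ^ 'n"
    and C :: "real ^ 'n \<Rightarrow> complex ^ 's::finite ^ 's"
  assumes e: "orthonormal_basis g e" and C: "clifford_map g C" and ks: "distinct ks"
  shows "clifford_alt C (map e ks) = clifford_word C (map e ks)"
proof (rule antisymmetrize_eq_self, rule permute_list_sign)
  fix ys i assume ms: "mset ys = mset (map e ks)" and i: "Suc i < length ys"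
  define as bs where "as = take i ys" "bs = drop (Suc (Suc i)) ys"
  have ys: "ys = as @ ys ! i # ys ! Suc i # bs"
    using i by (simp add: as_bs_def Cons_nth_drop_Suc)
  have "inj e"
    by (rule injI) (metis e orthonormal_basisD(2) zero_neq_one)
  then have "distinct ys"
    using ms ks by (metis distinct_map inj_on_subset mset_eq_imp_distinct_iff subset_UNIV)
  then have "ys ! i \<noteq> ys ! Suc i" using i by (simp add: nth_eq_iff_index_eq)
  moreover have "set ys \<subseteq> range e" using mset_eq_setD[OF ms] by auto
  then have "ys ! i \<in> range e" "ys ! Suc i \<in> range e" using i by (meson Suc_lessD nth_mem subsetD)+
  ultimately have g0: "g (ys ! Suc i) (ys ! i) = 0"
    using orthonormal_basisD(2)[OF e] by auto
  have "ys[i := ys ! Suc i, Suc i := ys ! i] = as @ ys ! Suc i # ys ! i # bs"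
  proof -
    have la: "length as = i" using i by (simp add: as_bs_def)
    show ?thesis by (subst (1) ys) (simp add: list_update_append la)
  qed
  then show "clifford_word C (ys[i := ys ! Suc i, Suc i := ys ! i]) = - clifford_word C ys"
    by (subst (3) ys) (simp add: clifford_word_append clifford_map_swap[OF C, of "ys ! Suc i"] g0 mmult_simps)
qed

text \<open>\<open>C (e k)\<close> anticommutes past the letters before its own occurrence and there
  squares to one; the signs collected on the way are those of the wedge.\<close>

lemma clifford_word_mult_left_mem:
  fixes g :: "real ^ 'n::finite \<Rightarrow> real ^ 'n \<Rightarrow> real" and e :: "'n \<Rightarrow> real ^ 'n"
    and C :: "real ^ 'n \<Rightarrow> complex ^ 's::finite ^ 's"
  assumes e: "orthonormal_basis g e" and C: "clifford_map g C" and "distinct ks" "k \<in> set ks"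
  shows "C (e k) ** clifford_word C (map e ks) = covector_wedge (g (e k)) (clifford_word C) (map e ks)"
  using assms(3,4)
proof (induction ks)
  case (Cons j ks)
  \<comment> \<open>Applied to the letters after the occurrence of \<open>e k\<close>: they are
    orthogonal to it and contribute nothing to the wedge.\<close>
  have notin: "k \<notin> set ls \<Longrightarrow> covector_wedge (g (e k)) \<omega> (map e ls) = 0"
    for ls and \<omega> :: "(real ^ 'n) list \<Rightarrow> complex ^ 's ^ 's"
    by (induction ls arbitrary: \<omega>) (auto simp: orthonormal_basisD(2)[OF e])
  have swap: "C (e k) ** clifford_word C (map e (j # ks))
      = (2 * g (e k) (e j)) *\<^sub>R clifford_word C (map e ks) - C (e j) ** (C (e k) ** clifford_word C (map e ks))"
    by (simp add: clifford_map_swap[OF C, of "e k" "e j"])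
  show ?case
  proof (cases "k = j")
    case True
    have "C (e k) ** (C (e k) ** M) = M" for M :: "complex ^ 's ^ 's"
    proof -
      have "C (e k) ** (C (e k) ** M) + C (e k) ** (C (e k) ** M) = 2 *\<^sub>R M"
        using clifford_map_swap[OF C, of "e k" "e k" M] by (simp add: orthonormal_basisD(2)[OF e])
      then show ?thesis by (simp flip: scaleR_2)
    qed
    then show ?thesis
      using True Cons.prems notin[of ks "clifford_word C"]
      by (simp add: covector_wedge_mmult orthonormal_basisD(2)[OF e] mmult_simps)
  next
    case False
    then show ?thesis
      using Cons unfolding swap by (simp add: covector_wedge_mmult orthonormal_basisD(2)[OF e])
  qed
qed simp

lemma covector_wedge_clifford_alt_orthonormal:
  fixes g :: "real ^ 'n::finite \<Rightarrow> real ^ 'n \<Rightarrow> real" and e :: "'n \<Rightarrow> real ^ 'n"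
    and C :: "real ^ 'n \<Rightarrow> complex ^ 's::finite ^ 's"
  assumes e: "orthonormal_basis g e" and C: "clifford_map g C" and "distinct ks"
  shows "covector_wedge f (clifford_alt C) (map e ks) = covector_wedge f (clifford_word C) (map e ks)"
  unfolding covector_wedge_map
  by (rule covector_wedge_cong_distinct[OF assms(3)]) (rule clifford_alt_orthonormal[OF e C])

text \<open>By linearity in \<open>v\<close> and alternation in \<open>xs\<close> only basis vectors
  matter. If \<open>e k\<close> is absent from the word, prefixing it gives another distinct word
  and the wedge vanishes. If it is present, the contraction vanishes and the product removes
  \<open>e k\<close> from the word.\<close>

lemma clifford_alt_mult_left:
  fixes g :: "real ^ 'n::finite \<Rightarrow> real ^ 'n \<Rightarrow> real" and e :: "'n \<Rightarrow> real ^ 'n"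
    and C :: "real ^ 'n \<Rightarrow> complex ^ 's::finite ^ 's"
  assumes e: "orthonormal_basis g e" and C: "clifford_map g C"
  shows "C v ** clifford_alt C xs = clifford_alt C (v # xs) + covector_wedge (g v) (clifford_alt C) xs"
proof -
  note g = inner_product_formD[OF orthonormal_basisD(1)[OF e]]
  note alt = alternating_clifford_alt[OF C]
  have basis: "C (e k) ** clifford_alt C xs
      = clifford_alt C (e k # xs) + covector_wedge (g (e k)) (clifford_alt C) xs" for k
  proof (rule alternating_eqI[OF e])
    show "alternating_multilinear (\<lambda>xs. C (e k) ** clifford_alt C xs)"
      by (rule alternating_compose[OF linear_mmult_left alt])
    show "alternating_multilinear (\<lambda>xs. clifford_alt C (e k # xs) + covector_wedge (g (e k)) (clifford_alt C) xs)"
      by (intro alternating_add alternating_contract[OF alt] alternating_covector_wedge[OF g(3) alt])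
  next
    fix ks :: "'n list" assume ks: "distinct ks"
    note alt_ks = clifford_alt_orthonormal[OF e C ks] covector_wedge_clifford_alt_orthonormal[OF e C ks]
    show "C (e k) ** clifford_alt C (map e ks)
      = clifford_alt C (e k # map e ks) + covector_wedge (g (e k)) (clifford_alt C) (map e ks)"
    proof (cases "k \<in> set ks")
      case True
      then have "\<not> distinct (e k # map e ks)" by simp
      then have "clifford_alt C (e k # map e ks) = 0"
        using alt unfolding alternating_multilinear_iff by blast
      then show ?thesis
        using clifford_word_mult_left_mem[OF e C ks True] by (simp add: alt_ks)
    next
      case False
      have "covector_wedge (g (e k)) \<omega> (map e ks) = 0"
        for \<omega> :: "(real ^ 'n) list \<Rightarrow> complex ^ 's ^ 's"
        using False by (induction ks arbitrary: \<omega>) (auto simp: orthonormal_basisD(2)[OF e])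
      moreover have "clifford_alt C (map e (k # ks)) = clifford_word C (map e (k # ks))"
        using ks False by (intro clifford_alt_orthonormal[OF e C]) simp
      ultimately show ?thesis by (simp add: alt_ks)
    qed
  qed
  have "linear (\<lambda>v. C v ** clifford_alt C xs)"
    using linear_compose[OF clifford_map_linear[OF C] linear_mmult_right] by (simp add: o_def)
  moreover have "linear (\<lambda>v. clifford_alt C (v # xs) + covector_wedge (g v) (clifford_alt C) xs)"
    by (intro linear_compose_add alternating_Cons_linear[OF alt] linear_covector_wedge_covector g(4))
  ultimately show ?thesis
    using linear_orthonormal_expand[OF e, of "\<lambda>v. C v ** clifford_alt C xs" v]
      linear_orthonormal_expand[OF e, of "\<lambda>v. clifford_alt C (v # xs) + covector_wedge (g v) (clifford_alt C) xs" v]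
    by (simp only: basis)
qed

text \<open>Passing \<open>C v\<close> through a letter \<open>w\<close> leaves
  \<open>2 g(v, w)\<close> in its place and flips the sign of the rest.\<close>

lemma clifford_word_supercommutator:
  fixes C :: "real ^ 'n::finite \<Rightarrow> complex ^ 's::finite ^ 's"
  assumes C: "clifford_map g C"
  shows "C v ** clifford_word C xs
    = 2 *\<^sub>R covector_wedge (g v) (clifford_word C) xs + (-1) ^ length xs *\<^sub>R (clifford_word C xs ** C v)"
proof (induction xs)
  case (Cons w xs)
  have "C v ** clifford_word C (w # xs)
      = (2 * g v w) *\<^sub>R clifford_word C xs - C w ** (C v ** clifford_word C xs)"
    by (simp only: clifford_word_simps clifford_map_swap[OF C, of v w])
  then show ?case
    by (simp add: Cons.IH covector_wedge_mmult mmult_simps scaleR_right_diff_distrib matrix_mul_assoc)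
qed simp

text \<open>The supercommutator trades right for left multiplication. It is carried over from words
  to antisymmetrised products by testing on distinct basis tuples.\<close>

lemma clifford_alt_mult_right:
  fixes g :: "real ^ 'n::finite \<Rightarrow> real ^ 'n \<Rightarrow> real" and e :: "'n \<Rightarrow> real ^ 'n"
    and C :: "real ^ 'n \<Rightarrow> complex ^ 's::finite ^ 's"
  assumes e: "orthonormal_basis g e" and C: "clifford_map g C"
  shows "clifford_alt C xs ** C v
    = (-1) ^ length xs *\<^sub>R (clifford_alt C (v # xs) - covector_wedge (g v) (clifford_alt C) xs)"
proof -
  note g = inner_product_formD[OF orthonormal_basisD(1)[OF e]]
  note alt = alternating_clifford_alt[OF C]
  have "C v ** clifford_alt C xs
    = 2 *\<^sub>R covector_wedge (g v) (clifford_alt C) xs + (-1) ^ length xs *\<^sub>R (clifford_alt C xs ** C v)"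
  proof (rule alternating_eqI[OF e])
    show "alternating_multilinear (\<lambda>xs. C v ** clifford_alt C xs)"
      by (rule alternating_compose[OF linear_mmult_left alt])
    show "alternating_multilinear (\<lambda>xs. 2 *\<^sub>R covector_wedge (g v) (clifford_alt C) xs
        + (-1) ^ length xs *\<^sub>R (clifford_alt C xs ** C v))"
      by (intro alternating_add alternating_scaleR alternating_covector_wedge[OF g(3) alt]
          alternating_length_scale[where c = "\<lambda>p. (-1) ^ p"] alternating_compose[OF linear_mmult_right alt])
    fix ks :: "'n list" assume ks: "distinct ks"
    show "C v ** clifford_alt C (map e ks)
      = 2 *\<^sub>R covector_wedge (g v) (clifford_alt C) (map e ks)
        + (-1) ^ length (map e ks) *\<^sub>R (clifford_alt C (map e ks) ** C v)"
      unfolding clifford_alt_orthonormal[OF e C ks] covector_wedge_clifford_alt_orthonormal[OF e C ks]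
      by (rule clifford_word_supercommutator[OF C])
  qed
  then have "(-1) ^ length xs *\<^sub>R (clifford_alt C xs ** C v)
      = clifford_alt C (v # xs) - covector_wedge (g v) (clifford_alt C) xs"
    by (simp add: clifford_alt_mult_left[OF e C] scaleR_2 algebra_simps)
  \<comment> \<open>The sign is its own inverse, so a second factor isolates the right
    product.\<close>
  then have "(-1) ^ length xs *\<^sub>R (-1) ^ length xs *\<^sub>R (clifford_alt C xs ** C v)
      = (-1) ^ length xs *\<^sub>R (clifford_alt C (v # xs) - covector_wedge (g v) (clifford_alt C) xs)"
    by simp
  then show ?thesis by simp
qed

lemma double_scaleR: "(2 * r) *\<^sub>R (x :: 'a::real_vector) = r *\<^sub>R x + r *\<^sub>R x"
  by (simp only: mult_2 scaleR_left_distrib)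

text \<open>Here and in the mirrored formula that follows, the operators are sorted so that those of
  \<open>y\<close> stand outermost. The two results share the terms of unchanged degree and differ
  in the sign of the last bracket, which holds the terms of degree shifted by two.\<close>

lemma clifford_alt_mult_left2:
  fixes g :: "real ^ 'n::finite \<Rightarrow> real ^ 'n \<Rightarrow> real" and e :: "'n \<Rightarrow> real ^ 'n"
    and C :: "real ^ 'n \<Rightarrow> complex ^ 's::finite ^ 's"
  assumes e: "orthonormal_basis g e" and C: "clifford_map g C"
  shows "C y ** (C a ** clifford_alt C xs)
    = (2 * g a y) *\<^sub>R clifford_alt C xs - covector_wedge (g y) (\<lambda>ys. clifford_alt C (a # ys)) xs
      - covector_wedge (g a) (clifford_alt C) (y # xs)
      - (clifford_alt C (a # y # xs) + covector_wedge (g y) (covector_wedge (g a) (clifford_alt C)) xs)"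
proof -
  \<comment> \<open>\<open>r *\<^sub>R X - F\<close> and \<open>r *\<^sub>R X - E\<close> are the
    wedges on \<open>y # xs\<close> and on \<open>a # xs\<close> with the head split off. Completing
    \<open>F\<close> to the former costs a second \<open>r *\<^sub>R X\<close>.\<close>
  have rearrange: "- P + (r *\<^sub>R X - E) + (F + - W) = (2 * r) *\<^sub>R X - E - (r *\<^sub>R X - F) - (P + W)"
    for r and P X E F W :: "'v::real_vector"
    by (simp add: double_scaleR)
  note alt = alternating_clifford_alt[OF C]
  have "C y ** (C a ** clifford_alt C xs) = C y ** clifford_alt C (a # xs)
      + covector_wedge (g a) (\<lambda>ys. C y ** clifford_alt C ys) xs"
    by (simp add: clifford_alt_mult_left[OF e C, of a] mmult_simps covector_wedge_mmult)
  also have "\<dots> = clifford_alt C (y # a # xs) + covector_wedge (g y) (clifford_alt C) (a # xs)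
      + (covector_wedge (g a) (\<lambda>ys. clifford_alt C (y # ys)) xs
         + covector_wedge (g a) (covector_wedge (g y) (clifford_alt C)) xs)"
    by (simp only: clifford_alt_mult_left[OF e C] covector_wedge_add)
  also have "clifford_alt C (y # a # xs) = - clifford_alt C (a # y # xs)"
    by (rule alternating_swap[OF alt])
  also have "covector_wedge (g a) (covector_wedge (g y) (clifford_alt C)) xs
      = - covector_wedge (g y) (covector_wedge (g a) (clifford_alt C)) xs"
    by (rule covector_wedge_anticommute)
  finally show ?thesis
    using inner_product_formD(2)[OF orthonormal_basisD(1)[OF e], of y a]
    by (simp only: covector_wedge_Cons rearrange)
qed

lemma clifford_alt_mult_right2:
  fixes g :: "real ^ 'n::finite \<Rightarrow> real ^ 'n \<Rightarrow> real" and e :: "'n \<Rightarrow> real ^ 'n"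
    and C :: "real ^ 'n \<Rightarrow> complex ^ 's::finite ^ 's"
  assumes e: "orthonormal_basis g e" and C: "clifford_map g C"
  shows "clifford_alt C xs ** C a ** C y
    = (2 * g a y) *\<^sub>R clifford_alt C xs - covector_wedge (g y) (\<lambda>ys. clifford_alt C (a # ys)) xs
      - covector_wedge (g a) (clifford_alt C) (y # xs)
      + (clifford_alt C (a # y # xs) + covector_wedge (g y) (covector_wedge (g a) (clifford_alt C)) xs)"
proof -
  note alt = alternating_clifford_alt[OF C]
  let ?s = "(-1) ^ length xs :: real"
  have rearrange: "?s *\<^sub>R ((- ?s) *\<^sub>R (- P - (r *\<^sub>R X - E)) - (- ?s) *\<^sub>R (F - - W))
      = (2 * r) *\<^sub>R X - E - (r *\<^sub>R X - F) + (P + W)"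
    for r and P X E F W :: "'v::real_vector"
    by (simp add: double_scaleR scaleR_right_diff_distrib scaleR_right_distrib)
  have "clifford_alt C xs ** C a ** C y = ?s *\<^sub>R (clifford_alt C (a # xs) ** C y
      - covector_wedge (g a) (\<lambda>ys. clifford_alt C ys ** C y) xs)"
    by (simp add: clifford_alt_mult_right[OF e C, of _ a] mmult_simps covector_wedge_mmult)
  \<comment> \<open>The arguments \<open>ys\<close> are shorter by one and \<open>a # xs\<close> is
    longer by one, so both inner right multiplications carry the sign \<open>- ?s\<close>.\<close>
  also have "covector_wedge (g a) (\<lambda>ys. clifford_alt C ys ** C y) xs
      = covector_wedge (g a) (\<lambda>ys. (- ?s) *\<^sub>R (clifford_alt C (y # ys) - covector_wedge (g y) (clifford_alt C) ys)) xs"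
    by (rule covector_wedge_cong) (simp add: clifford_alt_mult_right[OF e C])
  also have "\<dots> = (- ?s) *\<^sub>R (covector_wedge (g a) (\<lambda>ys. clifford_alt C (y # ys)) xs
      - covector_wedge (g a) (covector_wedge (g y) (clifford_alt C)) xs)"
    by (simp only: covector_wedge_scaleR covector_wedge_diff)
  also have "clifford_alt C (a # xs) ** C y
      = (- ?s) *\<^sub>R (clifford_alt C (y # a # xs) - covector_wedge (g y) (clifford_alt C) (a # xs))"
    by (simp only: clifford_alt_mult_right[OF e C]) simp
  also have "clifford_alt C (y # a # xs) = - clifford_alt C (a # y # xs)"
    by (rule alternating_swap[OF alt])
  also have "covector_wedge (g a) (covector_wedge (g y) (clifford_alt C)) xs
      = - covector_wedge (g y) (covector_wedge (g a) (clifford_alt C)) xs"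
    by (rule covector_wedge_anticommute)
  finally show ?thesis
    using inner_product_formD(2)[OF orthonormal_basisD(1)[OF e], of y a]
    by (simp only: covector_wedge_Cons rearrange)
qed

section \<open>The form hierarchy, pointwise\<close>

text \<open>Here \<open>f\<close> is the value of a 1-form at a point and \<open>a\<close> its
  metric dual vector.\<close>

definition hierarchy_P ::
  "complex \<Rightarrow> ('v \<Rightarrow> real) \<Rightarrow> 'v \<Rightarrow> ('v list \<Rightarrow> 'b::real_vector) \<Rightarrow> 'v list \<Rightarrow> 'b" where
  "hierarchy_P k f a \<psi> xs = (2 * Re k) *\<^sub>R covector_wedge f \<psi> xs - (2 * Im k) *\<^sub>R \<psi> (a # xs)"

definition hierarchy_Q ::
  "complex \<Rightarrow> ('v \<Rightarrow> real) \<Rightarrow> 'v \<Rightarrow> ('v list \<Rightarrow> 'b::real_vector) \<Rightarrow> 'v list \<Rightarrow> 'b" where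
  "hierarchy_Q k f a \<psi> xs = (2 * Re k) *\<^sub>R \<psi> (a # xs) + (2 * Im k) *\<^sub>R covector_wedge f \<psi> xs"

lemma alternating_hierarchy:
  assumes "linear f" "alternating_multilinear \<psi>"
  shows "alternating_multilinear (hierarchy_P k f a \<psi>)" "alternating_multilinear (hierarchy_Q k f a \<psi>)"
  unfolding hierarchy_P_def hierarchy_Q_def
  by (intro alternating_add alternating_diff alternating_scaleR alternating_contract
      alternating_covector_wedge assms)+

text \<open>The two products contribute \<open>4 Re k\<^sub>1 g(a, y)\<close> to the multiple of
  \<open>\<psi> xs\<close>, and the last summand contributes \<open>2 Re k\<^sub>2 g(a, y)\<close>;
  this is where the \<open>2 Re (2 k\<^sub>1 + k\<^sub>2)\<close> of the connection comes from. The
  other terms already have the form \<open>\<iota>\<^sub>y P + g(y) \<and> Q\<close>.\<close>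

lemma bilinear_hierarchy:
  fixes g :: "real ^ 'n::finite \<Rightarrow> real ^ 'n \<Rightarrow> real" and e :: "'n \<Rightarrow> real ^ 'n"
    and C :: "real ^ 'n \<Rightarrow> complex ^ 's::finite ^ 's" and \<phi> :: "complex ^ 's ^ 's \<Rightarrow> complex"
  assumes e: "orthonormal_basis g e" and C: "clifford_map g C" and \<phi>: "linear \<phi>"
    and \<psi>: "\<And>xs. \<psi> xs = \<i> ^ (length xs div 2) * \<phi> (clifford_alt C xs)"
  shows "- (\<i> ^ (length xs div 2) * (k\<^sub>1 * \<phi> (clifford_alt C xs ** C a ** C y)
           + cnj k\<^sub>1 * \<phi> (C y ** (C a ** clifford_alt C xs))
           + of_real (2 * Re k\<^sub>2 * g a y) * \<phi> (clifford_alt C xs)))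
         + (2 * Re (2 * k\<^sub>1 + k\<^sub>2) * g a y) *\<^sub>R \<psi> xs
       = hierarchy_P k\<^sub>1 (g a) a \<psi> (y # xs) + covector_wedge (g y) (hierarchy_Q k\<^sub>1 (g a) a \<psi>) xs"
proof -
  define z where "z = \<i> ^ (length xs div 2)"
  define E where "E = \<phi> (covector_wedge (g y) (\<lambda>ys. clifford_alt C (a # ys)) xs)"
  define F where "F = \<phi> (covector_wedge (g a) (clifford_alt C) (y # xs))"
  define U where "U = \<phi> (clifford_alt C (a # y # xs))"
  define V where "V = \<phi> (covector_wedge (g y) (covector_wedge (g a) (clifford_alt C)) xs)"
  define \<omega> where "\<omega> = \<phi> (clifford_alt C xs)"
  have lin: "linear (\<lambda>M. w * \<phi> M)" for w
    using linear_compose[OF \<phi>, of "(*) w"] by (simp add: o_def)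
  \<comment> \<open>\<open>a # ys\<close> has the length of \<open>xs\<close>, so the phase is the
    same.\<close>
  have zE: "covector_wedge (g y) (\<lambda>ys. \<psi> (a # ys)) xs = z * E"
    unfolding E_def z_def
    by (subst covector_wedge_linear[OF lin, symmetric], rule covector_wedge_cong) (simp add: \<psi>)
  have zF: "covector_wedge (g a) \<psi> (y # xs) = z * F"
    unfolding F_def z_def
    by (subst covector_wedge_linear[OF lin, symmetric], rule covector_wedge_cong) (simp add: \<psi>)
  have zU: "\<psi> (a # y # xs) = z * \<i> * U"
    by (simp add: \<psi> z_def U_def)
  \<comment> \<open>Two wedges take \<open>\<psi>\<close> in degree \<open>p - 2\<close>, where its
    phase is \<open>z\<close> divided by \<open>\<i>\<close>, that is
    \<open>- \<i> z\<close>.\<close>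
  have zV: "covector_wedge (g y) (covector_wedge (g a) \<psi>) xs = - (z * \<i> * V)"
  proof -
    have "covector_wedge (g y) (covector_wedge (g a) \<psi>) xs
        = covector_wedge (g y) (\<lambda>ys. (- (z * \<i>)) * \<phi> (covector_wedge (g a) (clifford_alt C) ys)) xs"
    proof (rule covector_wedge_cong)
      fix ys :: "(real ^ 'n) list" assume l: "length xs = Suc (length ys)"
      show "covector_wedge (g a) \<psi> ys = - (z * \<i>) * \<phi> (covector_wedge (g a) (clifford_alt C) ys)"
        by (subst covector_wedge_linear[OF lin, symmetric], rule covector_wedge_cong)
           (simp add: \<psi> z_def l, simp add: algebra_simps)
    qed
    also have "\<dots> = - (z * \<i>) * V"
      unfolding V_def by (rule covector_wedge_linear[OF lin])
    finally show ?thesis by simp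
  qed
  have L: "\<phi> (C y ** (C a ** clifford_alt C xs)) = of_real (2 * g a y) * \<omega> - E - F - (U + V)"
    unfolding E_def F_def U_def V_def \<omega>_def
    by (simp only: clifford_alt_mult_left2[OF e C] linear_add[OF \<phi>] linear_diff[OF \<phi>] linear_scale[OF \<phi>])
       (simp only: scaleR_conv_of_real)
  have R: "\<phi> (clifford_alt C xs ** C a ** C y) = of_real (2 * g a y) * \<omega> - E - F + (U + V)"
    unfolding E_def F_def U_def V_def \<omega>_def
    by (simp only: clifford_alt_mult_right2[OF e C] linear_add[OF \<phi>] linear_diff[OF \<phi>] linear_scale[OF \<phi>])
       (simp only: scaleR_conv_of_real)
  have arith: "- (z * (k * (of_real (2 * r) * w - E - F + (U + V))
        + cnj k * (of_real (2 * r) * w - E - F - (U + V)) + of_real (2 * s * r) * w))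
      + (2 * (2 * Re k + s) * r) *\<^sub>R (z * w)
      = (2 * Re k) *\<^sub>R (z * F) - (2 * Im k) *\<^sub>R (z * \<i> * U)
        + ((2 * Re k) *\<^sub>R (z * E) + (2 * Im k) *\<^sub>R (- (z * \<i> * V)))"
    for k z w E F U V :: complex and r s :: real
  proof -
    have "- (z * (k * (of_real (2 * r) * w - E - F + (U + V))
        + cnj k * (of_real (2 * r) * w - E - F - (U + V)) + of_real (2 * s * r) * w))
      = - (z * ((k + cnj k) * (of_real (2 * r) * w - E - F) + (k - cnj k) * (U + V) + of_real (2 * s * r) * w))"
      by (simp add: algebra_simps)
    then show ?thesis
      unfolding complex_add_cnj complex_diff_cnj by (simp add: scaleR_conv_of_real algebra_simps)
  qed
  have "covector_wedge (g y) (hierarchy_Q k\<^sub>1 (g a) a \<psi>) xs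
      = (2 * Re k\<^sub>1) *\<^sub>R (z * E) + (2 * Im k\<^sub>1) *\<^sub>R (- (z * \<i> * V))"
    unfolding hierarchy_Q_def by (simp only: covector_wedge_add covector_wedge_scaleR zE zV)
  moreover have "hierarchy_P k\<^sub>1 (g a) a \<psi> (y # xs) = (2 * Re k\<^sub>1) *\<^sub>R (z * F) - (2 * Im k\<^sub>1) *\<^sub>R (z * \<i> * U)"
    unfolding hierarchy_P_def by (simp only: zF zU)
  moreover have "\<psi> xs = z * \<omega>" by (simp add: \<psi> z_def \<omega>_def)
  moreover have "Re (2 * k\<^sub>1 + k\<^sub>2) = 2 * Re k\<^sub>1 + Re k\<^sub>2" by simp
  ultimately show ?thesis
    unfolding z_def[symmetric] \<omega>_def[symmetric] L R by (simp only: arith)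
qed

section \<open>Calculus of smooth maps\<close>

lemma Ck_on_cong:
  assumes "open U" "\<And>x. x \<in> U \<Longrightarrow> f x = g x" "Ck_on k U f"
  shows "Ck_on k U g"
  using assms(2,3)
proof (induction k arbitrary: f g)
  case 0
  then show ?case by (simp cong: continuous_on_cong)
next
  case (Suc k)
  have d: "(g has_derivative frechet_derivative f (at x)) (at x)" if "x \<in> U" for x
  proof -
    have "(f has_derivative frechet_derivative f (at x)) (at x)"
      using Suc.prems that by (simp add: frechet_derivative_works)
    then show ?thesis
      using assms(1) that Suc.prems(1) by (rule has_derivative_transform_within_open)
  qed
  show ?case
    unfolding Ck_on.simps
  proof (intro conjI ballI allI)
    fix x assume "x \<in> U"
    then show "g differentiable at x" using d differentiableI by blast
  next
    fix v
    show "Ck_on k U (\<lambda>x. frechet_derivative g (at x) v)"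
    proof (rule Suc.IH)
      fix x assume "x \<in> U"
      then show "frechet_derivative f (at x) v = frechet_derivative g (at x) v"
        using frechet_derivative_at[OF d] by simp
    qed (use Suc.prems in simp)
  qed
qed

text \<open>On an open set any formula for the derivative may stand for
  \<open>frechet_derivative\<close>.\<close>

lemma Ck_on_SucI:
  assumes "open U" "\<And>x. x \<in> U \<Longrightarrow> (f has_derivative f' x) (at x)" "\<And>v. Ck_on k U (\<lambda>x. f' x v)"
  shows "Ck_on (Suc k) U f"
  unfolding Ck_on.simps
proof (intro conjI ballI allI)
  fix x assume "x \<in> U"
  then show "f differentiable at x" using assms(2) differentiableI by blast
next
  fix v
  show "Ck_on k U (\<lambda>x. frechet_derivative f (at x) v)"
    using assms(1) _ assms(3)[of v]
  proof (rule Ck_on_cong)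
    fix x assume "x \<in> U"
    then show "f' x v = frechet_derivative f (at x) v"
      using frechet_derivative_at[OF assms(2)] by simp
  qed
qed

lemma Ck_on_Suc_has_derivative:
  "Ck_on (Suc k) U f \<Longrightarrow> x \<in> U \<Longrightarrow> (f has_derivative frechet_derivative f (at x)) (at x)"
  by (simp add: frechet_derivative_works)

lemma Ck_on_decrease: "Ck_on (Suc k) U f \<Longrightarrow> Ck_on k U f"
proof (induction k arbitrary: f)
  case 0
  then show ?case
    by (auto intro!: continuous_at_imp_continuous_on dest: differentiable_imp_continuous_within)
next
  case (Suc k)
  then show ?case by (metis Ck_on.simps(2))
qed

lemma Ck_on_const: "Ck_on k U (\<lambda>x. w)"
  by (induction k arbitrary: w) (auto simp: frechet_derivative_const)

lemma Ck_on_linear: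
  assumes "bounded_linear L" "open U" "Ck_on k U f" shows "Ck_on k U (\<lambda>x. L (f x))"
  using assms(3)
proof (induction k arbitrary: f)
  case 0
  then show ?case by (auto intro: bounded_linear.continuous_on[OF assms(1)])
next
  case (Suc k)
  show ?case
  proof (rule Ck_on_SucI[OF assms(2)])
    show "((\<lambda>x. L (f x)) has_derivative (\<lambda>v. L (frechet_derivative f (at x) v))) (at x)" if "x \<in> U" for x
      using bounded_linear.has_derivative[OF assms(1) Ck_on_Suc_has_derivative[OF Suc.prems that]] .
    show "Ck_on k U (\<lambda>x. L (frechet_derivative f (at x) v))" for v
      using Suc by simp
  qed
qed

lemma Ck_on_add:
  assumes "open U" "Ck_on k U f" "Ck_on k U g" shows "Ck_on k U (\<lambda>x. f x + g x)"
  using assms(2,3)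
proof (induction k arbitrary: f g)
  case 0
  then show ?case by (auto intro: continuous_on_add)
next
  case (Suc k)
  show ?case
  proof (rule Ck_on_SucI[OF assms(1)])
    show "((\<lambda>x. f x + g x) has_derivative (\<lambda>v. frechet_derivative f (at x) v + frechet_derivative g (at x) v)) (at x)"
      if "x \<in> U" for x
      by (rule has_derivative_add[OF Suc.prems(1)[THEN Ck_on_Suc_has_derivative, OF that]
            Suc.prems(2)[THEN Ck_on_Suc_has_derivative, OF that]])
    show "Ck_on k U (\<lambda>x. frechet_derivative f (at x) v + frechet_derivative g (at x) v)" for v
      using Suc by simp
  qed
qed

lemma Ck_on_bilinear:
  assumes "bounded_bilinear B" "open U" "Ck_on k U f" "Ck_on k U g"
  shows "Ck_on k U (\<lambda>x. B (f x) (g x))"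
  using assms(3,4)
proof (induction k arbitrary: f g)
  case 0
  then show ?case by (auto intro: bounded_bilinear.continuous_on[OF assms(1)])
next
  case (Suc k)
  show ?case
  proof (rule Ck_on_SucI[OF assms(2)])
    show "((\<lambda>x. B (f x) (g x)) has_derivative
        (\<lambda>v. B (f x) (frechet_derivative g (at x) v) + B (frechet_derivative f (at x) v) (g x))) (at x)"
      if "x \<in> U" for x
      by (rule bounded_bilinear.FDERIV[OF assms(1)]; rule Ck_on_Suc_has_derivative[OF _ that]; fact)
    show "Ck_on k U (\<lambda>x. B (f x) (frechet_derivative g (at x) v) + B (frechet_derivative f (at x) v) (g x))" for v
    \<comment> \<open>The product rule pairs a derivative with an undifferentiated factor, which is
      lowered to the same order.\<close>
    proof (rule Ck_on_add[OF assms(2)])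
      show "Ck_on k U (\<lambda>x. B (f x) (frechet_derivative g (at x) v))"
        using Suc.prems Ck_on_decrease[OF Suc.prems(1)] by (intro Suc.IH) simp_all
      show "Ck_on k U (\<lambda>x. B (frechet_derivative f (at x) v) (g x))"
        using Suc.prems Ck_on_decrease[OF Suc.prems(2)] by (intro Suc.IH) simp_all
    qed
  qed
qed

text \<open>Orthonormal frames live only on open pieces of a chart, while a multi-form must be
  smooth on all of it.\<close>

lemma Ck_on_local:
  assumes "\<And>x. x \<in> U \<Longrightarrow> \<exists>V. open V \<and> x \<in> V \<and> Ck_on k V f"
  shows "Ck_on k U f"
  using assms
proof (induction k arbitrary: f)
  case 0
  then show ?case
    by (fastforce intro!: continuous_at_imp_continuous_on simp: continuous_on_eq_continuous_at)
next
  case (Suc k)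
  show ?case
    unfolding Ck_on.simps
  proof (intro conjI ballI allI)
    fix x assume "x \<in> U"
    then show "f differentiable at x" using Suc.prems by fastforce
  next
    fix v show "Ck_on k U (\<lambda>x. frechet_derivative f (at x) v)"
    proof (rule Suc.IH)
      fix x assume "x \<in> U"
      then obtain V where "open V" "x \<in> V" "Ck_on (Suc k) V f" using Suc.prems by blast
      then show "\<exists>V. open V \<and> x \<in> V \<and> Ck_on k V (\<lambda>x. frechet_derivative f (at x) v)" by auto
    qed
  qed
qed

section \<open>Smoothness and derivatives in a chart\<close>

lemma open_chart_image:
  assumes "is_chart c" "open W" shows "open (snd c ` (fst c \<inter> W))"
proof -
  have hom: "homeomorphism (fst c) (snd c ` fst c) (snd c) (inv_into (fst c) (snd c))"
    and o: "open (snd c ` fst c)"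
    using assms(1) by (auto simp: is_chart_def)
  have "openin (top_of_set (snd c ` fst c)) (snd c ` (fst c \<inter> W))"
    using hom by (rule homeomorphism_imp_open_map) (simp add: assms(2) openin_open_Int)
  then show ?thesis using o openin_open_eq by blast
qed

lemma inv_into_chart:
  assumes "is_chart c" "x \<in> fst c" shows "inv_into (fst c) (snd c) (snd c x) = x"
  using assms by (auto simp: is_chart_def homeomorphism_def)

lemma in_chart_apply:
  assumes "is_chart c" "x \<in> fst c" shows "in_chart c f (snd c x) = f x"
  by (simp add: in_chart_def inv_into_chart[OF assms])

lemma in_chart_eq:
  assumes "is_chart c" "\<And>x. x \<in> fst c \<inter> W \<Longrightarrow> f x = g x" "z \<in> snd c ` (fst c \<inter> W)"
  shows "in_chart c f z = in_chart c g z"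
proof -
  obtain x where "x \<in> fst c \<inter> W" "z = snd c x" using assms(3) by blast
  then show ?thesis
    using in_chart_apply[OF assms(1), of x f] in_chart_apply[OF assms(1), of x g] assms(2) by simp
qed

lemma smooth_in_chart_cong:
  assumes "is_chart c" "open W" "\<And>x. x \<in> fst c \<inter> W \<Longrightarrow> f x = g x" "smooth_in_chart c W f"
  shows "smooth_in_chart c W g"
  unfolding smooth_in_chart_def smooth_on_def
proof
  fix k
  have "Ck_on k (snd c ` (fst c \<inter> W)) (in_chart c f)"
    using assms(4) by (simp add: smooth_in_chart_def smooth_on_def)
  then show "Ck_on k (snd c ` (fst c \<inter> W)) (in_chart c g)"
    by (rule Ck_on_cong[OF open_chart_image[OF assms(1,2)] in_chart_eq[OF assms(1,3)], rotated -1])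
qed

lemma smooth_in_chart_const: "smooth_in_chart c W (\<lambda>x. w)"
  by (simp add: smooth_in_chart_def smooth_on_def in_chart_def o_def Ck_on_const)

lemma smooth_in_chart_linear:
  assumes "is_chart c" "open W" "bounded_linear L" "smooth_in_chart c W f"
  shows "smooth_in_chart c W (\<lambda>x. L (f x))"
  unfolding smooth_in_chart_def smooth_on_def
proof
  fix k
  show "Ck_on k (snd c ` (fst c \<inter> W)) (in_chart c (\<lambda>x. L (f x)))"
    using Ck_on_linear[OF assms(3) open_chart_image[OF assms(1,2)], of k "in_chart c f"] assms(4)
    by (simp add: smooth_in_chart_def smooth_on_def in_chart_def o_def)
qed

lemma smooth_in_chart_add:
  assumes "is_chart c" "open W" "smooth_in_chart c W f" "smooth_in_chart c W g"
  shows "smooth_in_chart c W (\<lambda>x. f x + g x)"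
  unfolding smooth_in_chart_def smooth_on_def
proof
  fix k
  show "Ck_on k (snd c ` (fst c \<inter> W)) (in_chart c (\<lambda>x. f x + g x))"
    using Ck_on_add[OF open_chart_image[OF assms(1,2)], of k "in_chart c f" "in_chart c g"] assms(3,4)
    by (simp add: smooth_in_chart_def smooth_on_def in_chart_def o_def)
qed

lemma smooth_in_chart_bilinear:
  assumes "is_chart c" "open W" "bounded_bilinear B" "smooth_in_chart c W f" "smooth_in_chart c W g"
  shows "smooth_in_chart c W (\<lambda>x. B (f x) (g x))"
  unfolding smooth_in_chart_def smooth_on_def
proof
  fix k
  show "Ck_on k (snd c ` (fst c \<inter> W)) (in_chart c (\<lambda>x. B (f x) (g x)))"
    using Ck_on_bilinear[OF assms(3) open_chart_image[OF assms(1,2)], of k "in_chart c f" "in_chart c g"]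
      assms(4,5)
    by (simp add: smooth_in_chart_def smooth_on_def in_chart_def o_def)
qed

lemma smooth_in_chart_sum:
  assumes "is_chart c" "open W" "\<And>i. i \<in> I \<Longrightarrow> smooth_in_chart c W (f i)"
  shows "smooth_in_chart c W (\<lambda>x. \<Sum>i\<in>I. f i x)"
  using assms(3)
  by (induction I rule: infinite_finite_induct)
     (auto intro: smooth_in_chart_const smooth_in_chart_add[OF assms(1,2)])

lemma smooth_in_chart_scaleR:
  assumes "is_chart c" "open W" "smooth_in_chart c W f" "smooth_in_chart c W g"
  shows "smooth_in_chart c W (\<lambda>x. f x *\<^sub>R g x)"
  by (rule smooth_in_chart_bilinear[OF assms(1,2) bounded_bilinear_scaleR assms(3,4)])

lemma Ck_on_subset: "Ck_on k U f \<Longrightarrow> V \<subseteq> U \<Longrightarrow> Ck_on k V f"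
  by (induction k arbitrary: f) (auto intro: continuous_on_subset)

lemma smooth_in_chart_subset: "smooth_in_chart c W f \<Longrightarrow> V \<subseteq> W \<Longrightarrow> smooth_in_chart c V f"
  unfolding smooth_in_chart_def smooth_on_def by (meson Ck_on_subset Int_mono image_mono order_refl)

lemma smooth_in_chart_local:
  assumes "is_chart c" "\<And>x. x \<in> fst c \<inter> W \<Longrightarrow> \<exists>V. open V \<and> x \<in> V \<and> smooth_in_chart c V f"
  shows "smooth_in_chart c W f"
  unfolding smooth_in_chart_def smooth_on_def
proof (intro allI Ck_on_local)
  fix k z assume "z \<in> snd c ` (fst c \<inter> W)"
  then obtain x where x: "x \<in> fst c \<inter> W" "z = snd c x" by blast
  then obtain V where V: "open V" "x \<in> V" "smooth_in_chart c V f" using assms(2) by blast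
  then have "open (snd c ` (fst c \<inter> V))" "z \<in> snd c ` (fst c \<inter> V)"
      "Ck_on k (snd c ` (fst c \<inter> V)) (in_chart c f)"
    using x open_chart_image[OF assms(1)] by (auto simp: smooth_in_chart_def smooth_on_def)
  then show "\<exists>V. open V \<and> z \<in> V \<and> Ck_on k V (in_chart c f)" by blast
qed

lemma smooth_in_chart_has_derivative:
  assumes "smooth_in_chart c W f" "x \<in> fst c \<inter> W"
  shows "(in_chart c f has_derivative deriv_in c f x) (at (snd c x))"
proof -
  have "Ck_on (Suc 0) (snd c ` (fst c \<inter> W)) (in_chart c f)"
    using assms(1) unfolding smooth_in_chart_def smooth_on_def by blast
  then have "(in_chart c f has_derivative frechet_derivative (in_chart c f) (at (snd c x))) (at (snd c x))"
    by (rule Ck_on_Suc_has_derivative) (use assms(2) in blast)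
  also have "frechet_derivative (in_chart c f) (at (snd c x)) = deriv_in c f x"
    by (simp add: deriv_in_def fun_eq_iff)
  finally show ?thesis .
qed

lemma deriv_in_eqI: "(in_chart c f has_derivative D) (at (snd c x)) \<Longrightarrow> deriv_in c f x = D"
  using frechet_derivative_at by (fastforce simp: deriv_in_def fun_eq_iff)

text \<open>Lets a field be replaced by a formula that holds only near the point, such as one in a
  local frame.\<close>

lemma in_chart_has_derivative_cong:
  assumes "is_chart c" "open W" "x \<in> fst c \<inter> W" "\<And>y. y \<in> fst c \<inter> W \<Longrightarrow> f y = h y"
    and "(in_chart c f has_derivative D) (at (snd c x))"
  shows "(in_chart c h has_derivative D) (at (snd c x))"
  using assms(5) open_chart_image[OF assms(1,2)] imageI[OF assms(3)] in_chart_eq[OF assms(1,4)]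
  by (rule has_derivative_transform_within_open)

lemma deriv_in_cong:
  assumes "is_chart c" "open W" "x \<in> fst c \<inter> W" "\<And>y. y \<in> fst c \<inter> W \<Longrightarrow> f y = h y"
    and "(in_chart c f has_derivative D) (at (snd c x))"
  shows "deriv_in c h x = D"
  by (rule deriv_in_eqI[OF in_chart_has_derivative_cong[OF assms]])

section \<open>The Levi-Civita connection\<close>

lemma linear_axis: "linear f \<Longrightarrow> f (v :: real ^ 'n::finite) = (\<Sum>k\<in>UNIV. v $ k *\<^sub>R f (axis k 1))"
  by (subst basis_expansion[symmetric, of v])
     (simp add: linear_sum linear_scale scalar_mult_eq_scaleR del: basis_expansion)

lemma bilinear_axis:
  fixes u v :: "real ^ 'n::finite"
  assumes "bilinear h"
  shows "h u v = (\<Sum>k\<in>UNIV. \<Sum>l\<in>UNIV. (u $ k * v $ l) *\<^sub>R h (axis k 1) (axis l 1))"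
proof -
  have l: "linear (\<lambda>u. h u v)" "linear (h u)" for u v using assms by (auto simp: bilinear_def)
  have "h u v = (\<Sum>k\<in>UNIV. u $ k *\<^sub>R h (axis k 1) v)" by (rule linear_axis[OF l(1)])
  also have "\<dots> = (\<Sum>k\<in>UNIV. u $ k *\<^sub>R (\<Sum>l\<in>UNIV. v $ l *\<^sub>R h (axis k 1) (axis l 1)))"
    by (intro sum.cong refl arg_cong2[where f = scaleR] linear_axis[OF l(2)])
  finally show ?thesis by (simp add: scaleR_sum_right)
qed

lemma riemannian_manifoldD:
  assumes "riemannian_manifold M" "c \<in> atlas M"
  shows "is_chart c" "smooth_in_chart c UNIV (\<lambda>x. gm M c x u v)"
    and "x \<in> fst c \<Longrightarrow> inner_product_form (gm M c x)"
    and "c' \<in> atlas M \<Longrightarrow> smooth_in_chart c (fst c') (snd c')"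
    and "c' \<in> atlas M \<Longrightarrow> x \<in> fst c \<inter> fst c' \<Longrightarrow>
      gm M c' x (deriv_in c (snd c') x u) (deriv_in c (snd c') x v) = gm M c x u v"
  using assms by (auto simp: riemannian_manifold_def smooth_atlas_def)

lemma in_chart_const_has_derivative: "(in_chart c (\<lambda>y. w) has_derivative (\<lambda>u. 0)) (at z)"
  by (simp add: in_chart_def o_def)

text \<open>Smoothness of the metric is given for constant arguments, so moving ones are expanded in
  the coordinate basis.\<close>

lemma gm_has_derivative_components:
  assumes M: "riemannian_manifold M" "c \<in> atlas M" and x: "x \<in> fst c"
    and X: "(in_chart c X has_derivative X') (at (snd c x))"
    and Y: "(in_chart c Y has_derivative Y') (at (snd c x))"
  shows "(in_chart c (\<lambda>y. gm M c y (X y) (Y y)) has_derivative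
    (\<lambda>w. gm M c x (X' w) (Y x) + gm M c x (X x) (Y' w)
      + (\<Sum>k\<in>UNIV. \<Sum>l\<in>UNIV. (X x $ k * Y x $ l) *\<^sub>R
           deriv_in c (\<lambda>y. gm M c y (axis k 1) (axis l 1)) x w))) (at (snd c x))"
proof -
  note c = riemannian_manifoldD(1)[OF M]
  note bil = inner_product_formD(1)[OF riemannian_manifoldD(3)[OF M]]
  let ?g = "\<lambda>k l y. gm M c y (axis k 1) (axis l 1)"
  let ?D = "\<lambda>k l. deriv_in c (?g k l) x"
  have g: "(in_chart c (?g k l) has_derivative ?D k l) (at (snd c x))" for k l
    using x by (intro smooth_in_chart_has_derivative[OF riemannian_manifoldD(2)[OF M]]) simp
  have "(in_chart c (\<lambda>y. \<Sum>k\<in>UNIV. \<Sum>l\<in>UNIV. (X y $ k * Y y $ l) * ?g k l y) has_derivative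
      (\<lambda>w. \<Sum>k\<in>UNIV. \<Sum>l\<in>UNIV. (X x $ k * Y x $ l) * ?D k l w
         + (X x $ k * Y' w $ l + X' w $ k * Y x $ l) * ?g k l x)) (at (snd c x))"
  proof -
    have Xk: "((\<lambda>z. in_chart c X z $ k) has_derivative (\<lambda>w. X' w $ k)) (at (snd c x))"
      and Yk: "((\<lambda>z. in_chart c Y z $ k) has_derivative (\<lambda>w. Y' w $ k)) (at (snd c x))" for k
      by (rule bounded_linear.has_derivative[OF bounded_linear_vec_nth X]
          bounded_linear.has_derivative[OF bounded_linear_vec_nth Y])+
    have "((\<lambda>z. \<Sum>k\<in>UNIV. \<Sum>l\<in>UNIV. (in_chart c X z $ k * in_chart c Y z $ l) * in_chart c (?g k l) z)
        has_derivative
      (\<lambda>w. \<Sum>k\<in>UNIV. \<Sum>l\<in>UNIV. (in_chart c X (snd c x) $ k * in_chart c Y (snd c x) $ l) * ?D k l w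
         + (in_chart c X (snd c x) $ k * Y' w $ l + X' w $ k * in_chart c Y (snd c x) $ l)
            * in_chart c (?g k l) (snd c x))) (at (snd c x))"
      by (intro has_derivative_sum has_derivative_mult Xk Yk g)
    then show ?thesis
      by (simp add: in_chart_apply[OF c x]) (simp add: in_chart_def o_def)
  qed
  then have "(in_chart c (\<lambda>y. gm M c y (X y) (Y y)) has_derivative
      (\<lambda>w. \<Sum>k\<in>UNIV. \<Sum>l\<in>UNIV. (X x $ k * Y x $ l) * ?D k l w
         + (X x $ k * Y' w $ l + X' w $ k * Y x $ l) * ?g k l x)) (at (snd c x))"
    by (rule in_chart_has_derivative_cong[OF c open_UNIV, rotated 2])
       (use x in \<open>auto simp: bilinear_axis[OF bil, of _ "X _"]\<close>)
  then show ?thesis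
    by (rule has_derivative_eq_rhs)
       (simp add: fun_eq_iff bilinear_axis[OF bil[OF x], of "X' _"] bilinear_axis[OF bil[OF x], of "X x"]
          sum.distrib algebra_simps)
qed

text \<open>For constant fields only the derivative of the coefficients survives. The component
  formula makes visible that the derivative is bilinear in \<open>u\<close> and
  \<open>v\<close>.\<close>

lemma deriv_gm_bilinear:
  fixes u v :: "real ^ 'n::finite"
  assumes M: "riemannian_manifold M" "c \<in> atlas M" and x: "x \<in> fst c"
  shows "deriv_in c (\<lambda>y. gm M c y u v) x w = (\<Sum>k\<in>UNIV. \<Sum>l\<in>UNIV. (u $ k * v $ l) *\<^sub>R
           deriv_in c (\<lambda>y. gm M c y (axis k 1) (axis l 1)) x w)"
proof -
  note lin = inner_product_formD(3,4)[OF riemannian_manifoldD(3)[OF M x]]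
  have "(in_chart c (\<lambda>y. gm M c y u v) has_derivative (\<lambda>w. \<Sum>k\<in>UNIV. \<Sum>l\<in>UNIV. (u $ k * v $ l) *\<^sub>R
           deriv_in c (\<lambda>y. gm M c y (axis k 1) (axis l 1)) x w)) (at (snd c x))"
    using gm_has_derivative_components[OF M x in_chart_const_has_derivative in_chart_const_has_derivative, of u v]
    by (simp add: linear_0[OF lin(1)] linear_0[OF lin(2)])
  from fun_cong[OF deriv_in_eqI[OF this]] show ?thesis .
qed

lemma deriv_in_linear:
  assumes "smooth_in_chart c W f" "x \<in> fst c \<inter> W" shows "linear (deriv_in c f x)"
  using smooth_in_chart_has_derivative[OF assms] by (rule has_derivative_linear)

text \<open>Koszul's formula; an orthonormal basis turns the linear form that it defines into a vector.\<close>

lemma christoffel: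
  assumes M: "riemannian_manifold M" "c \<in> atlas M" and x: "x \<in> fst c"
    and e: "orthonormal_basis (gm M c x) e"
  shows "bilinear (christoffel M c x)" "christoffel M c x u v = christoffel M c x v u"
    and "deriv_in c (\<lambda>y. gm M c y u v) x w
      = gm M c x (christoffel M c x w u) v + gm M c x u (christoffel M c x w v)"
proof -
  define g where "g = gm M c x"
  define D where "D u v w = deriv_in c (\<lambda>y. gm M c y u v) x w" for u v w
  note e = e[folded g_def]
  note g = inner_product_formD[OF orthonormal_basisD(1)[OF e]]
  have D_sum: "D u v w = (\<Sum>k\<in>UNIV. \<Sum>l\<in>UNIV. (u $ k * v $ l) *\<^sub>R D (axis k 1) (axis l 1) w)" for u v w
    unfolding D_def by (rule deriv_gm_bilinear[OF M x])
  have D1: "linear (\<lambda>u. D u v w)" for v w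
  proof -
    have "linear (\<lambda>u. \<Sum>k\<in>UNIV. \<Sum>l\<in>UNIV. (u $ k * v $ l) *\<^sub>R D (axis k 1) (axis l 1) w)"
      by (rule linearI) (simp_all add: sum.distrib sum_distrib_left algebra_simps)
    then show ?thesis unfolding D_sum[of _ v w, symmetric] .
  qed
  have D2: "linear (\<lambda>v. D u v w)" for u w
  proof -
    have "linear (\<lambda>v. \<Sum>k\<in>UNIV. \<Sum>l\<in>UNIV. (u $ k * v $ l) *\<^sub>R D (axis k 1) (axis l 1) w)"
      by (rule linearI) (simp_all add: sum.distrib sum_distrib_left algebra_simps)
    then show ?thesis unfolding D_sum[of u _ w, symmetric] .
  qed
  have D3: "linear (\<lambda>w. D u v w)" for u v
    unfolding D_def using x by (intro deriv_in_linear[OF riemannian_manifoldD(2)[OF M]]) simp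
  have D_sym: "D u v w = D v u w" for u v w
  proof -
    have "(in_chart c (\<lambda>y. gm M c y v u) has_derivative deriv_in c (\<lambda>y. gm M c y v u) x) (at (snd c x))"
      using x by (intro smooth_in_chart_has_derivative[OF riemannian_manifoldD(2)[OF M]]) simp
    then have "deriv_in c (\<lambda>y. gm M c y u v) x = deriv_in c (\<lambda>y. gm M c y v u) x"
      using x by (intro deriv_in_cong[OF riemannian_manifoldD(1)[OF M] open_UNIV])
        (auto intro: inner_product_formD(2)[OF riemannian_manifoldD(3)[OF M]])
    then show ?thesis by (simp add: D_def)
  qed
  \<comment> \<open>The Christoffel symbol of the first kind: in this combination of derivatives,
    metric compatibility and symmetry cancel all but \<open>g (G u v) w\<close>.\<close>
  define K where "K u v w = (1 / 2) * (D v w u + D u w v - D u v w)" for u v w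
  have K3: "linear (K u v)" for u v
    unfolding K_def
    by (rule linearI) (simp_all add: linear_add[OF D2] linear_add[OF D3] linear_scale[OF D2] linear_scale[OF D3] algebra_simps)
  have K2: "linear (\<lambda>v. K u v w)" for u w
    unfolding K_def
    by (rule linearI) (simp_all add: linear_add[OF D1] linear_add[OF D2] linear_add[OF D3]
        linear_scale[OF D1] linear_scale[OF D2] linear_scale[OF D3] algebra_simps)
  have K_sym: "K u v w = K v u w" for u v w
    by (simp add: K_def D_sym[of u v])
  define G where "G u v = (\<Sum>i\<in>UNIV. K u v (e i) *\<^sub>R e i)" for u v
  have gG: "g (G u v) w = K u v w" for u v w
  proof -
    have "g (G u v) w = (\<Sum>i\<in>UNIV. K u v (e i) * g w (e i))"
      by (simp add: G_def linear_sum[OF g(4)] linear_scale[OF g(4)] g(2)[of w])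
    also have "\<dots> = K u v w"
      by (subst linear_orthonormal_expand[OF e K3, of u v w]) (simp add: mult.commute)
    finally show ?thesis .
  qed
  let ?P = "\<lambda>G. bilinear G \<and> (\<forall>u v. G u v = G v u) \<and>
     (\<forall>u v w. deriv_in c (\<lambda>y. gm M c y u v) x w = gm M c x (G w u) v + gm M c x u (G w v))"
  have ex: "?P G"
  proof (intro conjI allI)
    have "G u (v + v') = G u v + G u v'" "G u (r *\<^sub>R v) = r *\<^sub>R G u v" for u v v' r
      by (simp_all add: G_def linear_add[OF K2] linear_scale[OF K2] scaleR_left_distrib sum.distrib scaleR_sum_right)
    moreover show sym: "G u v = G v u" for u v by (simp add: G_def K_sym[of u v])
    ultimately show "bilinear G"
      unfolding bilinear_def by (intro conjI allI linearI) (metis sym)+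
    show "deriv_in c (\<lambda>y. gm M c y u v) x w = gm M c x (G w u) v + gm M c x u (G w v)" for u v w
      unfolding D_def[symmetric] g_def[symmetric]
      by (simp add: g(2)[of u] gG K_def D_sym[of v u] D_sym[of v w] D_sym[of u w])
         (simp add: field_simps)
  qed
  \<comment> \<open>Metric compatibility of \<open>H\<close> turns \<open>K u v w\<close> into
    \<open>g (H u v) w\<close>, so \<open>H\<close> and \<open>G\<close> have the same products with
    every \<open>w\<close>.\<close>
  moreover have uniq: "H = G" if H: "?P H" for H
  proof (intro ext)
    fix u v
    have Hsym: "H u v = H v u" for u v using H by blast
    have HD: "D u v w = g (H w u) v + g u (H w v)" for u v w
      using H unfolding D_def g_def by blast
    have "g (H u v) w = K u v w" for w
      unfolding K_def HD
      by (simp add: g(2)[of v] g(2)[of u] Hsym[of v u] Hsym[of w u] Hsym[of w v])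
    then show "H u v = G u v"
      by (simp add: inner_product_form_eq_iff[OF orthonormal_basisD(1)[OF e]] gG)
  qed
  ultimately have "?P (christoffel M c x)"
    unfolding christoffel_def by (rule theI)
  then show "bilinear (christoffel M c x)" "christoffel M c x u v = christoffel M c x v u"
    "deriv_in c (\<lambda>y. gm M c y u v) x w
      = gm M c x (christoffel M c x w u) v + gm M c x u (christoffel M c x w v)"
    by blast+
qed

text \<open>The metric is parallel: its own derivative is absorbed in the covariant derivatives of
  the two fields.\<close>

lemma gm_has_derivative:
  assumes M: "riemannian_manifold M" "c \<in> atlas M" and x: "x \<in> fst c"
    and e: "orthonormal_basis (gm M c x) e"
    and X: "(in_chart c X has_derivative X') (at (snd c x))"
    and Y: "(in_chart c Y has_derivative Y') (at (snd c x))"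
  shows "(in_chart c (\<lambda>y. gm M c y (X y) (Y y)) has_derivative
    (\<lambda>w. gm M c x (X' w + christoffel M c x w (X x)) (Y x)
       + gm M c x (X x) (Y' w + christoffel M c x w (Y x)))) (at (snd c x))"
proof -
  note g = inner_product_formD[OF orthonormal_basisD(1)[OF e]]
  have "(\<Sum>k\<in>UNIV. \<Sum>l\<in>UNIV. (X x $ k * Y x $ l) *\<^sub>R deriv_in c (\<lambda>y. gm M c y (axis k 1) (axis l 1)) x w)
      = gm M c x (christoffel M c x w (X x)) (Y x) + gm M c x (X x) (christoffel M c x w (Y x))" for w
    unfolding deriv_gm_bilinear[OF M x, symmetric] by (rule christoffel(3)[OF M x e])
  then show ?thesis
    by (intro has_derivative_eq_rhs[OF gm_has_derivative_components[OF M x X Y]])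
       (simp add: fun_eq_iff linear_add[OF g(3)] linear_add[OF g(4)])
qed

section \<open>Derivatives of antisymmetrised products\<close>

lemma antisymmetrize_linear: "linear L \<Longrightarrow> antisymmetrize (\<lambda>ys. L (f ys)) xs = L (antisymmetrize f xs)"
  by (simp add: antisymmetrize_def linear_scale linear_sum)

lemma antisymmetrize_diff: "antisymmetrize (\<lambda>ys. f ys - h ys) xs = antisymmetrize f xs - antisymmetrize h xs"
  by (simp add: antisymmetrize_def scaleR_right_diff_distrib sum_subtractf)

text \<open>Transforming each entry in turn treats all positions alike, hence commutes with
  permuting the list.\<close>

lemma antisymmetrize_derivation:
  "antisymmetrize (\<lambda>ys. \<Sum>i<length ys. f (ys[i := B (ys ! i)])) xs
    = (\<Sum>i<length xs. antisymmetrize f (xs[i := B (xs ! i)]))"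
proof -
  \<comment> \<open>Position \<open>i\<close> of the permuted list is entry
    \<open>\<sigma> i\<close> of the original, so the sum over positions is relabelled by
    \<open>\<sigma>\<close>.\<close>
  have reindex: "(\<Sum>i<length xs. f ((permute_list \<sigma> xs)[i := B (permute_list \<sigma> xs ! i)]))
      = (\<Sum>i<length xs. f (permute_list \<sigma> (xs[i := B (xs ! i)])))" if s: "\<sigma> permutes {..<length xs}" for \<sigma>
  proof -
    have "(\<Sum>i<length xs. f (permute_list \<sigma> (xs[i := B (xs ! i)])))
        = (\<Sum>i<length xs. f (permute_list \<sigma> (xs[\<sigma> i := B (xs ! \<sigma> i)])))"
      by (rule sum.permute[OF s, unfolded o_def])
    also have "\<dots> = (\<Sum>i<length xs. f ((permute_list \<sigma> xs)[i := B (permute_list \<sigma> xs ! i)]))"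
    proof (intro sum.cong refl)
      fix i assume "i \<in> {..<length xs}"
      then have "\<sigma> i < length xs" "i < length xs" using permutes_in_image[OF s] by auto
      then show "f (permute_list \<sigma> (xs[\<sigma> i := B (xs ! \<sigma> i)]))
          = f ((permute_list \<sigma> xs)[i := B (permute_list \<sigma> xs ! i)])"
        by (simp add: permute_list_update[OF s] permute_list_nth[OF s] permutes_inverses[OF s])
    qed
    finally show ?thesis by simp
  qed
  have "antisymmetrize (\<lambda>ys. \<Sum>i<length ys. f (ys[i := B (ys ! i)])) xs
      = (1 / fact (length xs)) *\<^sub>R (\<Sum>\<sigma> | \<sigma> permutes {..<length xs}. \<Sum>i<length xs.
          of_int (sign \<sigma>) *\<^sub>R f (permute_list \<sigma> (xs[i := B (xs ! i)])))"
    by (simp add: antisymmetrize_def reindex scaleR_sum_right)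
  also have "\<dots> = (\<Sum>i<length xs. antisymmetrize f (xs[i := B (xs ! i)]))"
    by (subst sum.swap) (simp add: antisymmetrize_def scaleR_sum_right)
  finally show ?thesis .
qed

lemma antisymmetrize_has_derivative:
  assumes "\<And>ys. length ys = length xs \<Longrightarrow> ((\<lambda>z. f z ys) has_derivative (\<lambda>u. f' u ys)) F"
  shows "((\<lambda>z. antisymmetrize (f z) xs) has_derivative (\<lambda>u. antisymmetrize (f' u) xs)) F"
  unfolding antisymmetrize_def
  by (intro has_derivative_scaleR_right has_derivative_sum assms) simp

text \<open>\<open>B\<close> will be the Christoffel map and \<open>\<Omega>\<close> the spin
  connection. The commutator with \<open>\<Omega>\<close> is a derivation of the product, so the
  inner \<open>\<Omega>\<close> terms cancel between neighbouring letters.\<close>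

lemma clifford_word_has_derivative:
  fixes C :: "'a::real_normed_vector \<Rightarrow> 'v \<Rightarrow> complex ^ 's::finite ^ 's"
  assumes "\<And>v. ((\<lambda>z. C z v) has_derivative (\<lambda>u. C z\<^sub>0 (B u v) - (\<Omega> u ** C z\<^sub>0 v - C z\<^sub>0 v ** \<Omega> u))) (at z\<^sub>0)"
  shows "((\<lambda>z. clifford_word (C z) xs) has_derivative
    (\<lambda>u. (\<Sum>i<length xs. clifford_word (C z\<^sub>0) (xs[i := B u (xs ! i)]))
       - (\<Omega> u ** clifford_word (C z\<^sub>0) xs - clifford_word (C z\<^sub>0) xs ** \<Omega> u))) (at z\<^sub>0)"
proof (induction xs)
  case Nil
  then show ?case by simp
next
  case (Cons v xs)
  show ?case
    unfolding clifford_word_simps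
    by (rule has_derivative_eq_rhs[OF bounded_bilinear.FDERIV[OF bounded_bilinear_matrix_matrix_mult assms Cons.IH]])
       (simp add: fun_eq_iff sum.lessThan_Suc_shift mmult_simps linear_sum[OF linear_mmult_left] matrix_mul_assoc
          del: sum.lessThan_Suc)
qed

lemma clifford_alt_has_derivative:
  fixes C :: "'a::real_normed_vector \<Rightarrow> real ^ 'n::finite \<Rightarrow> complex ^ 's::finite ^ 's"
  assumes "\<And>v. ((\<lambda>z. C z v) has_derivative (\<lambda>u. C z\<^sub>0 (B u v) - (\<Omega> u ** C z\<^sub>0 v - C z\<^sub>0 v ** \<Omega> u))) (at z\<^sub>0)"
  shows "((\<lambda>z. clifford_alt (C z) xs) has_derivative
    (\<lambda>u. (\<Sum>i<length xs. clifford_alt (C z\<^sub>0) (xs[i := B u (xs ! i)]))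
       - (\<Omega> u ** clifford_alt (C z\<^sub>0) xs - clifford_alt (C z\<^sub>0) xs ** \<Omega> u))) (at z\<^sub>0)"
proof -
  have "((\<lambda>z. clifford_alt (C z) xs) has_derivative (\<lambda>u. antisymmetrize (\<lambda>ys.
      (\<Sum>i<length ys. clifford_word (C z\<^sub>0) (ys[i := B u (ys ! i)]))
        - (\<Omega> u ** clifford_word (C z\<^sub>0) ys - clifford_word (C z\<^sub>0) ys ** \<Omega> u)) xs)) (at z\<^sub>0)"
    by (intro antisymmetrize_has_derivative clifford_word_has_derivative assms)
  then show ?thesis
    by (simp only: antisymmetrize_diff antisymmetrize_derivation
        antisymmetrize_linear[OF linear_mmult_left] antisymmetrize_linear[OF linear_mmult_right])
qed

section \<open>Spinor bilinears\<close>

lemma hermitian_inner_productD: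
  assumes "hermitian_inner_product h"
  shows "h \<eta> (\<zeta> + \<xi>) = h \<eta> \<zeta> + h \<eta> \<xi>" "h (\<eta> + \<zeta>) \<xi> = h \<eta> \<xi> + h \<zeta> \<xi>"
    and "h \<eta> (k *s \<zeta>) = k * h \<eta> \<zeta>" "h (k *s \<eta>) \<zeta> = cnj k * h \<eta> \<zeta>"
    and "h \<zeta> \<eta> = cnj (h \<eta> \<zeta>)"
proof -
  have add: "h \<eta> (\<zeta> + \<xi>) = h \<eta> \<zeta> + h \<eta> \<xi>" and scale: "h \<eta> (k *s \<zeta>) = k * h \<eta> \<zeta>"
    and sym: "h \<zeta> \<eta> = cnj (h \<eta> \<zeta>)" for \<eta> \<zeta> \<xi> k
    using assms unfolding hermitian_inner_product_def by blast+
  show "h \<eta> (\<zeta> + \<xi>) = h \<eta> \<zeta> + h \<eta> \<xi>" "h \<eta> (k *s \<zeta>) = k * h \<eta> \<zeta>" "h \<zeta> \<eta> = cnj (h \<eta> \<zeta>)"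
    by (rule add scale sym)+
  have "h (\<eta> + \<zeta>) \<xi> = cnj (h \<xi> (\<eta> + \<zeta>))" by (rule sym)
  also have "\<dots> = cnj (h \<xi> \<eta>) + cnj (h \<xi> \<zeta>)" by (simp add: add)
  also have "\<dots> = h \<eta> \<xi> + h \<zeta> \<xi>" by (simp only: sym[symmetric])
  finally show "h (\<eta> + \<zeta>) \<xi> = h \<eta> \<xi> + h \<zeta> \<xi>" .
  have "h (k *s \<eta>) \<zeta> = cnj (h \<zeta> (k *s \<eta>))" by (rule sym)
  also have "\<dots> = cnj k * cnj (h \<zeta> \<eta>)" by (simp add: scale)
  also have "\<dots> = cnj k * h \<eta> \<zeta>" by (simp only: sym[symmetric])
  finally show "h (k *s \<eta>) \<zeta> = cnj k * h \<eta> \<zeta>" .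
qed

lemma scaleR_vec_complex: "r *\<^sub>R (\<eta> :: complex ^ 's) = of_real r *s \<eta>"
  unfolding vec_eq_iff vector_scaleR_component vector_smult_component by (simp add: scaleR_conv_of_real)

lemma bounded_bilinear_hermitian:
  fixes h :: "complex ^ 's::finite \<Rightarrow> complex ^ 's \<Rightarrow> complex"
  assumes "hermitian_inner_product h" shows "bounded_bilinear h"
  unfolding bilinear_conv_bounded_bilinear[symmetric] bilinear_def
  by (intro conjI allI linearI)
     (simp_all add: hermitian_inner_productD(1-4)[OF assms] scaleR_vec_complex scaleR_conv_of_real)

locale spin_manifold =
  fixes S :: "('m::{t2_space, second_countable_topology}, 'n::finite, 'i, 's::finite) spin_riemannian"
  assumes spin: "spin_riemannian_manifold S"
begin

lemma riem: "riemannian_manifold S"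
  and clifford_rel: "clifford_relations (gam S)"
  and herm: "hermitian_inner_product (ip S)"
  and gam_adjoint: "ip S (gam S i *v \<eta>) \<zeta> = ip S \<eta> (gam S i *v \<zeta>)"
  and open_dom: "a \<in> frames S \<Longrightarrow> open (dom_of S a)"
  and frame_cover: "\<exists>a. a \<in> frames S \<and> x \<in> dom_of S a"
  and frame_vector_field: "a \<in> frames S \<Longrightarrow> vector_field_on S (dom_of S a) (frame S a i)"
  and frame_orthonormal: "a \<in> frames S \<Longrightarrow> c \<in> atlas S \<Longrightarrow> x \<in> fst c \<inter> dom_of S a \<Longrightarrow>
     gm S c x (frame S a i c x) (frame S a j c x) = (if i = j then 1 else 0)"
  and transition_cl: "a \<in> frames S \<Longrightarrow> b \<in> frames S \<Longrightarrow> c \<in> atlas S \<Longrightarrow>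
     x \<in> fst c \<inter> dom_of S a \<inter> dom_of S b \<Longrightarrow>
     transition S a b x ** cl S b c x u = cl S a c x u ** transition S a b x"
  and transition_spin: "a \<in> frames S \<Longrightarrow> b \<in> frames S \<Longrightarrow> x \<in> dom_of S a \<inter> dom_of S b \<Longrightarrow>
     transition S a b x \<in> spin_group (gam S)"
  using spin unfolding spin_riemannian_manifold_def by (simp; fail | blast | auto)+

lemmas bilinear_ip = bounded_bilinear_hermitian[OF herm]

lemmas ip_simps =
  bounded_bilinear.add_left[OF bilinear_ip] bounded_bilinear.add_right[OF bilinear_ip]
  bounded_bilinear.diff_left[OF bilinear_ip] bounded_bilinear.diff_right[OF bilinear_ip]
  bounded_bilinear.minus_left[OF bilinear_ip] bounded_bilinear.minus_right[OF bilinear_ip]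
  bounded_bilinear.scaleR_left[OF bilinear_ip] bounded_bilinear.scaleR_right[OF bilinear_ip]
  bounded_bilinear.sum_left[OF bilinear_ip] bounded_bilinear.sum_right[OF bilinear_ip]
  hermitian_inner_productD(3,4)[OF herm]

lemmas mv_simps =
  bounded_bilinear.add_left[OF bounded_bilinear_matrix_vector_mult]
  bounded_bilinear.add_right[OF bounded_bilinear_matrix_vector_mult]
  bounded_bilinear.diff_left[OF bounded_bilinear_matrix_vector_mult]
  bounded_bilinear.diff_right[OF bounded_bilinear_matrix_vector_mult]
  bounded_bilinear.minus_left[OF bounded_bilinear_matrix_vector_mult]
  bounded_bilinear.minus_right[OF bounded_bilinear_matrix_vector_mult]
  bounded_bilinear.scaleR_left[OF bounded_bilinear_matrix_vector_mult]
  bounded_bilinear.scaleR_right[OF bounded_bilinear_matrix_vector_mult]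
  bounded_bilinear.sum_left[OF bounded_bilinear_matrix_vector_mult]
  bounded_bilinear.sum_right[OF bounded_bilinear_matrix_vector_mult]

lemma linear_ip_mv: "linear (\<lambda>M :: complex ^ 's ^ 's. ip S \<eta> (M *v \<zeta>))"
  by (rule linearI) (simp_all add: ip_simps mv_simps)

lemma cliff_adjoint: "ip S (cliff (gam S) v *v \<eta>) \<zeta> = ip S \<eta> (cliff (gam S) v *v \<zeta>)"
  by (simp add: cliff_def mv_simps ip_simps gam_adjoint)

text \<open>Exchanging the summation indices symmetrises the double sum, so that the Clifford
  relations apply to it.\<close>

lemma cliff_square: "cliff (gam S) v ** cliff (gam S) v = (norm v)\<^sup>2 *\<^sub>R mat 1"
proof -
  let ?\<Gamma> = "gam S"
  have rel: "?\<Gamma> i ** ?\<Gamma> j + ?\<Gamma> j ** ?\<Gamma> i = (if i = j then 2 else 0 :: real) *\<^sub>R mat 1" for i j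
    using clifford_rel unfolding clifford_relations_def
    by (auto simp: vec_eq_iff mat_def scaleR_conv_of_real)
  have "cliff ?\<Gamma> v ** cliff ?\<Gamma> v = (\<Sum>i\<in>UNIV. \<Sum>j\<in>UNIV. (v $ i * v $ j) *\<^sub>R (?\<Gamma> i ** ?\<Gamma> j))"
    unfolding cliff_def
    by (subst sum.swap) (simp add: linear_sum[OF linear_mmult_left] linear_sum[OF linear_mmult_right]
        mmult_simps scaleR_sum_right mult.commute)
  moreover from this have "cliff ?\<Gamma> v ** cliff ?\<Gamma> v = (\<Sum>i\<in>UNIV. \<Sum>j\<in>UNIV. (v $ i * v $ j) *\<^sub>R (?\<Gamma> j ** ?\<Gamma> i))"
    by (subst sum.swap) (simp add: mult.commute)
  ultimately have "2 *\<^sub>R (cliff ?\<Gamma> v ** cliff ?\<Gamma> v)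
      = (\<Sum>i\<in>UNIV. \<Sum>j\<in>UNIV. (v $ i * v $ j) *\<^sub>R (?\<Gamma> i ** ?\<Gamma> j + ?\<Gamma> j ** ?\<Gamma> i))"
    by (simp add: scaleR_2 scaleR_right_distrib sum.distrib)
  also have "\<dots> = (\<Sum>i\<in>UNIV. (2 * (v $ i)\<^sup>2) *\<^sub>R mat 1)"
    unfolding rel by (intro sum.cong refl) (simp add: if_distrib if_distribR power2_eq_square mult.commute cong: if_cong)
  also have "\<dots> = 2 *\<^sub>R ((norm v)\<^sup>2 *\<^sub>R mat 1)"
    unfolding power2_norm_eq_inner inner_vec_def
    by (simp add: power2_eq_square sum_distrib_left flip: scaleR_sum_left)
  finally show ?thesis by (rule scaleR_left_imp_eq[rotated]) simp
qed

text \<open>Polarisation of the square.\<close>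

lemma cliff_anticommute:
  "cliff (gam S) u ** cliff (gam S) v + cliff (gam S) v ** cliff (gam S) u = (2 * (u \<bullet> v)) *\<^sub>R mat 1"
proof -
  have add: "cliff (gam S) (u + v) = cliff (gam S) u + cliff (gam S) v"
    by (simp add: cliff_def scaleR_left_distrib sum.distrib)
  have "(norm (u + v))\<^sup>2 *\<^sub>R (mat 1 :: complex ^ 's ^ 's) = (norm u)\<^sup>2 *\<^sub>R mat 1
      + (cliff (gam S) u ** cliff (gam S) v + cliff (gam S) v ** cliff (gam S) u) + (norm v)\<^sup>2 *\<^sub>R mat 1"
    using cliff_square[of "u + v"] by (simp add: add mmult_simps cliff_square algebra_simps)
  moreover have "(norm (u + v))\<^sup>2 = (norm u)\<^sup>2 + 2 * (u \<bullet> v) + (norm v)\<^sup>2"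
    by (simp add: power2_norm_eq_inner inner_add_left inner_add_right inner_commute)
  ultimately show ?thesis by (simp add: scaleR_left_distrib)
qed

text \<open>Unit vectors act as self-adjoint involutions, hence unitarily.\<close>

lemma spin_group_unitary:
  assumes "s \<in> spin_group (gam S)" shows "ip S (s *v \<eta>) (s *v \<zeta>) = ip S \<eta> \<zeta>"
proof -
  have "ip S (foldr (\<lambda>v s. cliff (gam S) v ** s) vs (mat 1) *v \<eta>)
      (foldr (\<lambda>v s. cliff (gam S) v ** s) vs (mat 1) *v \<zeta>) = ip S \<eta> \<zeta>"
    if "\<forall>v\<in>set vs. norm v = 1" for vs
    using that
  proof (induction vs)
    case (Cons v vs)
    have "ip S (cliff (gam S) v *v \<eta>) (cliff (gam S) v *v \<zeta>) = ip S \<eta> \<zeta>" for \<eta> \<zeta>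
      using Cons.prems by (simp add: cliff_adjoint matrix_vector_mul_assoc cliff_square)
    then show ?case using Cons by (simp add: matrix_vector_mul_assoc[symmetric])
  qed simp
  then show ?thesis using assms unfolding spin_group_def by auto
qed

end

section \<open>The spin connection at a point, in a fixed chart and frame\<close>

locale spin_point = spin_manifold S
  for S :: "('m::{t2_space, second_countable_topology}, 'n::finite, 'i, 's::finite) spin_riemannian" +
  fixes a c x
  assumes a: "a \<in> frames S" and c: "c \<in> atlas S" and x: "x \<in> fst c \<inter> dom_of S a"
begin

abbreviation "g \<equiv> gm S c x"
abbreviation "e i \<equiv> frame S a i c x"
abbreviation "C \<equiv> cl S a c x"
abbreviation "\<Gamma> \<equiv> gam S"
abbreviation "G \<equiv> christoffel S c x"

lemma x_chart: "x \<in> fst c"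
  using x by auto

lemmas is_chart = riemannian_manifoldD(1)[OF riem c]

lemma onb: "orthonormal_basis g e"
  using riemannian_manifoldD(3)[OF riem c x_chart] frame_orthonormal[OF a c x]
  by (simp add: orthonormal_basis_def)

lemmas g_rules = inner_product_formD[OF orthonormal_basisD(1)[OF onb]]

lemma clifford_C: "clifford_map g C"
  unfolding clifford_map_def
proof (intro conjI allI)
  show "linear C"
    by (rule linearI)
       (simp_all add: cl_def cliff_def linear_add[OF g_rules(4)] linear_scale[OF g_rules(4)]
          scaleR_left_distrib sum.distrib scaleR_sum_right)
  show "C u ** C v + C v ** C u = (2 * g u v) *\<^sub>R mat 1" for u v
    using inner_product_orthonormal[OF onb, of u v]
    by (simp add: cl_def cliff_anticommute inner_vec_def)
qed

lemma C_adjoint: "ip S (C v *v \<eta>) \<zeta> = ip S \<eta> (C v *v \<zeta>)"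
  by (simp add: cl_def cliff_adjoint)

definition connection_form :: "real ^ 'n \<Rightarrow> 'n \<Rightarrow> 'n \<Rightarrow> real" where
  "connection_form u i j = g (e i) (nabla_vf S (frame S a j) c x u)"

definition spin_connection :: "real ^ 'n \<Rightarrow> complex ^ 's ^ 's" where
  "spin_connection u = (1 / 4) *\<^sub>R (\<Sum>i\<in>UNIV. \<Sum>j\<in>UNIV. connection_form u i j *\<^sub>R (\<Gamma> i ** \<Gamma> j))"

lemma frame_has_derivative: "(in_chart c (frame S a i c) has_derivative deriv_in c (frame S a i c) x) (at (snd c x))"
  using frame_vector_field[OF a, of i] c x
  by (intro smooth_in_chart_has_derivative[of c "dom_of S a"]) (auto simp: vector_field_on_def)

text \<open>The products of the frame vectors are constant near \<open>x\<close>, so their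
  derivative vanishes.\<close>

lemma connection_form_antisym: "connection_form u i j = - connection_form u j i"
proof -
  have "(in_chart c (\<lambda>y. gm S c y (frame S a i c y) (frame S a j c y)) has_derivative
    (\<lambda>w. g (nabla_vf S (frame S a i) c x w) (e j) + g (e i) (nabla_vf S (frame S a j) c x w))) (at (snd c x))"
    unfolding nabla_vf_def
    by (rule gm_has_derivative[OF riem c x_chart onb frame_has_derivative frame_has_derivative])
  moreover have "(in_chart c (\<lambda>y. gm S c y (frame S a i c y) (frame S a j c y)) has_derivative (\<lambda>w. 0)) (at (snd c x))"
    by (rule in_chart_has_derivative_cong[OF is_chart open_dom[OF a] x _ in_chart_const_has_derivative])
       (simp add: frame_orthonormal[OF a c])
  ultimately have "g (nabla_vf S (frame S a i) c x u) (e j) + g (e i) (nabla_vf S (frame S a j) c x u) = 0"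
    by (rule has_derivative_unique[THEN fun_cong])
  then show ?thesis by (simp add: connection_form_def g_rules(2)[of _ "e j"])
qed

text \<open>The derivative of the covering \<open>Spin(n) \<rightarrow> SO(n)\<close>: bracketing
  with the spin connection rotates the generators by the connection form. The Clifford relations
  give a factor 2 and the antisymmetry another, which cancel the 1/4.\<close>

lemma spin_connection_commutator:
  "spin_connection u ** \<Gamma> k - \<Gamma> k ** spin_connection u = (\<Sum>i\<in>UNIV. connection_form u i k *\<^sub>R \<Gamma> i)"
proof -
  let ?w = "connection_form u"
  have sw: "\<Gamma> i ** \<Gamma> j = (if i = j then 2 else 0 :: real) *\<^sub>R mat 1 - \<Gamma> j ** \<Gamma> i" for i j
  proof -
    have "\<Gamma> i ** \<Gamma> j + \<Gamma> j ** \<Gamma> i = (if i = j then 2 else 0 :: real) *\<^sub>R mat 1"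
      using clifford_rel unfolding clifford_relations_def
      by (auto simp: vec_eq_iff mat_def scaleR_conv_of_real)
    then show ?thesis by (simp add: eq_diff_eq)
  qed
  have term_eq: "\<Gamma> i ** \<Gamma> j ** \<Gamma> k - \<Gamma> k ** (\<Gamma> i ** \<Gamma> j)
      = (if j = k then 2 else 0 :: real) *\<^sub>R \<Gamma> i - (if i = k then 2 else 0 :: real) *\<^sub>R \<Gamma> j" for i j
  proof -
    have "\<Gamma> i ** \<Gamma> j ** \<Gamma> k = \<Gamma> i ** (\<Gamma> j ** \<Gamma> k)" by (simp add: matrix_mul_assoc)
    also have "\<dots> = (if j = k then 2 else 0 :: real) *\<^sub>R \<Gamma> i - (\<Gamma> i ** \<Gamma> k) ** \<Gamma> j"
      by (subst sw) (simp add: mmult_simps matrix_mul_assoc)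
    also have "(\<Gamma> i ** \<Gamma> k) ** \<Gamma> j = (if i = k then 2 else 0 :: real) *\<^sub>R \<Gamma> j - \<Gamma> k ** (\<Gamma> i ** \<Gamma> j)"
      by (subst sw) (simp add: mmult_simps matrix_mul_assoc)
    finally show ?thesis by simp
  qed
  have "spin_connection u ** \<Gamma> k - \<Gamma> k ** spin_connection u
      = (1 / 4) *\<^sub>R (\<Sum>i\<in>UNIV. \<Sum>j\<in>UNIV. ?w i j *\<^sub>R (\<Gamma> i ** \<Gamma> j ** \<Gamma> k - \<Gamma> k ** (\<Gamma> i ** \<Gamma> j)))"
    unfolding spin_connection_def
    by (simp add: linear_sum[OF linear_mmult_left] linear_sum[OF linear_mmult_right] mmult_simps
        scaleR_right_diff_distrib sum_subtractf)
  also have "\<dots> = (1 / 4) *\<^sub>R (\<Sum>i\<in>UNIV. \<Sum>j\<in>UNIV. (if j = k then (2 * ?w i j) *\<^sub>R \<Gamma> i else 0)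
      - (if i = k then (2 * ?w i j) *\<^sub>R \<Gamma> j else 0))"
    unfolding term_eq
    by (intro arg_cong2[where f = scaleR] sum.cong refl) auto
  also have "\<dots> = (1 / 4) *\<^sub>R ((\<Sum>i\<in>UNIV. (2 * ?w i k) *\<^sub>R \<Gamma> i) - (\<Sum>j\<in>UNIV. (2 * ?w k j) *\<^sub>R \<Gamma> j))"
  proof -
    have "(\<Sum>i\<in>UNIV. \<Sum>j\<in>UNIV. if i = k then (2 * ?w i j) *\<^sub>R \<Gamma> j else 0) = (\<Sum>j\<in>UNIV. (2 * ?w k j) *\<^sub>R \<Gamma> j)"
      by (subst sum.swap) simp
    then show ?thesis by (simp add: sum_subtractf)
  qed
  also have "(\<Sum>j\<in>UNIV. (2 * ?w k j) *\<^sub>R \<Gamma> j) = - (\<Sum>i\<in>UNIV. (2 * ?w i k) *\<^sub>R \<Gamma> i)"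
    by (subst connection_form_antisym) (simp add: sum_negf)
  also have "(1 / 4) *\<^sub>R ((\<Sum>i\<in>UNIV. (2 * ?w i k) *\<^sub>R \<Gamma> i) - - (\<Sum>i\<in>UNIV. (2 * ?w i k) *\<^sub>R \<Gamma> i))
      = (\<Sum>i\<in>UNIV. ?w i k *\<^sub>R \<Gamma> i)"
    by (simp add: scaleR_sum_right sum.distrib[symmetric] scaleR_left_distrib[symmetric])
  finally show ?thesis .
qed

text \<open>Clifford multiplication is parallel. The coefficients \<open>g v (e i)\<close> change
  through the Christoffel term and through the turning of the frame; the latter is expressed by the
  commutator with the spin connection.\<close>

lemma cl_has_derivative:
  "(in_chart c (\<lambda>y. cl S a c y v) has_derivative
     (\<lambda>u. C (G u v) - (spin_connection u ** C v - C v ** spin_connection u))) (at (snd c x))"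
proof -
  \<comment> \<open>The \<open>0\<close> is the derivative of \<open>v\<close>, whose components in
    the chart are constant.\<close>
  have "((\<lambda>z. \<Sum>i\<in>UNIV. in_chart c (\<lambda>y. gm S c y v (frame S a i c y)) z *\<^sub>R \<Gamma> i) has_derivative
      (\<lambda>u. \<Sum>i\<in>UNIV. (g (0 + G u v) (e i) + g v (nabla_vf S (frame S a i) c x u)) *\<^sub>R \<Gamma> i)) (at (snd c x))"
    unfolding nabla_vf_def
    by (intro has_derivative_sum has_derivative_scaleR_left
        gm_has_derivative[OF riem c x_chart onb in_chart_const_has_derivative frame_has_derivative])
  moreover have "(\<lambda>z. \<Sum>i\<in>UNIV. in_chart c (\<lambda>y. gm S c y v (frame S a i c y)) z *\<^sub>R \<Gamma> i)
      = in_chart c (\<lambda>y. cl S a c y v)"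
    by (simp add: in_chart_def o_def cl_def cliff_def)
  moreover have "(\<Sum>i\<in>UNIV. (g (0 + G u v) (e i) + g v (nabla_vf S (frame S a i) c x u)) *\<^sub>R \<Gamma> i)
      = C (G u v) - (spin_connection u ** C v - C v ** spin_connection u)" for u
  proof -
    have "spin_connection u ** C v - C v ** spin_connection u
        = (\<Sum>k\<in>UNIV. g v (e k) *\<^sub>R (spin_connection u ** \<Gamma> k - \<Gamma> k ** spin_connection u))"
      by (simp add: cl_def cliff_def linear_sum[OF linear_mmult_left] linear_sum[OF linear_mmult_right]
          mmult_simps scaleR_right_diff_distrib sum_subtractf)
    also have "\<dots> = (\<Sum>k\<in>UNIV. \<Sum>i\<in>UNIV. (g v (e k) * connection_form u i k) *\<^sub>R \<Gamma> i)"
      by (simp only: spin_connection_commutator scaleR_sum_right scaleR_scaleR)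
    also have "\<dots> = (\<Sum>i\<in>UNIV. (\<Sum>k\<in>UNIV. g v (e k) * connection_form u i k) *\<^sub>R \<Gamma> i)"
      by (subst sum.swap) (simp add: scaleR_sum_left)
    also have "\<dots> = (\<Sum>i\<in>UNIV. (- g v (nabla_vf S (frame S a i) c x u)) *\<^sub>R \<Gamma> i)"
    proof (intro sum.cong refl arg_cong2[where f = scaleR])
      fix i
      have "g v (nabla_vf S (frame S a i) c x u) = (\<Sum>k\<in>UNIV. g v (e k) *\<^sub>R connection_form u k i)"
        unfolding connection_form_def by (rule linear_orthonormal_expand[OF onb g_rules(4)])
      also have "\<dots> = (\<Sum>k\<in>UNIV. g v (e k) *\<^sub>R (- connection_form u i k))"
        by (intro sum.cong refl arg_cong2[where f = scaleR] connection_form_antisym)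
      finally show "(\<Sum>k\<in>UNIV. g v (e k) * connection_form u i k) = - g v (nabla_vf S (frame S a i) c x u)"
        by (simp add: sum_negf)
    qed
    finally show ?thesis
      by (simp add: cl_def cliff_def scaleR_left_distrib sum.distrib sum_negf)
  qed
  ultimately show ?thesis by simp
qed

text \<open>Adjunction reverses \<open>\<Gamma>\<^sub>i \<Gamma>\<^sub>j\<close>, and exchanging the
  indices changes the sign of the connection form.\<close>

lemma spin_connection_skew: "ip S (spin_connection u *v \<eta>) \<zeta> = - ip S \<eta> (spin_connection u *v \<zeta>)"
proof -
  have "ip S (spin_connection u *v \<eta>) \<zeta>
      = (1 / 4) *\<^sub>R (\<Sum>i\<in>UNIV. \<Sum>j\<in>UNIV. connection_form u i j *\<^sub>R ip S \<eta> (\<Gamma> j *v (\<Gamma> i *v \<zeta>)))"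
    by (simp add: spin_connection_def mv_simps ip_simps matrix_vector_mul_assoc[symmetric] gam_adjoint)
  also have "\<dots> = (1 / 4) *\<^sub>R (\<Sum>i\<in>UNIV. \<Sum>j\<in>UNIV. connection_form u j i *\<^sub>R ip S \<eta> (\<Gamma> i *v (\<Gamma> j *v \<zeta>)))"
    by (subst sum.swap) simp
  also have "\<dots> = - ((1 / 4) *\<^sub>R (\<Sum>i\<in>UNIV. \<Sum>j\<in>UNIV. connection_form u i j *\<^sub>R ip S \<eta> (\<Gamma> i *v (\<Gamma> j *v \<zeta>))))"
    by (subst connection_form_antisym) (simp add: sum_negf)
  also have "\<dots> = - ip S \<eta> (spin_connection u *v \<zeta>)"
    by (simp add: spin_connection_def mv_simps ip_simps matrix_vector_mul_assoc[symmetric])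
  finally show ?thesis .
qed

end

section \<open>Bilinears in an arbitrary frame and their derivative\<close>

lemma antisymmetrize_map:
  "antisymmetrize f (map h xs) = antisymmetrize (\<lambda>ys. f (map h ys)) xs"
  by (simp add: antisymmetrize_def permute_list_map)

lemma clifford_word_mv: "clifford_word C (map f is) *v \<eta> = foldr (\<lambda>i \<eta>. C (f i) *v \<eta>) is \<eta>"
  by (induction "is") (simp_all add: matrix_vector_mul_assoc[symmetric])

context spin_manifold
begin

lemma clifford_alt_ip:
  "ip S \<eta> (clifford_alt C xs *v \<zeta>) = 1 / fact (length xs) *
     (\<Sum>\<sigma> | \<sigma> permutes {..<length xs}. of_int (sign \<sigma>) *
        ip S \<eta> (foldr (\<lambda>i \<eta>. C (xs ! \<sigma> i) *v \<eta>) [0..<length xs] \<zeta>))"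
proof -
  have "ip S \<eta> (clifford_alt C xs *v \<zeta>) = (1 / fact (length xs)) *\<^sub>R
     (\<Sum>\<sigma> | \<sigma> permutes {..<length xs}. of_int (sign \<sigma>) *\<^sub>R
        ip S \<eta> (clifford_word C (permute_list \<sigma> xs) *v \<zeta>))"
    by (simp only: antisymmetrize_def mv_simps ip_simps)
  then show ?thesis
    by (simp add: permute_list_def clifford_word_mv scaleR_conv_of_real)
qed

text \<open>The transition function intertwines the two Clifford multiplications, hence also the
  antisymmetrised products, and it is unitary.\<close>

lemma spinor_form_frame_independent:
  assumes "spinor_field S \<epsilon>" and ab: "a \<in> frames S" "b \<in> frames S" and c: "c \<in> atlas S"
    and x: "x \<in> fst c \<inter> dom_of S a \<inter> dom_of S b"
  shows "ip S (\<epsilon> b x) (clifford_alt (cl S b c x) xs *v \<epsilon> b x)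
    = ip S (\<epsilon> a x) (clifford_alt (cl S a c x) xs *v \<epsilon> a x)"
proof -
  define s where "s = transition S a b x"
  have eps: "\<epsilon> a x = s *v \<epsilon> b x"
    using assms unfolding spinor_field_def s_def by blast
  have "s ** clifford_word (cl S b c x) ys = clifford_word (cl S a c x) ys ** s" for ys
  proof (induction ys)
    case (Cons v ys)
    have "s ** clifford_word (cl S b c x) (v # ys) = (s ** cl S b c x v) ** clifford_word (cl S b c x) ys"
      by (simp add: matrix_mul_assoc)
    also have "s ** cl S b c x v = cl S a c x v ** s"
      unfolding s_def by (rule transition_cl[OF ab c x])
    finally show ?case using Cons.IH by (simp add: matrix_mul_assoc[symmetric])
  qed simp
  then have "s ** clifford_alt (cl S b c x) xs = clifford_alt (cl S a c x) xs ** s"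
    by (simp only: antisymmetrize_linear[OF linear_mmult_left, symmetric]
        antisymmetrize_linear[OF linear_mmult_right, symmetric])
  then have "clifford_alt (cl S a c x) xs *v (s *v \<epsilon> b x) = s *v (clifford_alt (cl S b c x) xs *v \<epsilon> b x)"
    by (simp add: matrix_vector_mul_assoc)
  moreover have "s \<in> spin_group (gam S)"
    unfolding s_def using x by (intro transition_spin[OF ab]) simp
  ultimately show ?thesis by (simp add: eps spin_group_unitary)
qed

text \<open>The frame chosen by \<open>SOME\<close> may jump from point to point. Frame independence
  replaces it by one frame on an open set, so that the bilinears can be differentiated.\<close>

lemma spinor_multi_form_frame:
  assumes \<epsilon>: "spinor_field S \<epsilon>" and a: "a \<in> frames S" and c: "c \<in> atlas S"
    and x: "x \<in> fst c \<inter> dom_of S a"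
  shows "spinor_multi_form S \<epsilon> c x xs
    = \<i> ^ (length xs div 2) * ip S (\<epsilon> a x) (clifford_alt (cl S a c x) xs *v \<epsilon> a x)"
proof -
  define b where "b = (SOME a. a \<in> frames S \<and> x \<in> dom_of S a)"
  have b: "b \<in> frames S \<and> x \<in> dom_of S b"
    unfolding b_def by (rule someI_ex[OF frame_cover])
  have "spinor_multi_form S \<epsilon> c x xs
      = \<i> ^ (length xs div 2) * ip S (\<epsilon> b x) (clifford_alt (cl S b c x) xs *v \<epsilon> b x)"
    unfolding spinor_multi_form_def spinor_form_def clifford_alt_ip b_def[symmetric]
    by (simp add: Let_def b_def)
  also have "ip S (\<epsilon> b x) (clifford_alt (cl S b c x) xs *v \<epsilon> b x)
      = ip S (\<epsilon> a x) (clifford_alt (cl S a c x) xs *v \<epsilon> a x)"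
    using b x by (intro spinor_form_frame_independent[OF \<epsilon> a _ c]) auto
  finally show ?thesis .
qed

lemma spinor_form_eq:
  "spinor_form S \<epsilon> p c x xs = (if length xs = p then spinor_multi_form S \<epsilon> c x xs else 0)"
  by (simp add: spinor_multi_form_def spinor_form_def)

end

context spin_point
begin

lemma alternating_spinor_multi_form:
  assumes "spinor_field S \<epsilon>" shows "alternating_multilinear (spinor_multi_form S \<epsilon> c x)"
proof -
  have "alternating_multilinear (\<lambda>xs. \<i> ^ (length xs div 2) * ip S (\<epsilon> a x) (clifford_alt C xs *v \<epsilon> a x))"
    by (intro alternating_length_compose[where L = "\<lambda>p. (*) (\<i> ^ (p div 2))"]
        alternating_compose[OF linear_ip_mv] alternating_clifford_alt[OF clifford_C])
       simp
  then show ?thesis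
    by (simp only: spinor_multi_form_frame[OF assms a c x, symmetric])
qed

lemma linear_covector: "multi_form S F \<Longrightarrow> linear (\<lambda>u. F c x [u])"
  using c x_chart alternating_Cons_linear[of "F c x" "[]"] by (auto simp: multi_form_def)

text \<open>In an orthonormal frame the dual vector has the values of the covector as coefficients;
  uniqueness holds because the metric is definite.\<close>

lemma sharp_expand:
  fixes F :: "('m, 'n, real) mform"
  assumes "multi_form S F"
  shows "sharp S F c x = (\<Sum>k\<in>UNIV. F c x [e k] *\<^sub>R e k)" "g (sharp S F c x) u = F c x [u]"
proof -
  define v where "v = (\<Sum>k\<in>UNIV. F c x [e k] *\<^sub>R e k)"
  have v: "g v u = F c x [u]" for u
    using linear_orthonormal_expand[OF onb linear_covector[OF assms], of u]
    by (simp add: v_def linear_sum[OF g_rules(3)] linear_scale[OF g_rules(3)] g_rules(2)[of _ u] mult.commute)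
  have "sharp S F c x = v"
    unfolding sharp_def
    using v inner_product_form_eq_iff[OF orthonormal_basisD(1)[OF onb]] by (intro the_equality) auto
  then show "sharp S F c x = (\<Sum>k\<in>UNIV. F c x [e k] *\<^sub>R e k)" "g (sharp S F c x) u = F c x [u]"
    using v by (simp_all add: v_def)
qed

lemma cl_form_eq: "multi_form S F \<Longrightarrow> cl_form S a c x F = C (sharp S F c x)"
  by (simp add: cl_form_def cl_def sharp_expand(2))

lemma spinor_multi_form_has_derivative:
  assumes \<epsilon>: "spinor_field S \<epsilon>"
  defines "\<epsilon>' \<equiv> deriv_in c (\<epsilon> a) x"
  shows "(in_chart c (\<lambda>y. spinor_multi_form S \<epsilon> c y xs) has_derivative
    (\<lambda>u. \<i> ^ (length xs div 2) * (ip S (\<epsilon> a x) (clifford_alt C xs *v \<epsilon>' u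
        + ((\<Sum>i<length xs. clifford_alt C (xs[i := G u (xs ! i)]))
            - (spin_connection u ** clifford_alt C xs - clifford_alt C xs ** spin_connection u)) *v \<epsilon> a x)
      + ip S (\<epsilon>' u) (clifford_alt C xs *v \<epsilon> a x)))) (at (snd c x))"
proof -
  have d\<epsilon>: "(in_chart c (\<epsilon> a) has_derivative \<epsilon>') (at (snd c x))"
    unfolding \<epsilon>'_def using \<epsilon> a c x
    by (intro smooth_in_chart_has_derivative[of c "dom_of S a"]) (auto simp: spinor_field_def)
  \<comment> \<open>The family of Clifford maps is indexed by points \<open>z\<close> of coordinate
    space; at \<open>snd c x\<close> it is \<open>C\<close>.\<close>
  have "((\<lambda>z. clifford_alt (\<lambda>v. in_chart c (\<lambda>y. cl S a c y v) z) xs) has_derivative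
      (\<lambda>u. (\<Sum>i<length xs. clifford_alt (\<lambda>v. in_chart c (\<lambda>y. cl S a c y v) (snd c x)) (xs[i := G u (xs ! i)]))
       - (spin_connection u ** clifford_alt (\<lambda>v. in_chart c (\<lambda>y. cl S a c y v) (snd c x)) xs
          - clifford_alt (\<lambda>v. in_chart c (\<lambda>y. cl S a c y v) (snd c x)) xs ** spin_connection u))) (at (snd c x))"
    by (rule clifford_alt_has_derivative) (simp add: in_chart_apply[OF is_chart x_chart] cl_has_derivative)
  then have dC: "((\<lambda>z. clifford_alt (\<lambda>v. in_chart c (\<lambda>y. cl S a c y v) z) xs) has_derivative
      (\<lambda>u. (\<Sum>i<length xs. clifford_alt C (xs[i := G u (xs ! i)]))
       - (spin_connection u ** clifford_alt C xs - clifford_alt C xs ** spin_connection u))) (at (snd c x))"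
    by (simp add: in_chart_apply[OF is_chart x_chart])
  have "((\<lambda>z. \<i> ^ (length xs div 2) * ip S (in_chart c (\<epsilon> a) z)
        (clifford_alt (\<lambda>v. in_chart c (\<lambda>y. cl S a c y v) z) xs *v in_chart c (\<epsilon> a) z)) has_derivative
    (\<lambda>u. \<i> ^ (length xs div 2) * (ip S (\<epsilon> a x) (clifford_alt C xs *v \<epsilon>' u
        + ((\<Sum>i<length xs. clifford_alt C (xs[i := G u (xs ! i)]))
            - (spin_connection u ** clifford_alt C xs - clifford_alt C xs ** spin_connection u)) *v \<epsilon> a x)
      + ip S (\<epsilon>' u) (clifford_alt C xs *v \<epsilon> a x)))) (at (snd c x))"
    using has_derivative_mult_right[OF bounded_bilinear.FDERIV[OF bilinear_ip d\<epsilon>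
        bounded_bilinear.FDERIV[OF bounded_bilinear_matrix_vector_mult dC d\<epsilon>]], of "\<i> ^ (length xs div 2)"]
    by (simp add: in_chart_apply[OF is_chart x_chart])
  then have "(in_chart c (\<lambda>y. \<i> ^ (length xs div 2) * ip S (\<epsilon> a y) (clifford_alt (cl S a c y) xs *v \<epsilon> a y)) has_derivative
    (\<lambda>u. \<i> ^ (length xs div 2) * (ip S (\<epsilon> a x) (clifford_alt C xs *v \<epsilon>' u
        + ((\<Sum>i<length xs. clifford_alt C (xs[i := G u (xs ! i)]))
            - (spin_connection u ** clifford_alt C xs - clifford_alt C xs ** spin_connection u)) *v \<epsilon> a x)
      + ip S (\<epsilon>' u) (clifford_alt C xs *v \<epsilon> a x)))) (at (snd c x))"
    by (simp add: in_chart_def o_def)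
  \<comment> \<open>On the domain of the frame \<open>a\<close> the differentiated expression is the
    bilinear itself.\<close>
  then show ?thesis
    by (rule in_chart_has_derivative_cong[OF is_chart open_dom[OF a] x, rotated 1])
       (simp add: spinor_multi_form_frame[OF \<epsilon> a c])
qed

text \<open>The spin connection in the derivative of the spinor cancels the commutator in the
  derivative of \<open>cl\<close>, and the Christoffel terms are those subtracted in
  \<open>nabla_at\<close>. What survives carries \<open>k\<^sub>1\<close> or
  \<open>k\<^sub>2\<close>.\<close>

lemma nabla_spinor_multi_form:
  assumes \<epsilon>: "spinor_field S \<epsilon>" and A: "multi_form S A" and par: "hat_parallel S k\<^sub>1 k\<^sub>2 A \<epsilon>"
  defines "\<psi> \<equiv> spinor_multi_form S \<epsilon> c x"
  shows "nabla_at S (spinor_multi_form S \<epsilon>) c x u xs + (2 * Re (2 * k\<^sub>1 + k\<^sub>2) * A c x [u]) *\<^sub>R \<psi> xs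
    = hierarchy_P k\<^sub>1 (\<lambda>v. A c x [v]) (sharp S A c x) \<psi> (u # xs)
      + covector_wedge (g u) (hierarchy_Q k\<^sub>1 (\<lambda>v. A c x [v]) (sharp S A c x) \<psi>) xs"
proof -
  define b where "b = sharp S A c x"
  define M where "M = clifford_alt C xs"
  define \<epsilon>' where "\<epsilon>' = deriv_in c (\<epsilon> a) x u"
  define \<eta> where "\<eta> = \<epsilon> a x"
  define \<phi> where "\<phi> N = ip S \<eta> (N *v \<eta>)" for N
  let ?\<Omega> = "spin_connection u"
  let ?z = "\<i> ^ (length xs div 2)"
  have b: "g b v = A c x [v]" for v unfolding b_def by (rule sharp_expand(2)[OF A])
  then have gb: "g b = (\<lambda>v. A c x [v])" by auto
  have \<psi>: "\<psi> ys = \<i> ^ (length ys div 2) * \<phi> (clifford_alt C ys)" for ys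
    unfolding \<psi>_def \<phi>_def \<eta>_def by (rule spinor_multi_form_frame[OF \<epsilon> a c x])
  have lin: "linear \<phi>" unfolding \<phi>_def by (rule linear_ip_mv)
  have "hat_nabla S k\<^sub>1 k\<^sub>2 A \<epsilon> a c x u = 0"
    using par a c x unfolding hat_parallel_def by blast
  then have "\<epsilon>' + ?\<Omega> *v \<eta> + k\<^sub>1 *s (C b *v (C u *v \<eta>)) + (k\<^sub>2 * of_real (g b u)) *s \<eta> = 0"
    by (simp add: hat_nabla_def spin_nabla_def \<epsilon>'_def \<eta>_def spin_connection_def connection_form_def
        mv_simps matrix_vector_mul_assoc cl_form_eq[OF A] b_def sharp_expand(2)[OF A])
  then have e': "\<epsilon>' = - (?\<Omega> *v \<eta>) - k\<^sub>1 *s (C b *v (C u *v \<eta>)) - (k\<^sub>2 * of_real (g b u)) *s \<eta>"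
    by (simp add: eq_neg_iff_add_eq_0 algebra_simps)
  have i1: "ip S \<eta> (M *v \<epsilon>') = - \<phi> (M ** ?\<Omega>) - k\<^sub>1 * \<phi> (M ** C b ** C u) - k\<^sub>2 * of_real (g b u) * \<phi> M"
    unfolding e' \<phi>_def
    by (simp add: mv_simps ip_simps vector_scalar_commute matrix_vector_mul_assoc matrix_mul_assoc)
  \<comment> \<open>In the first slot scalars are conjugated, adjunction reverses the Clifford
    factors, and skewness gives the spin connection the opposite sign.\<close>
  have i2: "ip S \<epsilon>' (M *v \<eta>) = \<phi> (?\<Omega> ** M) - cnj k\<^sub>1 * \<phi> (C u ** (C b ** M)) - cnj k\<^sub>2 * of_real (g b u) * \<phi> M"
    unfolding e' \<phi>_def
    by (simp add: ip_simps spin_connection_skew C_adjoint) (simp add: matrix_vector_mul_assoc matrix_mul_assoc)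
  have "deriv_in c (\<lambda>y. spinor_multi_form S \<epsilon> c y xs) x u
      = ?z * (ip S \<eta> (M *v \<epsilon>' + ((\<Sum>i<length xs. clifford_alt C (xs[i := G u (xs ! i)]))
            - (?\<Omega> ** M - M ** ?\<Omega>)) *v \<eta>) + ip S \<epsilon>' (M *v \<eta>))"
    unfolding M_def \<epsilon>'_def \<eta>_def by (rule fun_cong[OF deriv_in_eqI[OF spinor_multi_form_has_derivative[OF \<epsilon>]]])
  also have "\<dots> = ?z * (ip S \<eta> (M *v \<epsilon>') + (\<Sum>i<length xs. \<phi> (clifford_alt C (xs[i := G u (xs ! i)])))
            - (\<phi> (?\<Omega> ** M) - \<phi> (M ** ?\<Omega>)) + ip S \<epsilon>' (M *v \<eta>))"
    unfolding \<phi>_def by (simp add: mv_simps ip_simps)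
  also have "\<dots> = (\<Sum>i<length xs. \<psi> (xs[i := G u (xs ! i)]))
      - ?z * (k\<^sub>1 * \<phi> (M ** C b ** C u) + cnj k\<^sub>1 * \<phi> (C u ** (C b ** M)) + (k\<^sub>2 + cnj k\<^sub>2) * of_real (g b u) * \<phi> M)"
    unfolding i1 i2 by (simp add: \<psi> algebra_simps sum_distrib_left)
  finally have "nabla_at S (spinor_multi_form S \<epsilon>) c x u xs
      = - (?z * (k\<^sub>1 * \<phi> (M ** C b ** C u) + cnj k\<^sub>1 * \<phi> (C u ** (C b ** M))
           + of_real (2 * Re k\<^sub>2 * g b u) * \<phi> M))"
    by (simp add: nabla_at_def \<psi>_def complex_add_cnj)
  then show ?thesis
    using bilinear_hierarchy[OF onb clifford_C lin \<psi>, of xs k\<^sub>1 b u k\<^sub>2]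
    unfolding M_def gb b_def[symmetric] by simp
qed

end

section \<open>Exterior derivative and codifferential of the bilinears\<close>

text \<open>If the columns of \<open>E\<close> are the frame vectors and \<open>H\<close> is the
  Gram matrix, orthonormality reads \<open>E\<^sup>T H E = 1\<close>, whence
  \<open>E E\<^sup>T\<close> inverts \<open>H\<close>.\<close>

lemma inverse_metric_orthonormal:
  assumes e: "orthonormal_basis (gm M c x) e"
  shows "inverse_metric M c x $ i $ j = (\<Sum>k\<in>UNIV. e k $ i * e k $ j)"
proof -
  note g = inner_product_formD[OF orthonormal_basisD(1)[OF e]]
  define E where "E = (\<chi> i k. e k $ i)"
  define H where "H = (\<chi> i j. gm M c x (axis i 1) (axis j 1))"
  have "transpose E ** H ** E = mat 1"
  proof -
    have "(transpose E ** H ** E) $ k $ l = gm M c x (e k) (e l)" for k l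
      unfolding bilinear_axis[OF g(1), of "e k" "e l"]
      by (subst sum.swap)
         (simp add: matrix_matrix_mult_def E_def H_def transpose_def sum_distrib_left mult.assoc
            mult.left_commute mult.commute)
    then show ?thesis
      by (simp add: vec_eq_iff mat_def orthonormal_basisD(2)[OF e])
  qed
  then have "E ** (transpose E ** H) = mat 1"
    by (simp add: matrix_left_right_inverse)
  then have 1: "(E ** transpose E) ** H = mat 1" by (simp add: matrix_mul_assoc)
  then have 2: "H ** (E ** transpose E) = mat 1" by (simp add: matrix_left_right_inverse)
  have "matrix_inv H = E ** transpose E"
    unfolding matrix_inv_def
  \<comment> \<open>\<open>matrix_inv\<close> is a choice of two-sided inverse; uniqueness
    identifies it.\<close>
  proof (rule some_equality)
    fix B assume "H ** B = mat 1 \<and> B ** H = mat 1"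
    then have "(E ** transpose E) ** (H ** B) = E ** transpose E" by simp
    then show "B = E ** transpose E" by (simp add: matrix_mul_assoc 1)
  qed (simp add: 1 2)
  then show ?thesis
    by (simp add: inverse_metric_def H_def[symmetric] matrix_matrix_mult_def E_def transpose_def)
qed

text \<open>Brings the codifferential, defined in coordinates, to the orthonormal frame.\<close>

lemma inverse_metric_trace:
  assumes e: "orthonormal_basis (gm M c x) e" and h: "bilinear h"
  shows "(\<Sum>i\<in>UNIV. \<Sum>j\<in>UNIV. inverse_metric M c x $ i $ j *\<^sub>R h (axis i 1) (axis j 1)) = (\<Sum>k\<in>UNIV. h (e k) (e k))"
proof -
  have "(\<Sum>k\<in>UNIV. h (e k) (e k))
      = (\<Sum>k\<in>UNIV. \<Sum>i\<in>UNIV. \<Sum>j\<in>UNIV. (e k $ i * e k $ j) *\<^sub>R h (axis i 1) (axis j 1))"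
    by (subst bilinear_axis[OF h]) simp
  also have "\<dots> = (\<Sum>i\<in>UNIV. \<Sum>k\<in>UNIV. \<Sum>j\<in>UNIV. (e k $ i * e k $ j) *\<^sub>R h (axis i 1) (axis j 1))"
    by (rule sum.swap)
  also have "\<dots> = (\<Sum>i\<in>UNIV. \<Sum>j\<in>UNIV. \<Sum>k\<in>UNIV. (e k $ i * e k $ j) *\<^sub>R h (axis i 1) (axis j 1))"
    by (intro sum.cong refl sum.swap)
  finally show ?thesis by (simp add: inverse_metric_orthonormal[OF e] scaleR_sum_left)
qed

lemma ext_d_nabla:
  assumes "alternating_multilinear (\<omega> c x)" "\<And>u v. christoffel M c x u v = christoffel M c x v u"
  shows "ext_d \<omega> c x xs = alt_sum (nabla_at M \<omega> c x) xs"
proof -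
  have "ext_d \<omega> c x xs = alt_sum (\<lambda>u ys. nabla_at M \<omega> c x u ys
      + (\<Sum>i<length ys. \<omega> c x (ys[i := christoffel M c x u (ys ! i)]))) xs"
    by (simp add: ext_d_eq nabla_at_def)
  then show ?thesis
    by (simp add: alt_sum_add alt_sum_derivation_symmetric[where G = "christoffel M c x", OF assms])
qed

context spin_point
begin

context
  fixes \<epsilon> :: "('m, 'i, 's) spinor" and A :: "('m, 'n, real) mform" and k\<^sub>1 k\<^sub>2 :: complex
  assumes \<epsilon>: "spinor_field S \<epsilon>" and A: "multi_form S A" and par: "hat_parallel S k\<^sub>1 k\<^sub>2 A \<epsilon>"
begin

abbreviation "\<mu> \<equiv> 2 * Re (2 * k\<^sub>1 + k\<^sub>2)"
abbreviation "f \<equiv> \<lambda>v. A c x [v]"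
abbreviation "b \<equiv> sharp S A c x"
abbreviation "\<psi> \<equiv> spinor_multi_form S \<epsilon> c x"
abbreviation "P \<equiv> hierarchy_P k\<^sub>1 f b \<psi>"
abbreviation "Q \<equiv> hierarchy_Q k\<^sub>1 f b \<psi>"

lemma nabla_at_eq:
  "nabla_at S (spinor_multi_form S \<epsilon>) c x u xs
    = P (u # xs) + covector_wedge (g u) Q xs - (\<mu> * f u) *\<^sub>R \<psi> xs"
  using nabla_spinor_multi_form[OF \<epsilon> A par, of u xs] by (simp add: eq_diff_eq)

lemmas alternating_\<psi> = alternating_spinor_multi_form[OF \<epsilon>]
lemmas alternating_PQ = alternating_hierarchy[OF linear_covector[OF A] alternating_\<psi>]

lemma ext_d_spinor_multi_form:
  "ext_d (spinor_multi_form S \<epsilon>) c x xs = real (length xs) *\<^sub>R P xs - \<mu> *\<^sub>R covector_wedge f \<psi> xs"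
proof -
  have "ext_d (spinor_multi_form S \<epsilon>) c x xs
      = alt_sum (\<lambda>u ys. P (u # ys) + covector_wedge (g u) Q ys - (\<mu> * f u) *\<^sub>R \<psi> ys) xs"
    using ext_d_nabla[where M = S and \<omega> = "spinor_multi_form S \<epsilon>", OF alternating_\<psi>
        christoffel(2)[OF riem c x_chart onb], of xs]
      nabla_at_eq[abs_def] by (simp only:)
  \<comment> \<open>The \<open>0\<close> is the wedge term with \<open>Q\<close>, which the symmetry
    of the metric removes.\<close>
  also have "\<dots> = real (length xs) *\<^sub>R P xs + 0 - \<mu> *\<^sub>R covector_wedge f \<psi> xs"
    using covector_wedge_scale_covector[of \<mu> f \<psi> xs]
    by (simp only: alt_sum_diff alt_sum_add alt_sum_contract[OF alternating_PQ(1)]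
        alt_sum_covector_wedge_symmetric[of g, OF g_rules(2)] covector_wedge_def[symmetric])
  finally show ?thesis by simp
qed

text \<open>The trace annihilates \<open>P (u # u # xs)\<close>, multiplies \<open>Q\<close> by the
  dimension minus the degree, and turns the values of \<open>A\<close> on the frame into contraction
  with \<open>b\<close>.\<close>

lemma codiff_spinor_multi_form:
  "codiff S (spinor_multi_form S \<epsilon>) c x xs
    = \<mu> *\<^sub>R \<psi> (b # xs) - (real CARD('n) - real (length xs)) *\<^sub>R Q xs"
proof -
  \<comment> \<open>The covariant derivative as a function of the direction \<open>u\<close> and the
    first argument \<open>v\<close>; bilinearity permits taking its trace in the frame.\<close>
  define h where "h u v = P (u # v # xs) + covector_wedge (g u) Q (v # xs) - (\<mu> * f u) *\<^sub>R \<psi> (v # xs)" for u v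
  have "bilinear h"
    unfolding bilinear_def h_def
  proof (intro conjI allI linear_compose_sub linear_compose_add)
    show "linear (\<lambda>v. P (u # v # xs))" for u
      by (intro alternating_Cons_linear alternating_contract alternating_PQ)
    show "linear (\<lambda>u. P (u # v # xs))" for v
      by (intro alternating_Cons_linear alternating_PQ)
    show "linear (\<lambda>v. covector_wedge (g u) Q (v # xs))" for u
      by (intro alternating_Cons_linear alternating_covector_wedge g_rules(3) alternating_PQ)
    show "linear (\<lambda>u. covector_wedge (g u) Q (v # xs))" for v
      by (rule linear_covector_wedge_covector[OF g_rules(4)])
    show "linear (\<lambda>v. (\<mu> * f u) *\<^sub>R \<psi> (v # xs))" for u
      by (intro linear_compose_scale_right alternating_Cons_linear alternating_\<psi>)
    show "linear (\<lambda>u. (\<mu> * f u) *\<^sub>R \<psi> (v # xs))" for v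
      by (rule linearI) (simp_all add: linear_covector[OF A, THEN linear_add]
          linear_covector[OF A, THEN linear_scale] distrib_left scaleR_left_distrib)
  qed
  then have "codiff S (spinor_multi_form S \<epsilon>) c x xs = - (\<Sum>k\<in>UNIV. h (e k) (e k))"
    by (simp only: codiff_def nabla_at_eq h_def[symmetric] inverse_metric_trace[OF onb])
  also have "\<dots> = \<mu> *\<^sub>R (\<Sum>k\<in>UNIV. f (e k) *\<^sub>R \<psi> (e k # xs))
      - (\<Sum>k\<in>UNIV. covector_wedge (g (e k)) Q (e k # xs))"
    by (simp only: h_def alternating_Cons_Cons_same[OF alternating_PQ(1)] sum_subtractf sum.distrib)
       (simp add: scaleR_sum_right)
  also have "(\<Sum>k\<in>UNIV. covector_wedge (g (e k)) Q (e k # xs)) = (real CARD('n) - real (length xs)) *\<^sub>R Q xs"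
    by (rule sum_contract_covector_wedge[OF onb alternating_PQ(2)])
  also have "(\<Sum>k\<in>UNIV. f (e k) *\<^sub>R \<psi> (e k # xs)) = \<psi> (b # xs)"
    using linear_orthonormal_expand[OF onb alternating_Cons_linear[OF alternating_\<psi>], of b xs]
    by (simp add: sharp_expand(2)[OF A])
  finally show ?thesis .
qed

section \<open>Homogeneous components of the bilinears\<close>

lemma nabla_at_spinor_form:
  "nabla_at S (spinor_form S \<epsilon> p) c x u xs
    = (if length xs = p then nabla_at S (spinor_multi_form S \<epsilon>) c x u xs else 0)"
proof -
  have "deriv_in c (\<lambda>y. 0 :: complex) x = (\<lambda>u. 0)"
    by (rule deriv_in_eqI[OF in_chart_const_has_derivative])
  then show ?thesis by (simp add: nabla_at_def spinor_form_eq)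
qed

lemma ext_d_spinor_form:
  "ext_d (spinor_form S \<epsilon> p) c x xs
    = (if length xs = Suc p then ext_d (spinor_multi_form S \<epsilon>) c x xs else 0)"
proof -
  have "deriv_in c (\<lambda>y. 0 :: complex) x = (\<lambda>u. 0)"
    by (rule deriv_in_eqI[OF in_chart_const_has_derivative])
  then have "alt_sum (\<lambda>u ys. deriv_in c (\<lambda>y. spinor_form S \<epsilon> p c y ys) x u) xs
      = alt_sum (\<lambda>u ys. if length xs = Suc p then deriv_in c (\<lambda>y. spinor_multi_form S \<epsilon> c y ys) x u else 0) xs"
    by (intro alt_sum_cong) (simp add: spinor_form_eq)
  then show ?thesis by (simp add: ext_d_eq)
qed

lemma codiff_spinor_form:
  "codiff S (spinor_form S \<epsilon> p) c x xs
    = (if Suc (length xs) = p then codiff S (spinor_multi_form S \<epsilon>) c x xs else 0)"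
  by (simp add: codiff_def nabla_at_spinor_form)

lemma wedge1_spinor_form:
  "wedge1 A (spinor_form S \<epsilon> p) c x xs = (if length xs = Suc p then covector_wedge f \<psi> xs else 0)"
proof -
  have "covector_wedge f (spinor_form S \<epsilon> p c x) xs
      = covector_wedge f (\<lambda>ys. if length xs = Suc p then \<psi> ys else 0) xs"
    by (rule covector_wedge_cong) (simp add: spinor_form_eq)
  then show ?thesis by (simp add: wedge1_eq)
qed

lemma hierarchy_equation:
  fixes Y :: "('m, 'n) vfield"
  shows "nabla S Y (spinor_form S \<epsilon> p) c x xs + (\<mu> * A c x [Y c x]) *\<^sub>R spinor_form S \<epsilon> p c x xs
    = (1 / (real p + 1)) *\<^sub>R contract Y (\<lambda>c x xs. ext_d (spinor_form S \<epsilon> p) c x xs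
          + \<mu> *\<^sub>R wedge1 A (spinor_form S \<epsilon> p) c x xs) c x xs
      - (1 / (real CARD('n) - real p + 1)) *\<^sub>R wedge1 (flat S Y) (\<lambda>c x xs. codiff S (spinor_form S \<epsilon> p) c x xs
          - \<mu> *\<^sub>R contract (sharp S A) (spinor_form S \<epsilon> p) c x xs) c x xs"
proof -
  let ?y = "Y c x" and ?m = "real CARD('n) - real p + 1"
  let ?D = "\<lambda>c x xs. codiff S (spinor_form S \<epsilon> p) c x xs - \<mu> *\<^sub>R contract (sharp S A) (spinor_form S \<epsilon> p) c x xs"
  \<comment> \<open>The codifferential lowers the degree: \<open>Suc (length ys) = p\<close> turns
    \<open>n - length ys\<close> into \<open>n - p + 1\<close>, and the terms with
    \<open>\<mu>\<close> cancel.\<close>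
  have D: "?D c x ys = (if Suc (length ys) = p then (- ?m) *\<^sub>R Q ys else 0)" for ys
    by (auto simp: codiff_spinor_form contract_def spinor_form_eq codiff_spinor_multi_form
        scaleR_left_diff_distrib scaleR_left_distrib)
  have "wedge1 (flat S Y) ?D c x xs = covector_wedge (g ?y) (?D c x) xs"
    unfolding wedge1_eq flat_def by simp
  also have "\<dots> = covector_wedge (g ?y) (\<lambda>ys. (if length xs = p then - ?m else 0) *\<^sub>R Q ys) xs"
    by (rule covector_wedge_cong) (simp only: D, simp)
  also have "\<dots> = (if length xs = p then - ?m else 0) *\<^sub>R covector_wedge (g ?y) Q xs"
    by (rule covector_wedge_scaleR)
  finally have W: "wedge1 (flat S Y) ?D c x xs = (if length xs = p then - ?m else 0) *\<^sub>R covector_wedge (g ?y) Q xs" .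
  \<comment> \<open>The wedge with \<open>A\<close> on \<open>Y c x # xs\<close> stays folded, so
    that it cancels against the one in \<open>d\<chi>\<^sub>p\<close>.\<close>
  have E: "contract Y (\<lambda>c x xs. ext_d (spinor_form S \<epsilon> p) c x xs
      + \<mu> *\<^sub>R wedge1 A (spinor_form S \<epsilon> p) c x xs) c x xs = (if length xs = p then (real p + 1) *\<^sub>R P (?y # xs) else 0)"
    by (simp add: contract_def ext_d_spinor_form wedge1_spinor_form ext_d_spinor_multi_form
        del: covector_wedge_Cons)
  \<comment> \<open>For \<open>m = 0\<close> the left side is zero, so \<open>X\<close> has to
    vanish there.\<close>
  have cancel: "(1 / m) *\<^sub>R (- m) *\<^sub>R X = - X" if "m = 0 \<Longrightarrow> X = 0" for m and X :: complex
    using that by (cases "m = 0") simp_all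
  show ?thesis
  proof (cases "length xs = p")
    case True
    \<comment> \<open>Only \<open>p = n + 1\<close> gives \<open>?m = 0\<close>; for larger
      \<open>p\<close> the number \<open>?m\<close> is negative and cancels as usual.\<close>
    have "covector_wedge (g ?y) Q xs = 0" if "?m = 0"
    proof (rule alternating_eq_0_of_length[OF onb])
      show "alternating_multilinear (covector_wedge (g ?y) Q)"
        by (intro alternating_covector_wedge g_rules(3) alternating_PQ)
      show "length xs > CARD('n)" using that True by linarith
    qed
    then have m: "(1 / ?m) *\<^sub>R (- ?m) *\<^sub>R covector_wedge (g ?y) Q xs = - covector_wedge (g ?y) Q xs"
      by (rule cancel)
    have q: "(1 / (real p + 1)) *\<^sub>R (real p + 1) *\<^sub>R P (?y # xs) = P (?y # xs)"
      by (simp add: add_nonneg_eq_0_iff)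
    have "nabla S Y (spinor_form S \<epsilon> p) c x xs + (\<mu> * A c x [?y]) *\<^sub>R spinor_form S \<epsilon> p c x xs
        = P (?y # xs) + covector_wedge (g ?y) Q xs"
      unfolding nabla_def nabla_at_spinor_form spinor_form_eq if_P[OF True] nabla_at_eq
      by (rule diff_add_cancel)
    then show ?thesis
      unfolding W E if_P[OF True] m q by (simp only: diff_minus_eq_add)
  next
    case False
    then show ?thesis
      unfolding W E by (simp add: nabla_def nabla_at_spinor_form spinor_form_eq)
  qed
qed

end

end

section \<open>Smooth multi-forms\<close>

lemma multi_formD:
  assumes "multi_form M \<omega>" "c \<in> atlas M"
  shows "x \<in> fst c \<Longrightarrow> alternating_multilinear (\<omega> c x)" "smooth_in_chart c UNIV (\<lambda>x. \<omega> c x xs)"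
    and "c' \<in> atlas M \<Longrightarrow> x \<in> fst c \<inter> fst c' \<Longrightarrow> \<omega> c' x (map (deriv_in c (snd c') x) xs) = \<omega> c x xs"
  using assms by (auto simp: multi_form_def)

lemma multi_form_linear_combination:
  assumes M: "riemannian_manifold M" and \<omega>: "multi_form M \<omega>" and \<eta>: "multi_form M \<eta>"
  shows "multi_form M (\<lambda>c x xs. r *\<^sub>R \<omega> c x xs + s *\<^sub>R \<eta> c x xs)"
  unfolding multi_form_def
proof (intro conjI ballI allI)
  fix c x assume "c \<in> atlas M" "x \<in> fst c"
  then show "alternating_multilinear (\<lambda>xs. r *\<^sub>R \<omega> c x xs + s *\<^sub>R \<eta> c x xs)"
    by (intro alternating_add alternating_scaleR multi_formD(1)[OF \<omega>] multi_formD(1)[OF \<eta>])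
next
  fix c xs assume c: "c \<in> atlas M"
  note chart = riemannian_manifoldD(1)[OF M c]
  show "smooth_in_chart c UNIV (\<lambda>x. r *\<^sub>R \<omega> c x xs + s *\<^sub>R \<eta> c x xs)"
    by (intro smooth_in_chart_add[OF chart open_UNIV] smooth_in_chart_linear[OF chart open_UNIV bounded_linear_scaleR_right]
        multi_formD(2)[OF \<omega> c] multi_formD(2)[OF \<eta> c])
next
  fix c c' x xs assume "c \<in> atlas M" "c' \<in> atlas M" "x \<in> fst c \<inter> fst c'"
  then show "r *\<^sub>R \<omega> c' x (map (deriv_in c (snd c') x) xs) + s *\<^sub>R \<eta> c' x (map (deriv_in c (snd c') x) xs)
      = r *\<^sub>R \<omega> c x xs + s *\<^sub>R \<eta> c x xs"
    by (simp only: multi_formD(3)[OF \<omega>] multi_formD(3)[OF \<eta>])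
qed

text \<open>As for the metric, smoothness is given for constant arguments, so the field is expanded
  in the coordinate basis.\<close>

lemma smooth_contract_field:
  assumes M: "riemannian_manifold M" and \<omega>: "multi_form M \<omega>" and c: "c \<in> atlas M"
    and W: "open W" and X: "smooth_in_chart c W X"
  shows "smooth_in_chart c W (\<lambda>y. \<omega> c y (X y # xs))"
proof -
  note chart = riemannian_manifoldD(1)[OF M c]
  have "smooth_in_chart c W (\<lambda>y. \<Sum>k\<in>UNIV. X y $ k *\<^sub>R \<omega> c y (axis k 1 # xs))"
    by (intro smooth_in_chart_sum[OF chart W] smooth_in_chart_scaleR[OF chart W]
        smooth_in_chart_linear[OF chart W bounded_linear_vec_nth X]
        smooth_in_chart_subset[OF multi_formD(2)[OF \<omega> c] subset_UNIV])
  then show ?thesis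
  proof (rule smooth_in_chart_cong[OF chart W, rotated])
    fix y assume "y \<in> fst c \<inter> W"
    then show "(\<Sum>k\<in>UNIV. X y $ k *\<^sub>R \<omega> c y (axis k 1 # xs)) = \<omega> c y (X y # xs)"
      using linear_axis[OF alternating_Cons_linear[OF multi_formD(1)[OF \<omega> c, of y]], of "X y" xs] by simp
  qed
qed

lemma multi_form_wedge1:
  fixes F :: "('m::{t2_space, second_countable_topology}, 'n::finite, real) mform"
  assumes M: "riemannian_manifold M" and F: "multi_form M F" and \<omega>: "multi_form M \<omega>"
  shows "multi_form M (wedge1 F \<omega>)"
  unfolding multi_form_def
proof (intro conjI ballI allI)
  fix c x assume cx: "c \<in> atlas M" "x \<in> fst c"
  then have "linear (\<lambda>v. F c x [v])" by (intro alternating_Cons_linear multi_formD(1)[OF F])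
  then show "alternating_multilinear (wedge1 F \<omega> c x)"
    unfolding wedge1_eq using cx by (intro alternating_covector_wedge multi_formD(1)[OF \<omega>])
next
  fix c xs assume c: "c \<in> atlas M"
  note chart = riemannian_manifoldD(1)[OF M c]
  show "smooth_in_chart c UNIV (\<lambda>x. wedge1 F \<omega> c x xs)"
    unfolding wedge1_def
    by (intro smooth_in_chart_sum[OF chart open_UNIV] smooth_in_chart_scaleR[OF chart open_UNIV]
        smooth_in_chart_linear[OF chart open_UNIV bounded_linear_mult_right]
        multi_formD(2)[OF \<omega> c] multi_formD(2)[OF F c])
next
  fix c c' x xs assume h: "c \<in> atlas M" "c' \<in> atlas M" "x \<in> fst c \<inter> fst c'"
  have "F c' x [deriv_in c (snd c') x u] = F c x [u]" for u
    using multi_formD(3)[OF F h, of "[u]"] by simp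
  then show "wedge1 F \<omega> c' x (map (deriv_in c (snd c') x) xs) = wedge1 F \<omega> c x xs"
    by (simp add: wedge1_eq covector_wedge_map multi_formD(3)[OF \<omega> h])
qed

context spin_manifold
begin

lemma spin_point: "a \<in> frames S \<Longrightarrow> c \<in> atlas S \<Longrightarrow> x \<in> fst c \<inter> dom_of S a \<Longrightarrow> spin_point S a c x"
  by unfold_locales auto

lemma frame_smooth: "a \<in> frames S \<Longrightarrow> c \<in> atlas S \<Longrightarrow> smooth_in_chart c (dom_of S a) (frame S a i c)"
  using frame_vector_field by (auto simp: vector_field_on_def)

lemma frame_transform:
  "a \<in> frames S \<Longrightarrow> c \<in> atlas S \<Longrightarrow> c' \<in> atlas S \<Longrightarrow> x \<in> fst c \<inter> fst c' \<inter> dom_of S a \<Longrightarrow>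
    frame S a i c' x = deriv_in c (snd c') x (frame S a i c x)"
  using frame_vector_field[of a i] unfolding vector_field_on_def by blast

text \<open>\<open>sharp\<close> is a definite description; its smoothness and its behaviour under a
  change of chart are read off from its expansion in a local frame.\<close>

lemma multi_form_contract_sharp:
  fixes F :: "('m, 'n, real) mform" and \<omega> :: "('m, 'n, 'b::real_normed_vector) mform"
  assumes F: "multi_form S F" and \<omega>: "multi_form S \<omega>"
  shows "multi_form S (contract (sharp S F) \<omega>)"
  unfolding multi_form_def contract_def
proof (intro conjI ballI allI)
  fix c x assume "c \<in> atlas S" "x \<in> fst c"
  then show "alternating_multilinear (\<lambda>xs. \<omega> c x (sharp S F c x # xs))"
    by (intro alternating_contract multi_formD(1)[OF \<omega>])
next
  fix c xs assume c: "c \<in> atlas S"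
  note chart = riemannian_manifoldD(1)[OF riem c]
  show "smooth_in_chart c UNIV (\<lambda>x. \<omega> c x (sharp S F c x # xs))"
  proof (rule smooth_in_chart_local[OF chart])
    fix x
    obtain a where a: "a \<in> frames S" "x \<in> dom_of S a" using frame_cover by blast
    note W = open_dom[OF a(1)]
    have "smooth_in_chart c (dom_of S a) (\<lambda>x. \<Sum>k\<in>UNIV. F c x [frame S a k c x] *\<^sub>R \<omega> c x (frame S a k c x # xs))"
      by (intro smooth_in_chart_sum[OF chart W] smooth_in_chart_scaleR[OF chart W]
          smooth_contract_field[OF riem F c W] smooth_contract_field[OF riem \<omega> c W] frame_smooth a c)
    then have "smooth_in_chart c (dom_of S a) (\<lambda>x. \<omega> c x (sharp S F c x # xs))"
    proof (rule smooth_in_chart_cong[OF chart W, rotated])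
      fix y assume y: "y \<in> fst c \<inter> dom_of S a"
      interpret p: spin_point S a c y by (rule spin_point[OF a(1) c y])
      have lin: "linear (\<lambda>v. \<omega> c y (v # xs))"
        using y by (intro alternating_Cons_linear multi_formD(1)[OF \<omega> c]) simp
      show "(\<Sum>k\<in>UNIV. F c y [frame S a k c y] *\<^sub>R \<omega> c y (frame S a k c y # xs)) = \<omega> c y (sharp S F c y # xs)"
        by (simp add: p.sharp_expand(1)[OF F] linear_sum[OF lin] linear_scale[OF lin])
    qed
    then show "\<exists>V. open V \<and> x \<in> V \<and> smooth_in_chart c V (\<lambda>x. \<omega> c x (sharp S F c x # xs))"
      using W a(2) by blast
  qed
next
  fix c c' x xs assume h: "c \<in> atlas S" "c' \<in> atlas S" "x \<in> fst c \<inter> fst c'"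
  let ?J = "deriv_in c (snd c') x"
  obtain a where a: "a \<in> frames S" "x \<in> dom_of S a" using frame_cover by blast
  interpret p: spin_point S a c x using h a by (intro spin_point) auto
  interpret p': spin_point S a c' x using h a by (intro spin_point) auto
  have J: "linear ?J"
    using h by (intro deriv_in_linear[OF riemannian_manifoldD(4)[OF riem h(1,2)]]) simp
  have eJ: "frame S a k c' x = ?J (frame S a k c x)" for k
    using h a by (intro frame_transform) auto
  have "F c' x [?J (frame S a k c x)] = F c x [frame S a k c x]" for k
    using multi_formD(3)[OF F h, of "[frame S a k c x]"] by simp
  then have "sharp S F c' x = ?J (sharp S F c x)"
    by (simp add: p.sharp_expand(1)[OF F] p'.sharp_expand(1)[OF F] linear_sum[OF J] linear_scale[OF J] eJ)
  then show "\<omega> c' x (sharp S F c' x # map ?J xs) = \<omega> c x (sharp S F c x # xs)"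
    using multi_formD(3)[OF \<omega> h, of "sharp S F c x # xs"] by simp
qed

lemma smooth_cl:
  assumes a: "a \<in> frames S" and c: "c \<in> atlas S"
  shows "smooth_in_chart c (dom_of S a) (\<lambda>y. cl S a c y v)"
proof -
  note chart = riemannian_manifoldD(1)[OF riem c] and W = open_dom[OF a]
  have "smooth_in_chart c (dom_of S a)
      (\<lambda>y. \<Sum>i\<in>UNIV. (\<Sum>k\<in>UNIV. frame S a i c y $ k *\<^sub>R gm S c y v (axis k 1)) *\<^sub>R gam S i)"
    by (intro smooth_in_chart_sum[OF chart W] smooth_in_chart_scaleR[OF chart W] smooth_in_chart_const
        smooth_in_chart_linear[OF chart W bounded_linear_vec_nth frame_smooth[OF a c]]
        smooth_in_chart_subset[OF riemannian_manifoldD(2)[OF riem c] subset_UNIV])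
  then show ?thesis
  proof (rule smooth_in_chart_cong[OF chart W, rotated])
    fix y assume "y \<in> fst c \<inter> dom_of S a"
    then have "linear (gm S c y v)"
      by (intro inner_product_formD(3) riemannian_manifoldD(3)[OF riem c]) simp
    from linear_axis[OF this, symmetric]
    show "(\<Sum>i\<in>UNIV. (\<Sum>k\<in>UNIV. frame S a i c y $ k *\<^sub>R gm S c y v (axis k 1)) *\<^sub>R gam S i) = cl S a c y v"
      by (simp only: cl_def cliff_def vec_lambda_beta)
  qed
qed

lemma smooth_clifford_alt:
  assumes a: "a \<in> frames S" and c: "c \<in> atlas S"
  shows "smooth_in_chart c (dom_of S a) (\<lambda>y. clifford_alt (cl S a c y) xs)"
proof -
  note chart = riemannian_manifoldD(1)[OF riem c] and W = open_dom[OF a]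
  have "smooth_in_chart c (dom_of S a) (\<lambda>y. clifford_word (cl S a c y) ys)" for ys
  proof (induction ys)
    case Nil
    show ?case by (simp add: smooth_in_chart_const)
  next
    case (Cons v ys)
    show ?case
      unfolding clifford_word_simps
      by (rule smooth_in_chart_bilinear[OF chart W bounded_bilinear_matrix_matrix_mult smooth_cl[OF a c] Cons.IH])
  qed
  then show ?thesis
    unfolding antisymmetrize_def
    by (intro smooth_in_chart_scaleR[OF chart W] smooth_in_chart_sum[OF chart W] smooth_in_chart_const)
qed

text \<open>Smoothness is local and visible in one frame. A change of chart pushes vectors and frame
  forward by the same Jacobian, so \<open>cl\<close> is unchanged.\<close>

lemma multi_form_spinor_multi_form:
  assumes \<epsilon>: "spinor_field S \<epsilon>"
  shows "multi_form S (spinor_multi_form S \<epsilon>)"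
  unfolding multi_form_def
proof (intro conjI ballI allI)
  fix c x assume h: "c \<in> atlas S" "x \<in> fst c"
  obtain a where a: "a \<in> frames S" "x \<in> dom_of S a" using frame_cover by blast
  interpret p: spin_point S a c x using h a by (intro spin_point) auto
  show "alternating_multilinear (spinor_multi_form S \<epsilon> c x)"
    by (rule p.alternating_spinor_multi_form[OF \<epsilon>])
next
  fix c xs assume c: "c \<in> atlas S"
  note chart = riemannian_manifoldD(1)[OF riem c]
  show "smooth_in_chart c UNIV (\<lambda>x. spinor_multi_form S \<epsilon> c x xs)"
  proof (rule smooth_in_chart_local[OF chart])
    fix x
    obtain a where a: "a \<in> frames S" "x \<in> dom_of S a" using frame_cover by blast
    note W = open_dom[OF a(1)]
    have s\<epsilon>: "smooth_in_chart c (dom_of S a) (\<epsilon> a)"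
      using \<epsilon> a c by (simp add: spinor_field_def)
    have "smooth_in_chart c (dom_of S a)
        (\<lambda>y. \<i> ^ (length xs div 2) * ip S (\<epsilon> a y) (clifford_alt (cl S a c y) xs *v \<epsilon> a y))"
      by (rule smooth_in_chart_linear[OF chart W bounded_linear_mult_right]
          smooth_in_chart_bilinear[OF chart W bilinear_ip]
          smooth_in_chart_bilinear[OF chart W bounded_bilinear_matrix_vector_mult]
          smooth_clifford_alt[OF a(1) c] s\<epsilon>)+
    then have "smooth_in_chart c (dom_of S a) (\<lambda>x. spinor_multi_form S \<epsilon> c x xs)"
      by (rule smooth_in_chart_cong[OF chart W, rotated]) (simp add: spinor_multi_form_frame[OF \<epsilon> a(1) c])
    then show "\<exists>V. open V \<and> x \<in> V \<and> smooth_in_chart c V (\<lambda>x. spinor_multi_form S \<epsilon> c x xs)"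
      using W a(2) by blast
  qed
next
  fix c c' x xs assume h: "c \<in> atlas S" "c' \<in> atlas S" "x \<in> fst c \<inter> fst c'"
  let ?J = "deriv_in c (snd c') x"
  obtain a where a: "a \<in> frames S" "x \<in> dom_of S a" using frame_cover by blast
  have "frame S a k c' x = ?J (frame S a k c x)" for k
    using h a by (intro frame_transform) auto
  then have "cl S a c' x (?J v) = cl S a c x v" for v
    by (simp add: cl_def riemannian_manifoldD(5)[OF riem h])
  then have "clifford_word (cl S a c' x) (map ?J ys) = clifford_word (cl S a c x) ys" for ys
    by (induction ys) simp_all
  then have "clifford_alt (cl S a c' x) (map ?J xs) = clifford_alt (cl S a c x) xs"
    by (simp add: antisymmetrize_map)
  then show "spinor_multi_form S \<epsilon> c' x (map ?J xs) = spinor_multi_form S \<epsilon> c x xs"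
    using h a by (simp add: spinor_multi_form_frame[OF \<epsilon> a(1)])
qed

end

text \<open>With \<open>r = 2 * Re (2 * k\<^sub>1 + k\<^sub>2)\<close> this is the connection of the
  hierarchy: \<open>\<nabla>\<^sub>Y\<close> shifted by a multiple of the scalar
  \<open>A(Y)\<close>.\<close>

lemma connection_term_scale:
  assumes M: "riemannian_manifold M"
  shows "connection_term M (\<lambda>g F v \<psi> xs. (r * F [v]) *\<^sub>R \<psi> xs)"
  unfolding connection_term_def
proof (intro conjI allI impI)
  fix F :: "(real ^ 'b) list \<Rightarrow> real" and \<psi> :: "(real ^ 'b) list \<Rightarrow> 'd" and xs and g :: "real ^ 'b \<Rightarrow> real ^ 'b \<Rightarrow> real"
  assume "inner_product_form g \<and> alternating_multilinear F"
  then have "linear (\<lambda>v. F [v])" by (intro alternating_Cons_linear) simp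
  note lin = linear_add[OF this] linear_scale[OF this]
  show "linear (\<lambda>v. (r * F [v]) *\<^sub>R \<psi> xs)"
    by (rule linearI) (simp_all add: lin distrib_left scaleR_left_distrib)
next
  fix F :: "('a, 'b, real) mform" and Y :: "('a, 'b) vfield" and \<psi> :: "('a, 'b, 'd) mform"
  assume "multi_form M F \<and> vector_field M Y \<and> multi_form M \<psi>"
  then have F: "multi_form M F" and Y: "vector_field M Y" and \<psi>: "multi_form M \<psi>" by auto
  show "multi_form M (\<lambda>c x xs. (r * F c x [Y c x]) *\<^sub>R \<psi> c x xs)"
    unfolding multi_form_def
  proof (intro conjI ballI allI)
    fix c x assume "c \<in> atlas M" "x \<in> fst c"
    then show "alternating_multilinear (\<lambda>xs. (r * F c x [Y c x]) *\<^sub>R \<psi> c x xs)"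
      by (intro alternating_scaleR multi_formD(1)[OF \<psi>])
  next
    fix c xs assume c: "c \<in> atlas M"
    note chart = riemannian_manifoldD(1)[OF M c]
    have "smooth_in_chart c UNIV (Y c)" using Y c by (simp add: vector_field_on_def)
    then show "smooth_in_chart c UNIV (\<lambda>x. (r * F c x [Y c x]) *\<^sub>R \<psi> c x xs)"
      by (intro smooth_in_chart_scaleR[OF chart open_UNIV] multi_formD(2)[OF \<psi> c]
          smooth_in_chart_linear[OF chart open_UNIV bounded_linear_mult_right]
          smooth_contract_field[OF M F c open_UNIV])
  next
    fix c c' x xs assume h: "c \<in> atlas M" "c' \<in> atlas M" "x \<in> fst c \<inter> fst c'"
    have "Y c' x = deriv_in c (snd c') x (Y c x)"
      using Y h unfolding vector_field_on_def by blast
    then have "F c' x [Y c' x] = F c x [Y c x]"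
      using multi_formD(3)[OF F h, of "[Y c x]"] by (simp only: list.map)
    then show "(r * F c' x [Y c' x]) *\<^sub>R \<psi> c' x (map (deriv_in c (snd c') x) xs) = (r * F c x [Y c x]) *\<^sub>R \<psi> c x xs"
      by (simp add: multi_formD(3)[OF \<psi> h])
  qed
qed (simp add: algebra_simps)

theorem corollary3p2p1:
  fixes S :: "('m::{t2_space, second_countable_topology}, 'n::finite, 'i, 's::finite) spin_riemannian"
    and A :: "('m, 'n, real) mform"
    and k\<^sub>1 k\<^sub>2 :: complex
    and \<epsilon> :: "('m, 'i, 's) spinor"
  assumes "spin_riemannian_manifold S"
    and "p_form S 1 A"
    and "spinor_field S \<epsilon>"
    and "hat_parallel S k\<^sub>1 k\<^sub>2 A \<epsilon>"
  shows "covariant_form_hierarchy S A (spinor_multi_form S \<epsilon>) \<and>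
    (\<forall>p Y. vector_field S Y \<longrightarrow>
      form_eq S
        (\<lambda>c x xs. nabla S Y (spinor_form S \<epsilon> p) c x xs
           + (2 * Re (2 * k\<^sub>1 + k\<^sub>2) * A c x [Y c x]) *\<^sub>R spinor_form S \<epsilon> p c x xs)
        (\<lambda>c x xs.
           (1 / (real p + 1)) *\<^sub>R
             contract Y (\<lambda>c x xs. ext_d (spinor_form S \<epsilon> p) c x xs
               + (2 * Re (2 * k\<^sub>1 + k\<^sub>2)) *\<^sub>R wedge1 A (spinor_form S \<epsilon> p) c x xs) c x xs
           - (1 / (real CARD('n) - real p + 1)) *\<^sub>R
             wedge1 (flat S Y) (\<lambda>c x xs. codiff S (spinor_form S \<epsilon> p) c x xs
               - (2 * Re (2 * k\<^sub>1 + k\<^sub>2)) *\<^sub>R contract (sharp S A) (spinor_form S \<epsilon> p) c x xs) c x xs))"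
proof -
  interpret spin_manifold S by (unfold_locales) (rule assms(1))
  have A: "multi_form S A" using assms(2) by (simp add: p_form_def)
  note \<epsilon> = assms(3) and par = assms(4)
  have point: "\<exists>a. spin_point S a c x" if "c \<in> atlas S" "x \<in> fst c" for c x
    using frame_cover[of x] spin_point that by blast
  \<comment> \<open>A hierarchy asks for maps on all multi-forms, so in \<open>T\<close>,
    \<open>P\<close> and \<open>Q\<close> both \<open>A\<close> and the bilinears become
    variables.\<close>
  define T where "T g F v \<psi> xs = (2 * Re (2 * k\<^sub>1 + k\<^sub>2) * F [v]) *\<^sub>R \<psi> xs"
    for g :: "real ^ 'n \<Rightarrow> real ^ 'n \<Rightarrow> real" and F :: "(real ^ 'n) list \<Rightarrow> real" and v
      and \<psi> :: "(real ^ 'n) list \<Rightarrow> complex" and xs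
  define P where "P F \<psi> c x xs = hierarchy_P k\<^sub>1 (\<lambda>v. F c x [v]) (sharp S F c x) (\<psi> c x) xs"
    for F :: "('m, 'n, real) mform" and \<psi> :: "('m, 'n, complex) mform" and c x xs
  define Q where "Q F \<psi> c x xs = hierarchy_Q k\<^sub>1 (\<lambda>v. F c x [v]) (sharp S F c x) (\<psi> c x) xs"
    for F :: "('m, 'n, real) mform" and \<psi> :: "('m, 'n, complex) mform" and c x xs
  have "covariant_form_hierarchy S A (spinor_multi_form S \<epsilon>)"
    unfolding covariant_form_hierarchy_def
  proof (intro conjI exI allI impI)
    show "connection_term S T"
      unfolding T_def by (rule connection_term_scale[OF riem])
    fix F :: "('m, 'n, real) mform" and \<psi> :: "('m, 'n, complex) mform" assume "multi_form S F \<and> multi_form S \<psi>"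
    then have w: "multi_form S (wedge1 F \<psi>)" and i: "multi_form S (contract (sharp S F) \<psi>)"
      by (auto intro: multi_form_wedge1[OF riem] multi_form_contract_sharp)
    \<comment> \<open>Both maps combine \<open>F \<and> \<psi>\<close> and the contraction of
      \<open>\<psi>\<close> with the dual of \<open>F\<close> with constant coefficients.\<close>
    have "P F \<psi> = (\<lambda>c x xs. (2 * Re k\<^sub>1) *\<^sub>R wedge1 F \<psi> c x xs
        + (- 2 * Im k\<^sub>1) *\<^sub>R contract (sharp S F) \<psi> c x xs)"
      by (simp add: P_def hierarchy_P_def wedge1_eq contract_def fun_eq_iff)
    then show "multi_form S (P F \<psi>)"
      using multi_form_linear_combination[OF riem w i, of "2 * Re k\<^sub>1" "- 2 * Im k\<^sub>1"] by simp
    have "Q F \<psi> = (\<lambda>c x xs. (2 * Re k\<^sub>1) *\<^sub>R contract (sharp S F) \<psi> c x xs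
        + (2 * Im k\<^sub>1) *\<^sub>R wedge1 F \<psi> c x xs)"
      by (simp add: Q_def hierarchy_Q_def wedge1_eq contract_def fun_eq_iff)
    then show "multi_form S (Q F \<psi>)"
      using multi_form_linear_combination[OF riem i w, of "2 * Re k\<^sub>1" "2 * Im k\<^sub>1"] by simp
  next
    fix Y :: "('m, 'n) vfield"
    show "form_eq S
       (\<lambda>c x xs. nabla S Y (spinor_multi_form S \<epsilon>) c x xs
          + T (gm S c x) (A c x) (Y c x) (spinor_multi_form S \<epsilon> c x) xs)
       (\<lambda>c x xs. contract Y (P A (spinor_multi_form S \<epsilon>)) c x xs
          + wedge1 (flat S Y) (Q A (spinor_multi_form S \<epsilon>)) c x xs)"
      unfolding form_eq_def
    proof (intro ballI allI)
      fix c x xs assume "c \<in> atlas S" "x \<in> fst c"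
      then obtain a where "spin_point S a c x" using point by blast
      then interpret p: spin_point S a c x .
      have "wedge1 (flat S Y) (Q A (spinor_multi_form S \<epsilon>)) c x xs
          = covector_wedge (gm S c x (Y c x)) (Q A (spinor_multi_form S \<epsilon>) c x) xs"
        unfolding wedge1_eq flat_def by simp
      then show "nabla S Y (spinor_multi_form S \<epsilon>) c x xs
          + T (gm S c x) (A c x) (Y c x) (spinor_multi_form S \<epsilon> c x) xs
        = contract Y (P A (spinor_multi_form S \<epsilon>)) c x xs
          + wedge1 (flat S Y) (Q A (spinor_multi_form S \<epsilon>)) c x xs"
        using p.nabla_spinor_multi_form[OF \<epsilon> A par, of "Y c x" xs]
        by (simp only: nabla_def T_def contract_def P_def Q_def[abs_def])
    qed
  qed (rule A multi_form_spinor_multi_form[OF \<epsilon>])+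
  moreover have "form_eq S
        (\<lambda>c x xs. nabla S Y (spinor_form S \<epsilon> p) c x xs
           + (2 * Re (2 * k\<^sub>1 + k\<^sub>2) * A c x [Y c x]) *\<^sub>R spinor_form S \<epsilon> p c x xs)
        (\<lambda>c x xs.
           (1 / (real p + 1)) *\<^sub>R
             contract Y (\<lambda>c x xs. ext_d (spinor_form S \<epsilon> p) c x xs
               + (2 * Re (2 * k\<^sub>1 + k\<^sub>2)) *\<^sub>R wedge1 A (spinor_form S \<epsilon> p) c x xs) c x xs
           - (1 / (real CARD('n) - real p + 1)) *\<^sub>R
             wedge1 (flat S Y) (\<lambda>c x xs. codiff S (spinor_form S \<epsilon> p) c x xs
               - (2 * Re (2 * k\<^sub>1 + k\<^sub>2)) *\<^sub>R contract (sharp S A) (spinor_form S \<epsilon> p) c x xs) c x xs)" for p Y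
    unfolding form_eq_def
  proof (intro ballI allI)
    fix c x xs assume "c \<in> atlas S" "x \<in> fst c"
    then obtain a where "spin_point S a c x" using point by blast
    then show "nabla S Y (spinor_form S \<epsilon> p) c x xs
           + (2 * Re (2 * k\<^sub>1 + k\<^sub>2) * A c x [Y c x]) *\<^sub>R spinor_form S \<epsilon> p c x xs
        = (1 / (real p + 1)) *\<^sub>R
             contract Y (\<lambda>c x xs. ext_d (spinor_form S \<epsilon> p) c x xs
               + (2 * Re (2 * k\<^sub>1 + k\<^sub>2)) *\<^sub>R wedge1 A (spinor_form S \<epsilon> p) c x xs) c x xs
           - (1 / (real CARD('n) - real p + 1)) *\<^sub>R
             wedge1 (flat S Y) (\<lambda>c x xs. codiff S (spinor_form S \<epsilon> p) c x xs
               - (2 * Re (2 * k\<^sub>1 + k\<^sub>2)) *\<^sub>R contract (sharp S A) (spinor_form S \<epsilon> p) c x xs) c x xs"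
      by (rule spin_point.hierarchy_equation[OF _ \<epsilon> A par])
  qed
  ultimately show ?thesis by blast
qed

end
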